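(* Let $x=[x_0;x_1,x_2,\dots]$ be an irrational number such that the inequality $\left|x-\frac{p}{q}\right|<\frac{1}{3q^2}$ has only finitely many rational solutions $\frac{p}{q}$, and let $N\in\mathbb{N}$ be minimal such that $\lambda_n(x)\leq 3$ for all $n\geq N+1$. (i) If the continued fraction of $x$ is ultimately periodic, then there is $(\alpha,\beta)\in\overline{P}$ such that $x_{N+1}x_{N+2}x_{N+3}\dots$ equals one of $(\beta^T)^\infty$, $\ \beta^T(\alpha^T)^\infty$, $\ 2\alpha^{+}\alpha^\infty$, $\ 2\alpha^{+}\beta^\infty$. Moreover, if $N\geq 1$ and $x_{N+1}x_{N+2}\dots\neq a^\infty, b^\infty$, then: when $x_{N+1}=1$ there is a unique factorization $x_{N+1}x_{N+2}\dots=\theta^Tb\,a\theta R$ (with $\theta$ a finite word and $R$ a right infinite word over $\{a,b\}$), and it satisfies $[0;x_N,\dots,x_1]<[0;R]$; when $x_{N+1}=2$ there is a unique factorization $2x_{N+1}x_{N+2}\dots=\theta^Ta\,b\theta R$, and it satisfies $[0;x_N,\dots,x_1]<[0;2,R]$. (ii) If the continued fraction of $x$ is not ultimately periodic, then there is a sequence of pairs $(\alpha_n,\beta_n)$ with $(\alpha_0,\beta_0)=(a,b)$ and $(\alpha_{n+1},\beta_{n+1})\in\{\overline{U}(\alpha_n,\beta_n),\overline{V}(\alpha_n,\beta_n)\}$ for all $n$, in which both $\overline{U}$ and $\overline{V}$ are applied infinitely many times, such that: either $x_{N+1}=1$, $x_{N+1}x_{N+2}x_{N+3}\dots=\lim_{n\to\infty}\beta_n^T$,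 and if $N\geq1$ then $[0;x_N,\dots,x_1]<[0;\lim_{n\to\infty}\alpha_n]$; or $x_{N+1}=2$, $x_{N+1}x_{N+2}x_{N+3}\dots=\lim_{n\to\infty}2\alpha_n^{+}$, and if $N\geq1$ then $[0;x_N,\dots,x_1]<[0;2,\lim_{n\to\infty}\beta_n^T]$. (iii) Conversely, let $N\in\mathbb{N}$ and let $x=[x_0;x_1,x_2,\dots]$ be an irrational number whose continued fraction has one of the forms described in (i) (and, if $N\geq1$ and $x_{N+1}x_{N+2}\dots\neq a^\infty,b^\infty$, the unique factorization of the form described in (i) satisfies the corresponding inequality there) or one of the forms described in (ii) (including the corresponding inequality when $N\geq1$). Then the inequality $\left|x-\frac{p}{q}\right|<\frac{1}{3q^2}$ has at most $N$ rational solutions.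
   Context: Continued fractions: $[y_0;y_1,y_2,\dots]$ denotes $y_0+\frac{1}{y_1+\frac{1}{y_2+\cdots}}$ (finite or infinite); for a word $w=w_1w_2\dots$ of positive integers, $[0;w]=[0;w_1,w_2,\dots]$ and $[0;2,w]=[0;2,w_1,w_2,\dots]$. The letters $a$ and $b$ denote the two-digit blocks $a=22$ and $b=11$; every word over $\{a,b\}$ is identified with the word over $\{1,2\}$ obtained by substituting these blocks, and a prefixed "$2$" (as in $2\alpha^+$) denotes the single digit $2$. For a finite word $w$ over $\{a,b\}$: $w^T$ is its reversal; $w^{+}$ (resp. $w^{-}$) is $w$ with its first (resp. last) letter from $\{a,b\}$ removed; $w^\infty=www\cdots$. For a right infinite word $R$, $R^T$ is the corresponding left infinite word. Exterior renormalization operators on pairs of finite words over $\{a,b\}$: $\overline{U}(\alpha,\beta)=(\alpha\beta,\beta)$, $\overline{V}(\alpha,\beta)=(\alpha,\alpha\beta)$. $\overline{P}$ is the set of all pairs obtained from $(a,b)$ by finitely many (possibly zero) applications of $\overline{U},\overline{V}$. A sequence of finite words $w_n$ converges to a right (resp. left) infinite word $\omega=\lim_{n\to\infty}w_n$ if every prefix (resp. suffix) of $\omega$ is a prefix (resp. suffix) of all but finitely many $w_n$. For an irrational $x=[x_0;x_1,x_2,\dots]$ and $n\geq 1$, $\lambda_n(x)=[x_n;x_{n+1},x_{n+2},\dots]+[0;x_{n-1},x_{n-2},\dots,x_1]$ (the second term is $0$ for $n=1$).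
   Formalization: The factorization need not be unique (ba(baa)^∞ has θ empty and θ=ab), so (i) is proved as: there is a unique factorization with longest θ, and every factorization satisfies the inequality; in (iii) the inequality is assumed for the factorization with longest θ. *)

theory Defs
  imports "HOL-Analysis.Analysis" "HOL-Library.Stream" "HOL-Library.Sublist"
begin

subsection \<open>Continued fractions\<close>

text \<open>The list \<open>[y\<^sub>0, y\<^sub>1, \<dots>, y\<^sub>n]\<close> stands for \<open>[y\<^sub>0; y\<^sub>1, \<dots>, y\<^sub>n]\<close>;
  the value at the empty list is never used.\<close>

fun cf_list :: "int list \<Rightarrow> real" where
  "cf_list [] = 0"
| "cf_list [y] = of_int y"
| "cf_list (y # z # ys) = of_int y + 1 / cf_list (z # ys)"

definition cf_stream :: "int stream \<Rightarrow> real" where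
  "cf_stream ys = lim (\<lambda>n. cf_list (stake (Suc n) ys))"

definition has_cf :: "real \<Rightarrow> int stream \<Rightarrow> bool" where
  "has_cf x xs \<longleftrightarrow>
     (\<forall>n\<ge>1. xs !! n \<ge> 1) \<and> (\<lambda>n. cf_list (stake (Suc n) xs)) \<longlonglongrightarrow> x"

text \<open>\<open>cf_past xs N\<close> is \<open>[0; x\<^sub>N, x\<^sub>N\<^sub>-\<^sub>1, \<dots>, x\<^sub>1]\<close>, which is \<open>0\<close> for \<open>N = 0\<close>, and
  \<open>cf_tail xs N\<close> is the digit word \<open>x\<^sub>N\<^sub>+\<^sub>1 x\<^sub>N\<^sub>+\<^sub>2 \<dots>\<close>.\<close>

definition cf_past :: "int stream \<Rightarrow> nat \<Rightarrow> real" where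
  "cf_past xs N = cf_list (0 # rev (stake N (stl xs)))"

definition cf_tail :: "int stream \<Rightarrow> nat \<Rightarrow> int stream" where
  "cf_tail xs N = sdrop (Suc N) xs"

definition cf_lambda :: "int stream \<Rightarrow> nat \<Rightarrow> real" where
  "cf_lambda xs n = cf_stream (sdrop n xs) + cf_past xs (n - 1)"

definition ultimately_periodic :: "'a stream \<Rightarrow> bool" where
  "ultimately_periodic s \<longleftrightarrow> (\<exists>k p. p > 0 \<and> (\<forall>n\<ge>k. s !! (n + p) = s !! n))"

text \<open>Solutions are counted as rational numbers, so different representations of the same
  fraction are identified.\<close>

definition approx_solutions :: "real \<Rightarrow> rat set" where
  "approx_solutions x =
     {r. \<exists>p q :: int. q > 0 \<and> r = Fract p q \<and>
           \<bar>x - of_int p / of_int q\<bar> < 1 / (3 * (of_int q)\<^sup>2)}"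

subsection \<open>Words over the blocks \<open>a = 22\<close> and \<open>b = 11\<close>\<close>

datatype letter = La | Lb

fun block :: "letter \<Rightarrow> int list" where
  "block La = [2, 2]"
| "block Lb = [1, 1]"

definition digits :: "letter list \<Rightarrow> int list" where
  "digits w = concat (map block w)"

definition sdigits :: "letter stream \<Rightarrow> int stream" where
  "sdigits R = flat (smap block R)"

fun Ubar :: "letter list \<times> letter list \<Rightarrow> letter list \<times> letter list" where
  "Ubar (\<alpha>, \<beta>) = (\<alpha> @ \<beta>, \<beta>)"

fun Vbar :: "letter list \<times> letter list \<Rightarrow> letter list \<times> letter list" where
  "Vbar (\<alpha>, \<beta>) = (\<alpha>, \<alpha> @ \<beta>)"

inductive_set Pbar :: "(letter list \<times> letter list) set" where
  base: "([La], [Lb]) \<in> Pbar"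
| U: "p \<in> Pbar \<Longrightarrow> Ubar p \<in> Pbar"
| V: "p \<in> Pbar \<Longrightarrow> Vbar p \<in> Pbar"

definition word_tendsto :: "(nat \<Rightarrow> 'a list) \<Rightarrow> 'a stream \<Rightarrow> bool" where
  "word_tendsto w \<omega> \<longleftrightarrow> (\<forall>k. \<forall>\<^sub>F n in sequentially. prefix (stake k \<omega>) (w n))"

subsection \<open>Tails with ultimately periodic continued fraction\<close>

definition periodic_form :: "int stream \<Rightarrow> bool" where
  "periodic_form W \<longleftrightarrow> (\<exists>(\<alpha>, \<beta>) \<in> Pbar.
     W = sdigits (cycle (rev \<beta>)) \<or>
     W = sdigits (rev \<beta> @- cycle (rev \<alpha>)) \<or>
     W = 2 ## digits (tl \<alpha>) @- sdigits (cycle \<alpha>) \<or>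
     W = 2 ## digits (tl \<alpha>) @- sdigits (cycle \<beta>))"

text \<open>\<open>factorization [c, d] W \<theta> R\<close> means \<open>W = \<theta>\<^sup>T c d \<theta> R\<close>.\<close>

definition factorization ::
  "letter list \<Rightarrow> int stream \<Rightarrow> letter list \<Rightarrow> letter stream \<Rightarrow> bool" where
  "factorization c W \<theta> R \<longleftrightarrow> W = sdigits ((rev \<theta> @ c @ \<theta>) @- R)"

text \<open>A word in \<^const>\<open>periodic_form\<close> can have several factorizations, as the lemma below shows.
  A longer \<open>\<theta>\<close> gives a stronger inequality between the past and \<open>R\<close>, so the factorization that
  has to be singled out is the one with the longest \<open>\<theta>\<close>. If there is just one factorization, it
  is that one.\<close>

definition longest_factorization ::
  "letter list \<Rightarrow> int stream \<Rightarrow> letter list \<Rightarrow> letter stream \<Rightarrow> bool" where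
  "longest_factorization c W \<theta> R \<longleftrightarrow> factorization c W \<theta> R \<and>
     (\<forall>\<theta>' R'. factorization c W \<theta>' R' \<longrightarrow> length \<theta>' \<le> length \<theta>)"

lemma factorization_not_unique:
  defines "W \<equiv> sdigits ([Lb, La] @- cycle [Lb, La, La])"
  shows "periodic_form W"
    and "factorization [Lb, La] W [] (cycle [Lb, La, La])"
    and "factorization [Lb, La] W [La, Lb] (cycle [La, La, Lb])"
proof -
  have "Ubar (Vbar ([La], [Lb])) \<in> Pbar"
    by (intro Pbar.intros)
  then have "([La, La, Lb], [La, Lb]) \<in> Pbar"
    by simp
  then show "periodic_form W"
    unfolding periodic_form_def W_def by (intro bexI) auto
  show "factorization [Lb, La] W [] (cycle [Lb, La, La])"
    by (simp add: factorization_def W_def)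
  have "cycle [Lb, La, La] = [Lb, La, La, Lb] @- cycle [La, La, Lb]"
    by (simp add: stream.expand)
  then show "factorization [Lb, La] W [La, Lb] (cycle [La, La, Lb])"
    by (simp add: factorization_def W_def)
qed

subsection \<open>Tails with aperiodic continued fraction\<close>

definition renormalization_sequence :: "(nat \<Rightarrow> letter list \<times> letter list) \<Rightarrow> bool" where
  "renormalization_sequence p \<longleftrightarrow>
     p 0 = ([La], [Lb]) \<and>
     (\<forall>n. p (Suc n) \<in> {Ubar (p n), Vbar (p n)}) \<and>
     infinite {n. p (Suc n) = Ubar (p n)} \<and>
     infinite {n. p (Suc n) = Vbar (p n)}"

definition aperiodic_form :: "int stream \<Rightarrow> nat \<Rightarrow> bool" where
  "aperiodic_form xs N \<longleftrightarrow>
     (\<exists>\<alpha> \<beta>. renormalization_sequence (\<lambda>n. (\<alpha> n, \<beta> n)) \<and>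
       (xs !! (N + 1) = 1 \<and>
        word_tendsto (\<lambda>n. digits (rev (\<beta> n))) (cf_tail xs N) \<and>
        (N \<ge> 1 \<longrightarrow> (\<exists>L. word_tendsto \<alpha> L \<and>
           cf_past xs N < cf_stream (0 ## sdigits L)))
      \<or> xs !! (N + 1) = 2 \<and>
        word_tendsto (\<lambda>n. 2 # digits (tl (\<alpha> n))) (cf_tail xs N) \<and>
        (N \<ge> 1 \<longrightarrow> (\<exists>L. word_tendsto (\<lambda>n. rev (\<beta> n)) L \<and>
           cf_past xs N < cf_stream (0 ## 2 ## sdigits L)))))"

end

theory Submission
  imports Defs
begin

text \<open>
  A rational solution is a convergent, and the convergent of index \<open>n\<close> is a solution iff
  \<open>\<lambda>\<^sub>n\<^sub>+\<^sub>1 > 3\<close>. The identity \<open>[2; 2, y] + [0; 1, 1, y] = 3\<close> turns \<open>\<lambda>\<^sub>n \<le> 3\<close> into a comparison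
  of the two words read outwards from a junction \<open>11|22\<close> or \<open>22|11\<close>. First it excludes odd runs of
  a digit (an odd run forces a shorter odd run further right), so that the tail is a word over
  \<open>a = 22\<close> and \<open>b = 11\<close>; since blocks have even length, the order of the values \<open>[0; R]\<close> is the
  lexicographic order of words with \<open>a < b\<close>. Exchanging the letters reduces tails that start with
  \<open>2\<close> to tails that start with \<open>1\<close>. The purely combinatorial part of the condition (\<open>markov\<close> below)
  is invariant under the transposed substitutions of \<open>U\<close> and \<open>V\<close>, and a word that satisfies it and
  starts with \<open>b\<close> is always the image of another such word, because \<open>aa\<close> and \<open>bb\<close> do not both
  occur. Iterating gives the two kinds of forms. The condition on the past only concerns the
  factorizations \<open>\<theta>\<^sup>T b a \<theta> R\<close>, a longer \<open>\<theta>\<close> gives a smaller \<open>R\<close>, and in the aperiodic case these \<open>R\<close>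
  decrease to the limit of the \<open>\<alpha>\<^sub>n\<close>. An ultimately periodic word has only finitely many of these
  factorizations, since reflection in the centre would identify the letters \<open>b\<close> and \<open>a\<close>.
\<close>

text \<open>A junction is first compared with the reversed block word before it; only when that word
  is used up, in a tie, does the comparison reach the real past. So \<lambda> \<le> 3 can hold at a
  junction in two ways. Minimality of \<open>N\<close> removes one of them: if the tail is
  \<open>11R\<close>, then \<lambda>_N > 3 says that the past is smaller than \<open>[0;22R]\<close>
  (for \<open>N = 0\<close> the past is 0), and this excludes ties at \<open>ab\<close>. Ties at
  \<open>ba\<close> remain, and they are exactly the factorizations. Hence the past survives only in
  the inequalities of the theorem. For a tail starting with 2, the prefixed 2 is not a digit of
  \<open>x\<close>: the first block \<open>22\<close> consists of it and \<open>x_{N+1}\<close>. In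
  a tie only \<open>x_{N+1}\<close> cancels, so the other 2 stays in \<open>[0;2,R]\<close>.
  Cancelling a single digit reverses the order, and the exchange of letters reverses it back. The
  past is rational and every value it is compared with is irrational. So weak and strict
  inequalities agree, and finitely many letters decide each comparison.\<close>

lemma snth_ext: "(\<And>n. s !! n = t !! n) \<Longrightarrow> s = t"
  using smap_alt[of id s t] by (simp add: stream.map_id0)

lemma stream_eq_stakeI: "(\<And>n. stake n s = stake n t) \<Longrightarrow> s = t"
  by (rule snth_ext) (metis lessI stake_nth)

lemma shift_eq_shift_same_length:
  "length u = length v \<Longrightarrow> u @- S = v @- T \<longleftrightarrow> u = v \<and> S = T"
  by (induction u v rule: list_induct2) auto

lemma flat_smap_Stream [simp]:
  "f c \<noteq> [] \<Longrightarrow> flat (smap f (c ## S)) = f c @- flat (smap f S)"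
  by (subst flat_unfold) auto

lemma flat_smap_shift:
  "(\<And>c. f c \<noteq> []) \<Longrightarrow> flat (smap f (w @- S)) = concat (map f w) @- flat (smap f S)"
  by (induction w) auto

subsection \<open>Lexicographic comparison\<close>

text \<open>The finite word is the reversed block word before a junction. If it ends without a
  difference, neither \<open>lex_gt\<close> nor \<open>lex_lt\<close> holds, because then the digits
  before the block word decide.\<close>

fun lex_gt :: "letter list \<Rightarrow> letter stream \<Rightarrow> bool" where
  "lex_gt [] R = False"
| "lex_gt (c # x) R = (if c = shd R then lex_gt x (stl R) else c = Lb)"

fun lex_lt :: "letter list \<Rightarrow> letter stream \<Rightarrow> bool" where
  "lex_lt [] R = False"
| "lex_lt (c # x) R = (if c = shd R then lex_lt x (stl R) else c = La)"

lemma lex_gt_shift: "lex_gt (w @ x) (w @- R) = lex_gt x R"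
  by (induction w) auto

lemma lex_lt_shift: "lex_lt (w @ x) (w @- R) = lex_lt x R"
  by (induction w) auto

lemma letter_neq: "c \<noteq> La \<longleftrightarrow> c = Lb" "c \<noteq> Lb \<longleftrightarrow> c = La"
  by (cases c; simp)+

lemma lex_gt_iff: "lex_gt x R \<longleftrightarrow> (\<exists>w x' R'. x = w @ Lb # x' \<and> R = w @- La ## R')"
proof
  assume "lex_gt x R"
  then show "\<exists>w x' R'. x = w @ Lb # x' \<and> R = w @- La ## R'"
  proof (induction x arbitrary: R)
    case (Cons c x)
    obtain e R1 where R: "R = e ## R1" by (cases R)
    show ?case
    proof (cases "c = e")
      case True
      then have "lex_gt x R1" using Cons.prems R by simp
      then obtain w x' R' where "x = w @ Lb # x'" "R1 = w @- La ## R'" using Cons.IH by blast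
      then show ?thesis
        using True R by (intro exI[of _ "c # w"] exI[of _ x'] exI[of _ R']) simp
    next
      case False
      then have "c = Lb" "e = La" using Cons.prems R by (cases c; cases e; simp)+
      then show ?thesis
        using R by (intro exI[of _ "[]"] exI[of _ x] exI[of _ R1]) simp
    qed
  qed simp
qed (auto simp: lex_gt_shift)

lemma lex_lt_iff: "lex_lt x R \<longleftrightarrow> (\<exists>w x' R'. x = w @ La # x' \<and> R = w @- Lb ## R')"
proof
  assume "lex_lt x R"
  then show "\<exists>w x' R'. x = w @ La # x' \<and> R = w @- Lb ## R'"
  proof (induction x arbitrary: R)
    case (Cons c x)
    obtain e R1 where R: "R = e ## R1" by (cases R)
    show ?case
    proof (cases "c = e")
      case True
      then have "lex_lt x R1" using Cons.prems R by simp
      then obtain w x' R' where "x = w @ La # x'" "R1 = w @- Lb ## R'" using Cons.IH by blast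
      then show ?thesis
        using True R by (intro exI[of _ "c # w"] exI[of _ x'] exI[of _ R']) simp
    next
      case False
      then have "c = La" "e = Lb" using Cons.prems R by (cases c; cases e; simp)+
      then show ?thesis
        using R by (intro exI[of _ "[]"] exI[of _ x] exI[of _ R1]) simp
    qed
  qed simp
qed (auto simp: lex_lt_shift)

lemma lex_gt_lt_prefix_cases: "lex_gt x R \<or> lex_lt x R \<or> (\<exists>R'. R = x @- R')"
proof (induction x arbitrary: R)
  case (Cons c x)
  show ?case
  proof (cases "c = shd R")
    case True
    then show ?thesis using Cons[of "stl R"] by (metis lex_gt.simps(2) lex_lt.simps(2) shift.simps(2) stream.collapse)
  qed (auto simp: letter_neq)
qed auto

lemma not_lex_gt_and_lex_lt: "lex_gt x R \<Longrightarrow> \<not> lex_lt x R"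
  by (induction x arbitrary: R) (auto split: if_splits)

lemma not_lex_gt_prefix: "\<not> lex_gt x (x @- R)" and not_lex_lt_prefix: "\<not> lex_lt x (x @- R)"
  by (induction x) auto

text \<open>The condition of an admissible word whose past is smaller than everything it is compared with.\<close>

definition markov :: "letter stream \<Rightarrow> bool" where
  "markov S \<longleftrightarrow> (\<forall>u R. S = u @- La ## Lb ## R \<longrightarrow> lex_gt (rev u) R)
     \<and> (\<forall>u R. S = u @- Lb ## La ## R \<longrightarrow> \<not> lex_gt (rev u) R)"

subsection \<open>Substitutions\<close>

text \<open>\<open>True\<close> stands for \<open>U\<close> and \<open>False\<close> for \<open>V\<close>.\<close>

fun renorm :: "bool \<Rightarrow> letter \<Rightarrow> letter list" where
  "renorm True La = [La, Lb]"
| "renorm True Lb = [Lb]"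
| "renorm False La = [La]"
| "renorm False Lb = [La, Lb]"

text \<open>The tails are built from reversed words, so a tail is desubstituted by
  \<open>renormT\<close>, while the word read backwards from a junction is an image under
  \<open>renorm\<close>.\<close>

definition renormT :: "bool \<Rightarrow> letter \<Rightarrow> letter list" where
  "renormT d c = rev (renorm d c)"

lemma renormT_simps [simp]:
  "renormT True La = [Lb, La]" "renormT True Lb = [Lb]"
  "renormT False La = [La]" "renormT False Lb = [Lb, La]"
  by (simp_all add: renormT_def)

lemma renorm_nonempty [simp]: "renorm d c \<noteq> []" by (cases d; cases c) auto
lemma renormT_nonempty [simp]: "renormT d c \<noteq> []" by (simp add: renormT_def)

definition lsub :: "bool \<Rightarrow> letter list \<Rightarrow> letter list" where "lsub d w = concat (map (renorm d) w)"
definition ltsub :: "bool \<Rightarrow> letter list \<Rightarrow> letter list" where "ltsub d w = concat (map (renormT d) w)"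
definition ssub :: "bool \<Rightarrow> letter stream \<Rightarrow> letter stream" where "ssub d S = flat (smap (renorm d) S)"
definition stsub :: "bool \<Rightarrow> letter stream \<Rightarrow> letter stream" where "stsub d S = flat (smap (renormT d) S)"

lemma lsub_simps [simp]: "lsub d [] = []" "lsub d (c # w) = renorm d c @ lsub d w"
  "lsub d (v @ w) = lsub d v @ lsub d w"
  by (simp_all add: lsub_def)
lemma ltsub_simps [simp]: "ltsub d [] = []" "ltsub d (c # w) = renormT d c @ ltsub d w"
  "ltsub d (v @ w) = ltsub d v @ ltsub d w"
  by (simp_all add: ltsub_def)
lemma ssub_simps [simp]: "ssub d (c ## S) = renorm d c @- ssub d S"
  "ssub d (w @- S) = lsub d w @- ssub d S"
  by (simp_all add: ssub_def lsub_def flat_smap_shift del: smap_shift)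
lemma stsub_simps [simp]: "stsub d (c ## S) = renormT d c @- stsub d S"
  "stsub d (w @- S) = ltsub d w @- stsub d S"
  by (simp_all add: stsub_def ltsub_def flat_smap_shift del: smap_shift)

lemma rev_ltsub [simp]: "rev (ltsub d w) = lsub d (rev w)"
  by (induction w) (auto simp: renormT_def)
lemma rev_lsub [simp]: "rev (lsub d w) = ltsub d (rev w)"
  by (induction w) (auto simp: renormT_def)

text \<open>The substitutions \<open>renorm True\<close> and \<open>renormT True\<close> are
  conjugate by the letter \<open>b\<close>, as \<open>ba b = b ab\<close>. Moving this letter across
  turns what follows a junction into an image under the same substitution as the reversed word
  before it.\<close>

lemma ltsub_True_Lb: "ltsub True w @ [Lb] = Lb # lsub True w"
proof (induction w)
  case (Cons c w) then show ?case by (cases c) auto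
qed auto
text \<open>Here the conjugating letter is \<open>a\<close>: \<open>ab a = a ba\<close>.\<close>

lemma lsub_False_La: "lsub False w @ [La] = La # ltsub False w"
proof (induction w)
  case (Cons c w) then show ?case by (cases c) auto
qed auto

text \<open>In the limit the last letter of the finite conjugacy disappears. The images of the
  letters have different lengths, hence strong induction on the length of the prefix.\<close>

lemma stsub_True_eq: "stsub True S = Lb ## ssub True S"
proof (rule stream_eq_stakeI)
  show "stake n (stsub True S) = stake n (Lb ## ssub True S)" for n
  proof (induction n arbitrary: S rule: less_induct)
    case (less n)
    show ?case
    proof (cases S)
      case (SCons c S')
      show ?thesis
      proof (cases c)
        case La
        show ?thesis using less[of "n - 2" S'] SCons La
          by (cases n; cases "n - 1") auto
      next
        case Lb
        show ?thesis using less[of "n - 1" S'] SCons Lb by (cases n) auto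
      qed
    qed
  qed
qed

lemma ssub_False_eq: "ssub False S = La ## stsub False S"
proof (rule stream_eq_stakeI)
  show "stake n (ssub False S) = stake n (La ## stsub False S)" for n
  proof (induction n arbitrary: S rule: less_induct)
    case (less n)
    show ?case
    proof (cases S)
      case (SCons c S')
      show ?thesis
      proof (cases c)
        case Lb
        show ?thesis using less[of "n - 2" S'] SCons Lb
          by (cases n; cases "n - 1") auto
      next
        case La
        show ?thesis using less[of "n - 1" S'] SCons La by (cases n) auto
      qed
    qed
  qed
qed

text \<open>The delicate case is \<open>V\<close>, where both images begin with \<open>a\<close>.
  The image of \<open>a\<close> is then followed by another \<open>a\<close>, since every image
  under \<open>V\<close> begins with \<open>a\<close>, and so it stays below the image
  \<open>ab\<close>.\<close>

lemma lex_gt_lsub: "lex_gt (lsub d x) (ssub d R) = lex_gt x R"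
proof (induction x arbitrary: R)
  case (Cons c x)
  obtain e R' where R: "R = e ## R'" by (cases R)
  have *: "\<not> lex_gt (lsub False y) (Lb ## Z)" for y Z
  proof (cases y)
    case (Cons f z) then show ?thesis by (cases f) auto
  qed auto
  show ?case using Cons[of R'] R *
    by (cases d; cases c; cases e) (auto simp: ssub_False_eq)
qed auto

text \<open>The letter \<open>b\<close> always starts a block of the transposed substitutions.\<close>

lemma stsub_split:
  "stsub d S = u @- Lb ## X \<Longrightarrow> \<exists>v Y. u = ltsub d v \<and> S = v @- Y \<and> stsub d Y = Lb ## X"
proof (induction "length u" arbitrary: u S rule: less_induct)
  case less
  obtain c S' where S: "S = c ## S'" by (cases S)
  show ?case
  proof (cases "u = []")
    case True
    then show ?thesis using less.prems by (intro exI[of _ "[]"] exI[of _ S]) auto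
  next
    case False
    obtain u2 where u: "u = renormT d c @ u2"
    proof -
      obtain e u' where e: "u = e # u'" using False by (cases u) auto
      show ?thesis
        using less.prems S e that
        by (cases d; cases c; cases u') auto
    qed
    then have "stsub d S' = u2 @- Lb ## X" using less.prems S
      by (simp add: shift_eq_shift_same_length)
    moreover have "length u2 < length u" using u renormT_nonempty[of d c] by (cases "renormT d c") auto
    ultimately obtain v Y where "u2 = ltsub d v" "S' = v @- Y" "stsub d Y = Lb ## X"
      using less.hyps by blast
    then show ?thesis using u S by (intro exI[of _ "c # v"] exI[of _ Y]) auto
  qed
qed

text \<open>Every junction of \<open>S\<close> survives in the image. Under \<open>U\<close> it
  acquires one more \<open>b\<close> on either side, and these cancel; under \<open>V\<close> the
  junction supplies the letter \<open>a\<close> that completes the image of \<open>R\<close> to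
  \<open>ssub False R\<close>. Then \<open>lex_gt_lsub\<close> removes the substitution.\<close>

lemma markov_stsubD:
  assumes "markov (stsub d S)"
  shows "markov S"
proof (cases d)
  case True
  have 1: "lex_gt (rev u) R" if "S = u @- La ## Lb ## R" for u R
  proof -
    have "stsub d S = (ltsub True u @ [Lb]) @- La ## Lb ## stsub True R"
      using that True by simp
    then have "lex_gt (rev (ltsub True u @ [Lb])) (stsub True R)"
      using assms unfolding markov_def by blast
    then show ?thesis by (simp add: stsub_True_eq lex_gt_lsub)
  qed
  have 2: "\<not> lex_gt (rev u) R" if "S = u @- Lb ## La ## R" for u R
  proof -
    have "stsub d S = (ltsub True u @ [Lb]) @- Lb ## La ## stsub True R"
      using that True by simp
    then have "\<not> lex_gt (rev (ltsub True u @ [Lb])) (stsub True R)"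
      using assms unfolding markov_def by blast
    then show ?thesis by (simp add: stsub_True_eq lex_gt_lsub)
  qed
  show ?thesis unfolding markov_def using 1 2 by blast
next
  case False
  have 1: "lex_gt (rev u) R" if "S = u @- La ## Lb ## R" for u R
  proof -
    have "stsub d S = ltsub False u @- La ## Lb ## ssub False R"
      using that False by (simp add: ssub_False_eq)
    then have "lex_gt (rev (ltsub False u)) (ssub False R)"
      using assms unfolding markov_def by blast
    then show ?thesis by (simp add: lex_gt_lsub)
  qed
  have 2: "\<not> lex_gt (rev u) R" if "S = u @- Lb ## La ## R" for u R
  proof -
    have "stsub d S = ltsub False u @- Lb ## La ## ssub False R"
      using that False by (simp add: ssub_False_eq)
    then have "\<not> lex_gt (rev (ltsub False u)) (ssub False R)"
      using assms unfolding markov_def by blast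
    then show ?thesis by (simp add: lex_gt_lsub)
  qed
  show ?thesis unfolding markov_def using 1 2 by blast
qed

text \<open>A junction of the image either comes from a junction of \<open>S\<close>, or is decided,
  in the direction that \<open>markov\<close> asks for, by the letters right next to it.\<close>

lemma markov_stsub_True:
  assumes "markov S"
  shows "markov (stsub True S)"
proof -
  have 1: "lex_gt (rev u) R" if "stsub True S = u @- La ## Lb ## R" for u R
  proof -
    have "stsub True S = (u @ [La]) @- Lb ## R" using that by simp
    then obtain v Y where v: "u @ [La] = ltsub True v" "S = v @- Y" "stsub True Y = Lb ## R"
      using stsub_split by blast
    from v(1) obtain v' c where v': "v = v' @ [c]" by (cases v rule: rev_cases) auto
    with v(1) have c: "c = La" by (cases c) auto
    with v(1) v' have u: "u = ltsub True v' @ [Lb]" by simp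
    have R: "R = ssub True Y" using v(3) by (simp add: stsub_True_eq)
    obtain e Y' where Y: "Y = e ## Y'" by (cases Y)
    show ?thesis
    proof (cases e)
      case La then show ?thesis using u R Y by simp
    next
      case Lb
      then have "S = v' @- La ## Lb ## Y'" using v v' c Y by simp
      then have "lex_gt (rev v') Y'" using assms unfolding markov_def by blast
      then show ?thesis using u R Y Lb by (simp add: lex_gt_lsub)
    qed
  qed
  have 2: "\<not> lex_gt (rev u) R" if h: "stsub True S = u @- Lb ## La ## R" for u R
  proof -
    obtain v Y where v: "u = ltsub True v" "S = v @- Y" "stsub True Y = Lb ## La ## R"
      using stsub_split[OF h] by blast
    obtain e Y' where Y: "Y = e ## Y'" by (cases Y)
    have e: "e = La" using v(3) Y by (cases e) (auto simp: stsub_True_eq)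
    have R: "R = stsub True Y'" using v(3) Y e by simp
    show ?thesis
    proof (cases v rule: rev_cases)
      case Nil then show ?thesis using v by simp
    next
      case (snoc v' c)
      show ?thesis
      proof (cases c)
        case La then show ?thesis using v snoc R by (simp add: stsub_True_eq)
      next
        case Lb
        then have "S = v' @- Lb ## La ## Y'" using v snoc e Y by simp
        then have "\<not> lex_gt (rev v') Y'" using assms unfolding markov_def by blast
        then show ?thesis using v snoc R Lb by (simp add: stsub_True_eq lex_gt_lsub)
      qed
    qed
  qed
  show ?thesis unfolding markov_def using 1 2 by blast
qed

lemma markov_stsub_False:
  assumes "markov S"
  shows "markov (stsub False S)"
proof -
  have 1: "lex_gt (rev u) R" if "stsub False S = u @- La ## Lb ## R" for u R
  proof -
    have "stsub False S = (u @ [La]) @- Lb ## R" using that by simp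
    then obtain v Y where v: "u @ [La] = ltsub False v" "S = v @- Y" "stsub False Y = Lb ## R"
      using stsub_split by blast
    obtain e Y' where Y: "Y = e ## Y'" by (cases Y)
    have e: "e = Lb" using v(3) Y by (cases e) auto
    have R: "R = ssub False Y'" using v(3) Y e by (simp add: ssub_False_eq)
    from v(1) obtain v' c where v': "v = v' @ [c]" by (cases v rule: rev_cases) auto
    show ?thesis
    proof (cases c)
      case La
      then have "S = v' @- La ## Lb ## Y'" using v v' e Y by simp
      then have "lex_gt (rev v') Y'" using assms unfolding markov_def by blast
      then show ?thesis using v v' R La by (simp add: lex_gt_lsub)
    next
      case Lb then show ?thesis using v v' R by (simp add: ssub_False_eq)
    qed
  qed
  have 2: "\<not> lex_gt (rev u) R" if h: "stsub False S = u @- Lb ## La ## R" for u R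
  proof -
    obtain v Y where v: "u = ltsub False v" "S = v @- Y" "stsub False Y = Lb ## La ## R"
      using stsub_split[OF h] by blast
    obtain e Y' where Y: "Y = e ## Y'" by (cases Y)
    have e: "e = Lb" using v(3) Y by (cases e) auto
    have R: "R = stsub False Y'" using v(3) Y e by simp
    obtain f Y'' where Y': "Y' = f ## Y''" by (cases Y')
    show ?thesis
    proof (cases f)
      case La
      then have "S = v @- Lb ## La ## Y''" using v e Y Y' by simp
      then have "\<not> lex_gt (rev v) Y''" using assms unfolding markov_def by blast
      then show ?thesis using v R La Y' by (simp add: lex_gt_lsub flip: ssub_False_eq)
    next
      case Lb
      have "\<not> lex_gt (lsub False y) (Lb ## Z)" for y Z
      proof (cases y)
        case (Cons f z) then show ?thesis by (cases f) auto
      qed auto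
      then show ?thesis using v R Lb Y' by simp
    qed
  qed
  show ?thesis unfolding markov_def using 1 2 by blast
qed


section \<open>Positions of double letters\<close>

lemma snth_split: "S = stake m S @- S !! m ## sdrop (Suc m) S"
  using stake_sdrop[of m S] by (metis append_Cons id_stake_snth_sdrop)

lemma lex_gt_nth:
  "lex_gt x R \<longleftrightarrow> (\<exists>j<length x. (\<forall>i<j. x ! i = R !! i) \<and> x ! j = Lb \<and> R !! j = La)"
proof
  assume "lex_gt x R"
  then obtain w x' R' where "x = w @ Lb # x'" "R = w @- La ## R'" by (auto simp: lex_gt_iff)
  then show "\<exists>j<length x. (\<forall>i<j. x ! i = R !! i) \<and> x ! j = Lb \<and> R !! j = La"
    by (intro exI[of _ "length w"]) (auto simp: nth_append)
next
  assume "\<exists>j<length x. (\<forall>i<j. x ! i = R !! i) \<and> x ! j = Lb \<and> R !! j = La"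
  then obtain j where j: "j < length x" "\<forall>i<j. x ! i = R !! i" "x ! j = Lb" "R !! j = La" by blast
  have "take j x = stake j R" using j by (intro nth_equalityI) auto
  moreover have "x = take j x @ Lb # drop (Suc j) x" using j by (metis id_take_nth_drop)
  moreover have "R = stake j R @- La ## sdrop (Suc j) R" using snth_split[of R j] j by simp
  ultimately show "lex_gt x R" unfolding lex_gt_iff
    by (intro exI[of _ "stake j R"] exI[of _ "drop (Suc j) x"] exI[of _ "sdrop (Suc j) R"]) simp
qed

lemma snth_split2: "S = stake m S @- S !! m ## S !! Suc m ## sdrop (Suc (Suc m)) S"
proof -
  have "sdrop (Suc m) S = S !! Suc m ## sdrop (Suc (Suc m)) S"
    by (metis sdrop_simps stream.collapse)
  then show ?thesis using snth_split[of S m] by simp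
qed

lemma markov_abD:
  assumes "markov S" "S !! m = La" "S !! Suc m = Lb"
  shows "\<exists>j<m. (\<forall>i<j. S !! (m - 1 - i) = S !! (m + 2 + i)) \<and> S !! (m - 1 - j) = Lb \<and> S !! (m + 2 + j) = La"
proof -
  have "lex_gt (rev (stake m S)) (sdrop (Suc (Suc m)) S)"
    using assms snth_split2[of S m] unfolding markov_def by metis
  then obtain j where "j < m" "\<And>i. i < j \<Longrightarrow> rev (stake m S) ! i = sdrop (Suc (Suc m)) S !! i"
    "rev (stake m S) ! j = Lb" "sdrop (Suc (Suc m)) S !! j = La"
    by (auto simp: lex_gt_nth simp del: sdrop.simps)
  then show ?thesis
    by (intro exI[of _ j]) (auto simp: rev_nth sdrop_snth simp del: snth.simps sdrop.simps)
qed

lemma markov_baD: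
  assumes "markov S" "S !! m = Lb" "S !! Suc m = La"
    and "j < m" "\<And>i. i < j \<Longrightarrow> S !! (m - 1 - i) = S !! (m + 2 + i)" "S !! (m - 1 - j) = Lb"
  shows "S !! (m + 2 + j) = Lb"
proof (rule ccontr)
  assume "S !! (m + 2 + j) \<noteq> Lb"
  then have "S !! (m + 2 + j) = La" by (simp add: letter_neq)
  moreover have "\<not> lex_gt (rev (stake m S)) (sdrop (Suc (Suc m)) S)"
    using assms snth_split2[of S m] unfolding markov_def by metis
  moreover have "rev (stake m S) ! i = sdrop (Suc (Suc m)) S !! i" if "i < j" for i
    using assms(5)[OF that] that assms(4) by (simp add: rev_nth sdrop_snth del: snth.simps sdrop.simps)
  moreover have "rev (stake m S) ! j = Lb"
    using assms(4,6) by (simp add: rev_nth)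
  ultimately show False using assms(4)
    unfolding lex_gt_nth by (auto simp: sdrop_snth simp del: snth.simps sdrop.simps)
qed

definition double :: "'a \<Rightarrow> (nat \<Rightarrow> 'a) \<Rightarrow> nat \<Rightarrow> bool" where
  "double c s i \<longleftrightarrow> s i = c \<and> s (Suc i) = c"

lemma letter_neq': "La \<noteq> c \<longleftrightarrow> c = Lb" "Lb \<noteq> c \<longleftrightarrow> c = La"
  by (cases c; simp)+

lemma greatest_below:
  assumes "P (q::nat)" "q < p"
  obtains r where "P r" "q \<le> r" "r < p" "\<And>i. r < i \<Longrightarrow> i < p \<Longrightarrow> \<not> P i"
proof -
  let ?r = "Max {i. P i \<and> i < p}"
  have fin: "finite {i. P i \<and> i < p}" by simp
  have "?r \<in> {i. P i \<and> i < p}" using assms by (intro Max_in) auto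
  moreover have "\<not> P i" if "?r < i" "i < p" for i
  proof
    assume "P i"
    then have "i \<le> ?r" using that by (intro Max_ge[OF fin]) simp
    then show False using that by simp
  qed
  moreover have "q \<le> ?r" using assms by (intro Max_ge) auto
  ultimately show ?thesis using that by blast
qed

text \<open>Otherwise take the last \<open>aa\<close> before the first \<open>bb\<close>; between
  them the letters alternate. The junction after \<open>aa\<close> needs a first difference with
  \<open>b\<close> on the left and \<open>a\<close> on the right. Whether this falls into the
  alternating stretch or beyond the \<open>bb\<close>, reflection produces an earlier
  \<open>bb\<close> on the left.\<close>

lemma first_bb_before_aa:
  assumes ab: "\<And>m. s m = La \<Longrightarrow> s (Suc m) = Lb \<Longrightarrow>
      \<exists>j<m. (\<forall>i<j. s (m - 1 - i) = s (m + 2 + i)) \<and> s (m - 1 - j) = Lb \<and> s (m + 2 + j) = La"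
    and p: "double Lb s p" "\<And>i. i < p \<Longrightarrow> \<not> double Lb s i"
    and q0: "double La s q0"
  shows "p < q0"
proof (rule ccontr)
  assume "\<not> p < q0"
  moreover have "p \<noteq> q0" using p q0 by (auto simp: double_def)
  ultimately have "q0 < p" by simp
  then obtain q where q: "double La s q" "q < p" "\<And>i. q < i \<Longrightarrow> i < p \<Longrightarrow> \<not> double La s i"
    using greatest_below[of "double La s", OF q0] by metis
  have alt: "s i \<noteq> s (Suc i)" if "q < i" "i < p" for i
    using q(3)[OF that] p(2)[OF that(2)] by (cases "s i") (auto simp: double_def)
  have sq: "s q = La" "s (Suc q) = La" and sp: "s p = Lb" "s (Suc p) = Lb"
    using p q by (auto simp: double_def)
  have "Suc q \<noteq> p" using sq sp by auto
  then have qp: "Suc q < p" using q(2) by simp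
  have "s (Suc (Suc q)) = Lb" using alt[of "Suc q"] qp sq by (simp add: letter_neq letter_neq')
  from ab[OF sq(2) this] obtain j where j: "j < Suc q"
    and eq: "\<And>i. i < j \<Longrightarrow> s (q - i) = s (q + 3 + i)"
    and l: "s (q - j) = Lb" and r: "s (q + 3 + j) = La"
    by (auto simp: numeral_3_eq_3)
  have j1: "j \<ge> 1" using l sq by (cases j) auto
  show False
  proof (cases "q + 2 + j < p")
    case True
    then have "s (q + 2 + j) = Lb" using alt[of "q + 2 + j"] r by (simp add: letter_neq letter_neq' numeral_3_eq_3)
    then have "s (q - (j - 1)) = Lb" using eq[of "j - 1"] j1 by (simp add: numeral_3_eq_3)
    then have "double Lb s (q - j)" using l j j1 by (simp add: double_def Suc_diff_le)
    then show False using p(2)[of "q - j"] q(2) by simp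
  next
    case False
    define k where "k = p - q - 2"
    have k: "p = q + 2 + k" "k \<le> j" using False qp by (auto simp: k_def)
    have "k \<noteq> j" using r sp(2) k by (auto simp: numeral_3_eq_3)
    then have kj: "k < j" using k by simp
    have 1: "s (q - k) = Lb" using eq[OF kj] sp(2) k by (simp add: numeral_3_eq_3)
    then have k1: "k \<ge> 1" using sq by (cases k) auto
    have "s (q - (k - 1)) = Lb" using eq[of "k - 1"] kj sp(1) k k1 by (simp add: numeral_3_eq_3)
    then have "double Lb s (q - k)" using 1 k1 kj j by (simp add: double_def Suc_diff_le)
    then show False using p(2)[of "q - k"] q(2) by simp
  qed
qed

text \<open>Let \<open>p\<close> be the last \<open>bb\<close> before the first \<open>aa\<close> at
  \<open>q\<close>; the letters between alternate. The \<open>ba\<close> condition at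
  \<open>p + 1\<close> reflects this stretch to the left of \<open>p\<close>. The reflection cannot
  reach the \<open>aa\<close>, so the stretch is longer than the part of the word before it. The
  \<open>ba\<close> condition at \<open>q - 1\<close> then yields a later \<open>bb\<close> at
  \<open>q + j\<close> with everything before it mirrored. Since the stretch has period 2, the
  \<open>ab\<close> condition at \<open>q + 1\<close> fails there.\<close>

lemma not_aa_and_bb:
  assumes ab: "\<And>m. s m = La \<Longrightarrow> s (Suc m) = Lb \<Longrightarrow>
      \<exists>j<m. (\<forall>i<j. s (m - 1 - i) = s (m + 2 + i)) \<and> s (m - 1 - j) = Lb \<and> s (m + 2 + j) = La"
    and ba: "\<And>m j. s m = Lb \<Longrightarrow> s (Suc m) = La \<Longrightarrow> j < m \<Longrightarrow>
      (\<And>i. i < j \<Longrightarrow> s (m - 1 - i) = s (m + 2 + i)) \<Longrightarrow> s (m - 1 - j) = Lb \<Longrightarrow> s (m + 2 + j) = Lb"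
    and "double Lb s p1" "double La s q1"
  shows False
proof -
  obtain p0 where p0: "double Lb s p0" "\<And>i. i < p0 \<Longrightarrow> \<not> double Lb s i"
    using assms(3) by (metis LeastI not_less_Least)
  obtain q where q: "double La s q" "\<And>i. i < q \<Longrightarrow> \<not> double La s i"
    using assms(4) by (metis LeastI not_less_Least)
  have "p0 < q" using first_bb_before_aa[OF ab p0 q(1)] by simp
  then obtain p where p: "double Lb s p" "p < q" "\<And>i. p < i \<Longrightarrow> i < q \<Longrightarrow> \<not> double Lb s i"
    using greatest_below[of "double Lb s", OF p0(1)] by metis
  have alt: "s i \<noteq> s (Suc i)" if "p < i" "i < q" for i
    using p(3)[OF that] q(2)[OF that(2)] by (cases "s i") (auto simp: double_def)
  have alta: "s (Suc i) = La" if "p < i" "i < q" "s i = Lb" for i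
    using alt[OF that(1,2)] that(3) by (simp add: letter_neq letter_neq')
  have altb: "s (Suc i) = Lb" if "p < i" "i < q" "s i = La" for i
    using alt[OF that(1,2)] that(3) by (simp add: letter_neq letter_neq')
  have sq: "s q = La" "s (Suc q) = La" and sp: "s p = Lb" "s (Suc p) = Lb"
    using p q by (auto simp: double_def)
  have "Suc p \<noteq> q" using sq sp by auto
  then have pq: "Suc p < q" using p(2) by simp
  have sp2: "s (Suc (Suc p)) = La" using alta[of "Suc p"] pq sp by simp
  define J where "J = q - p - 2"
  have J: "q = p + 2 + J" using pq by (simp add: J_def)
  \<comment> \<open>A \<open>b\<close> on the left forces a \<open>b\<close> on the right. An
    \<open>a\<close> on the left against a \<open>b\<close> on the right would make the preceding
    letters \<open>a\<close> on both sides, hence \<open>aa\<close> before \<open>q\<close>.\<close>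
  have c1: "s (p - j) = s (p + 3 + j)" if "j < Suc p" "j \<le> J" for j
    using that
  proof (induction j rule: less_induct)
    case (less j)
    have eq: "s (p - i) = s (p + 3 + i)" if "i < j" for i
      using less that by simp
    show ?case
    proof (cases "s (p - j)")
      case Lb
      have "s (Suc p + 2 + j) = Lb"
        by (rule ba[OF sp(2) sp2 less.prems(1)]) (use eq Lb in \<open>auto simp: numeral_3_eq_3\<close>)
      then show ?thesis using Lb by (simp add: numeral_3_eq_3)
    next
      case La
      have j1: "j \<ge> 1" using La sp by (cases j) auto
      show ?thesis
      proof (rule ccontr)
        assume "s (p - j) \<noteq> s (p + 3 + j)"
        then have r: "s (p + 3 + j) = Lb" using La by (simp add: letter_neq letter_neq')
        have "p + 2 + j \<noteq> q" using r sq(2) by (auto simp: numeral_3_eq_3)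
        then have "p + 2 + j < q" using less.prems J by simp
        then have "s (p + 2 + j) = La" using alt[of "p + 2 + j"] r by (simp add: letter_neq letter_neq' numeral_3_eq_3)
        then have "s (p - (j - 1)) = La" using eq[of "j - 1"] j1 by (simp add: numeral_3_eq_3)
        then have "double La s (p - j)" using La j1 less.prems by (simp add: double_def Suc_diff_le)
        then show False using q(2)[of "p - j"] p(2) by simp
      qed
    qed
  qed
  \<comment> \<open>Otherwise the reflection reaches the \<open>aa\<close> at \<open>q\<close> and
    copies it to the left.\<close>
  have pJ: "Suc p \<le> J"
  proof (rule ccontr)
    assume "\<not> Suc p \<le> J"
    then have JJ: "J < Suc p" by simp
    have 1: "s (p - J) = La" using c1[OF JJ] J sq(2) by (simp add: numeral_3_eq_3)
    then have J1: "J \<ge> 1" using sp by (cases J) auto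
    have "s (p - (J - 1)) = La" using c1[of "J - 1"] JJ J sq(1) J1 by (simp add: numeral_3_eq_3)
    then have "double La s (p - J)" using 1 J1 JJ by (simp add: double_def Suc_diff_le)
    then show False using q(2)[of "p - J"] p(2) by simp
  qed
  have sq1: "s (q - 1) = Lb" using alt[of "q - 1"] J sq pJ by (simp add: letter_neq letter_neq')
  have Sq1: "s (Suc (q - 1)) = La" using sq J by simp
  have left_J: "s (q - 2 - J) = Lb" using J sp by simp
  \<comment> \<open>\<open>j\<close> is the first difference from the reflection in the junction at
    \<open>q - 1\<close>; if there is none up to \<open>J\<close>, take \<open>J\<close>, where the
    \<open>bb\<close> at \<open>p\<close> is copied.\<close>
  obtain j where j: "1 \<le> j" "j \<le> J" "s (q + 1 + j) = Lb" "s (q + j) = Lb"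
    "\<And>i. i < j \<Longrightarrow> s (q + 1 + i) = s (q - 2 - i)"
  proof (cases "\<exists>j\<le>J. s (q + 1 + j) \<noteq> s (q - 2 - j)")
    case True
    define j where "j = (LEAST j. j \<le> J \<and> s (q + 1 + j) \<noteq> s (q - 2 - j))"
    have j: "j \<le> J \<and> s (q + 1 + j) \<noteq> s (q - 2 - j)"
      unfolding j_def by (rule LeastI_ex) (use True in blast)
    have eq: "s (q + 1 + i) = s (q - 2 - i)" if "i < j" for i
      using not_less_Least[of i "\<lambda>j. j \<le> J \<and> s (q + 1 + j) \<noteq> s (q - 2 - j)"] that j
      unfolding j_def[symmetric] by auto
    have ljA: "s (q - 2 - j) = La"
    proof (rule ccontr)
      assume "s (q - 2 - j) \<noteq> La"
      then have l: "s (q - 2 - j) = Lb" by (simp add: letter_neq letter_neq')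
      have "s (q - 1 + 2 + j) = Lb"
      proof (rule ba[OF sq1 Sq1])
        show "j < q - 1" using j J by simp
        show "s (q - 1 - 1 - i) = s (q - 1 + 2 + i)" if "i < j" for i
          using eq[OF that] J by (simp add: algebra_simps)
        show "s (q - 1 - 1 - j) = Lb" using l by (simp add: numeral_2_eq_2)
      qed
      then show False using j l J by (simp add: algebra_simps)
    qed
    have r: "s (q + 1 + j) = Lb" using j ljA by (simp add: letter_neq letter_neq')
    have j1: "1 \<le> j" using r sq(2) by (cases j) auto
    have jJ: "j < J" using ljA left_J j by (cases "j = J") auto
    have "s (Suc (q - 2 - j)) = Lb" using altb[of "q - 2 - j"] J jJ ljA by simp
    then have "s (q - 2 - (j - 1)) = Lb" using j1 jJ J by (simp add: Suc_diff_le)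
    then have "s (q + j) = Lb" using eq[of "j - 1"] j1 by simp
    then show ?thesis using that[of j] j1 j r eq by simp
  next
    case False
    then have eq: "s (q + 1 + i) = s (q - 2 - i)" if "i \<le> J" for i using that by blast
    have "s (q - 2 - (J - 1)) = Lb" using J pJ sp by simp
    then have "s (q + J) = Lb" using eq[of "J - 1"] pJ by simp
    then show ?thesis using that[of J] eq[of J] left_J eq pJ by simp
  qed
  have j2: "j \<ge> 2" using j(4) sq(2) j(1) by (cases "j = 1") auto
  have a2: "s (q - 2) = La"
    using altb[of "q - 2"] alta[of "q - 2"] sq1 J pJ
    by (cases "s (q - 2)") (auto simp: Suc_diff_le numeral_2_eq_2)
  have a3: "s (q - 3) = Lb"
  proof -
    have "Suc (q - 3) = q - 2" using J pJ by simp
    then show ?thesis using altb[of "q - 3"] a2 J pJ j2 j(2) alt[of "q - 3"]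
      by (cases "s (q - 3)") auto
  qed
  have "s (Suc (Suc q)) = Lb" using j(5)[of 1] j2 a3 J by (simp add: numeral_3_eq_3 numeral_2_eq_2)
  from ab[OF sq(2) this] obtain i where i: "i < Suc q"
    and eq: "\<And>k. k < i \<Longrightarrow> s (q - k) = s (q + 3 + k)"
    and l: "s (q - i) = Lb" and r: "s (q + 3 + i) = La"
    by (auto simp: numeral_3_eq_3)
  \<comment> \<open>Two reflections whose centres are two positions apart compose to a shift by 4,
    which is a period of the alternating stretch.\<close>
  have alt4: "s (k + 4) = s k" if "p < k" "k + 4 \<le> q" for k
    using alt[of k] alt[of "k + 1"] alt[of "k + 2"] alt[of "k + 3"] that
    by (cases "s k"; cases "s (k + 1)"; cases "s (k + 2)"; cases "s (k + 3)"; cases "s (k + 4)")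
      (auto simp: numeral_eq_Suc)
  have m1: "s (q - k) = s (q + 3 + k)" if "k < j - 2" for k
  proof -
    have "s (q + 1 + (k + 2)) = s (q - 2 - (k + 2))" using j(5)[of "k + 2"] that by simp
    moreover have "s (q - 4 - k + 4) = s (q - 4 - k)" using that j(2) J pJ by (intro alt4) auto
    moreover have "q - 4 - k + 4 = q - k" using that j(2) J pJ by simp
    ultimately show ?thesis by (simp add: numeral_eq_Suc)
  qed
  have m2: "s (q - (j - 2)) = La"
  proof -
    have "s (q + 1 + (j - 1)) = s (q - 2 - (j - 1))" using j(5)[of "j - 1"] j2 by simp
    then have b: "s (q - 1 - j) = Lb" using j j2 by simp
    define k where "k = q - 1 - j"
    have k: "p < k" "k + 3 = q - (j - 2)" "k + 3 \<le> q" using j j2 J by (auto simp: k_def)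
    have "s k = Lb" using b by (simp only: k_def)
    then have "s (Suc k) = La" using alta[OF k(1)] k(3) by simp
    then have "s (Suc (Suc k)) = Lb" using altb[of "Suc k"] k(1,3) by simp
    then have "s (Suc (Suc (Suc k))) = La" using alta[of "Suc (Suc k)"] k(1,3) by simp
    moreover have "Suc (Suc (Suc k)) = q - (j - 2)" using k(2) by simp
    ultimately show ?thesis by metis
  qed
  have m3: "s (q + 3 + (j - 2)) = Lb"
  proof -
    have "q + 3 + (j - 2) = q + 1 + j" using j2 by simp
    then show ?thesis using j(3) by (simp only:)
  qed
  consider "i < j - 2" | "i = j - 2" | "i > j - 2" by linarith
  then show False
  proof cases
    case 1 then show False using m1[OF 1] l r by simp
  next
    case 2 then show False using m2 l by simp
  next
    case 3 then show False using eq[OF 3] m2 m3 by simp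
  qed
qed

section \<open>Desubstitution\<close>

lemma stsub_preimage_exists:
  assumes "P S" and step: "\<And>S. P S \<Longrightarrow> S = renormT d (g S) @- f S \<and> P (f S)"
  shows "\<exists>S'. S = stsub d S'"
proof -
  \<comment> \<open>\<open>g\<close> reads the first letter of the preimage and \<open>f\<close>
    removes its image, so iterating \<open>f\<close> and reading with \<open>g\<close> spells out
    the preimage.\<close>
  have "P S \<Longrightarrow> stake n (stsub d (smap g (siterate f S))) = stake n S" for n S
  proof (induction n arbitrary: S rule: less_induct)
    case (less n)
    let ?w = "renormT d (g S)"
    have S: "S = ?w @- f S" and PS: "P (f S)" using step less.prems by auto
    have "smap g (siterate f S) = g S ## smap g (siterate f (f S))"
      by (subst siterate.ctr) simp
    then have e: "stsub d (smap g (siterate f S)) = ?w @- stsub d (smap g (siterate f (f S)))" by simp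
    show ?case
    proof (cases "n = 0")
      case False
      then have "n - length ?w < n" by simp
      then have "stake (n - length ?w) (stsub d (smap g (siterate f (f S)))) = stake (n - length ?w) (f S)"
        using less.IH PS by blast
      then show ?thesis using S e by (metis stake_shift)
    qed simp
  qed
  then show ?thesis using assms(1) by (intro exI[of _ "smap g (siterate f S)"] stream_eq_stakeI) simp
qed

text \<open>The blocks are \<open>ba\<close> and \<open>b\<close>, and without \<open>aa\<close>
  every \<open>a\<close> follows a \<open>b\<close>. The letter coded by the first block is
  therefore the second letter of \<open>S\<close>, whence \<open>g\<close>.\<close>

lemma stsub_True_preimage:
  assumes "shd S = Lb" "\<And>i. \<not> double La (snth S) i"
  shows "\<exists>S'. S = stsub True S'"
proof (rule stsub_preimage_exists[where P = "\<lambda>S. shd S = Lb \<and> (\<forall>i. \<not> double La (snth S) i)"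
      and g = "\<lambda>S. shd (stl S)" and f = "\<lambda>S. if shd (stl S) = La then stl (stl S) else stl S"])
  show "shd S = Lb \<and> (\<forall>i. \<not> double La (snth S) i)" using assms by auto
  show "S = renormT True (shd (stl S)) @- (if shd (stl S) = La then stl (stl S) else stl S) \<and>
      shd (if shd (stl S) = La then stl (stl S) else stl S) = Lb \<and>
      (\<forall>i. \<not> double La (snth (if shd (stl S) = La then stl (stl S) else stl S)) i)"
    if h: "shd S = Lb \<and> (\<forall>i. \<not> double La (snth S) i)" for S
  proof -
    obtain e f Y where S: "S = Lb ## e ## f ## Y" using h by (metis stream.collapse)
    have nd: "\<not> double La (snth S) i" for i using h by blast
    have 1: "\<not> double La (snth (f ## Y)) i" for i using nd[of "Suc (Suc i)"] S by (simp add: double_def)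
    have 2: "\<not> double La (snth (e ## f ## Y)) i" for i using nd[of "Suc i"] S by (simp add: double_def)
    show ?thesis using S 1 2 2[of 0] by (cases e; cases f) (auto simp: double_def)
  qed
qed

text \<open>Without \<open>bb\<close> every \<open>b\<close> opens a block \<open>ba\<close>, so
  here the first letter of \<open>S\<close> is also the first letter of the preimage.\<close>

lemma stsub_False_preimage:
  assumes "\<And>i. \<not> double Lb (snth S) i"
  shows "\<exists>S'. S = stsub False S'"
proof (rule stsub_preimage_exists[where P = "\<lambda>S. \<forall>i. \<not> double Lb (snth S) i"
      and g = shd and f = "\<lambda>S. if shd S = Lb then stl (stl S) else stl S"])
  show "\<forall>i. \<not> double Lb (snth S) i" using assms by auto
  show "S = renormT False (shd S) @- (if shd S = Lb then stl (stl S) else stl S) \<and>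
      (\<forall>i. \<not> double Lb (snth (if shd S = Lb then stl (stl S) else stl S)) i)"
    if h: "\<forall>i. \<not> double Lb (snth S) i" for S
  proof -
    obtain e f Y where S: "S = e ## f ## Y" by (metis stream.collapse)
    have nd: "\<not> double Lb (snth S) i" for i using h by blast
    have 1: "\<not> double Lb (snth Y) i" for i using nd[of "Suc (Suc i)"] S by (simp add: double_def)
    have 2: "\<not> double Lb (snth (f ## Y)) i" for i using nd[of "Suc i"] S by (simp add: double_def)
    show ?thesis using S 1 2 nd[of 0] by (cases e; cases f) (auto simp: double_def)
  qed
qed


lemma markov_preimage:
  assumes M: "markov S" and b: "shd S = Lb"
  shows "\<exists>d S'. S = stsub d S' \<and> shd S' = Lb \<and> markov S'"
proof (cases "\<exists>p. double Lb (snth S) p")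
  case False
  then obtain S' where S: "S = stsub False S'" using stsub_False_preimage[of S] by auto
  obtain e Y where e: "S' = e ## Y" by (cases S')
  have "shd S' = Lb" using S b e by (cases e) auto
  then show ?thesis using S M markov_stsubD by blast
next
  case True
  then obtain p where p: "double Lb (snth S) p" by blast
  have "\<not> double La (snth S) i" for i
    using not_aa_and_bb[of "snth S" p i] markov_abD[OF M] markov_baD[OF M] p by blast
  then obtain S' where S: "S = stsub True S'" using stsub_True_preimage[OF b] by auto
  have M': "markov S'" using M S markov_stsubD by blast
  \<comment> \<open>The occurrence of \<open>bb\<close> in \<open>S\<close> puts a \<open>b\<close>
    into \<open>S'\<close>. If \<open>S'\<close> began with \<open>a\<close>, its first
    \<open>ab\<close> would have only letters \<open>a\<close> before it, and such a word exceeds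
    nothing.\<close>
  have "shd S' = Lb"
  proof (rule ccontr)
    assume "shd S' \<noteq> Lb"
    then have a: "shd S' = La" by (simp add: letter_neq)
    have "S = stake p S @- Lb ## Lb ## sdrop (Suc (Suc p)) S"
      using snth_split2[of S p] p by (simp add: double_def del: snth.simps sdrop.simps)
    then obtain v Y where v: "S' = v @- Y" "stsub True Y = Lb ## Lb ## sdrop (Suc (Suc p)) S"
      using stsub_split[of True S' "stake p S"] S by metis
    obtain e Y' where e: "Y = e ## Y'" by (cases Y)
    have "e = Lb" using v(2) e by (cases e) auto
    then have S': "S' = (v @ [Lb]) @- Y'" using v e by simp
    have "Lb \<in> set (v @ [Lb])" by simp
    then obtain ys zs where ys: "v @ [Lb] = ys @ Lb # zs" "Lb \<notin> set ys" using split_list_first by metis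
    have "ys \<noteq> []" using S' ys(1) a by auto
    then obtain ys' c where ys': "ys = ys' @ [c]" by (cases ys rule: rev_cases) auto
    then have "c = La" using ys(2) by (simp add: letter_neq')
    then have "S' = ys' @- La ## Lb ## (zs @- Y')" using S' ys ys' by simp
    then have "lex_gt (rev ys') (zs @- Y')" using M' unfolding markov_def by blast
    then obtain w x' where "rev ys' = w @ Lb # x'" by (auto simp: lex_gt_iff)
    then have "Lb \<in> set (rev ys')" by simp
    then show False using ys ys' by simp
  qed
  then show ?thesis using S M' by blast
qed

lemma stream_all_eq_imp_cycle: "(\<And>n. S !! n = c) \<Longrightarrow> S = cycle [c]"
  by (rule snth_ext) (simp flip: sconst_cycle)

lemma cycle_eqI:
  assumes "X = w @- X" "w \<noteq> []"
  shows "X = cycle w"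
proof (rule stream_eq_stakeI)
  show "stake n X = stake n (cycle w)" for n
  proof (induction n rule: less_induct)
    case (less n)
    show ?case
    proof (cases "n = 0")
      case False
      then have "stake (n - length w) X = stake (n - length w) (cycle w)" using less assms(2) by simp
      then show ?thesis using assms(1) cycle_decomp[OF assms(2)] by (metis stake_shift)
    qed simp
  qed
qed

lemma ltsub_nonempty [simp]: "ltsub d w = [] \<longleftrightarrow> w = []"
  by (cases w) auto
lemma lsub_nonempty [simp]: "lsub d w = [] \<longleftrightarrow> w = []"
  by (cases w) auto

lemma stsub_cycle: "w \<noteq> [] \<Longrightarrow> stsub d (cycle w) = cycle (ltsub d w)"
  by (rule cycle_eqI) (metis cycle_decomp stsub_simps(2), simp)

lemma foldr_ltsub_nonempty [simp]: "foldr ltsub os w = [] \<longleftrightarrow> w = []"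
  by (induction os) auto
lemma foldr_lsub_nonempty [simp]: "foldr lsub os w = [] \<longleftrightarrow> w = []"
  by (induction os) auto
lemma foldr_stsub_cycle: "w \<noteq> [] \<Longrightarrow> foldr stsub os (cycle w) = cycle (foldr ltsub os w)"
  by (induction os) (auto simp: stsub_cycle)
lemma foldr_stsub_shift: "foldr stsub os (w @- S) = foldr ltsub os w @- foldr stsub os S"
  by (induction os) auto
lemma foldr_ssub_shift: "foldr ssub os (w @- S) = foldr lsub os w @- foldr ssub os S"
  by (induction os) auto
lemma foldr_lsub_append: "foldr lsub os (v @ w) = foldr lsub os v @ foldr lsub os w"
  by (induction os) auto
lemma rev_foldr_lsub: "rev (foldr lsub os w) = foldr ltsub os (rev w)"
  by (induction os) auto

lemma map_upt_0_Suc: "map d [0..<Suc n] = d 0 # map (\<lambda>i. d (Suc i)) [0..<n]"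
  by (simp add: map_upt_Suc del: upt_Suc)

text \<open>Each application of \<open>U\<close> makes the known initial run of \<open>b\<close>
  longer by one.\<close>

lemma eventually_U_constant:
  assumes "\<And>n. k \<le> n \<Longrightarrow> T n = stsub True (T (Suc n))"
  shows "T k = cycle [Lb]"
proof -
  have pre: "\<exists>Y. T m = replicate n Lb @- Y" if "k \<le> m" for n m
    using that
  proof (induction n arbitrary: m)
    case (Suc n)
    then obtain Y where "T (Suc m) = replicate n Lb @- Y" by (meson le_SucI)
    then have "T m = ltsub True (replicate n Lb) @- stsub True Y" using assms[OF Suc.prems] by simp
    also have "ltsub True (replicate n Lb) = replicate n Lb" by (induction n) auto
    also have "replicate n Lb @- stsub True Y = (replicate n Lb @ [Lb]) @- ssub True Y"
      by (simp add: stsub_True_eq)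
    also have "replicate n Lb @ [Lb] = replicate (Suc n) Lb" by (simp add: replicate_append_same)
    finally show ?case by blast
  qed auto
  show ?thesis
  proof (rule stream_all_eq_imp_cycle)
    show "T k !! n = Lb" for n
      using pre[of k "Suc n"] by (metis length_replicate lessI nth_replicate order_refl shift_snth_less)
  qed
qed

text \<open>Each application of \<open>V\<close> turns the first \<open>b\<close> into
  \<open>ba\<close> and keeps the letters \<open>a\<close> after it, so the known run of
  \<open>a\<close> grows by one.\<close>

lemma eventually_V_constant:
  assumes "\<And>n. k \<le> n \<Longrightarrow> T n = stsub False (T (Suc n))" "\<And>n. shd (T n) = Lb"
  shows "T k = Lb ## cycle [La]"
proof -
  have pre: "\<exists>Y. T m = Lb ## (replicate n La @- Y)" if "k \<le> m" for n m
    using that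
  proof (induction n arbitrary: m)
    case 0
    then show ?case using assms(2)[of m] by (metis replicate_0 shift.simps(1) stream.collapse)
  next
    case (Suc n)
    then obtain Y where "T (Suc m) = Lb ## (replicate n La @- Y)" by (meson le_SucI)
    then have "T m = Lb ## La ## (ltsub False (replicate n La) @- stsub False Y)"
      using assms(1)[OF Suc.prems] by simp
    also have "ltsub False (replicate n La) = replicate n La" by (induction n) auto
    finally show ?case by (intro exI[of _ "stsub False Y"]) simp
  qed
  have "stl (T k) = cycle [La]"
  proof (rule stream_all_eq_imp_cycle)
    show "stl (T k) !! n = La" for n
      using pre[of k "Suc n"] by (metis length_replicate lessI nth_replicate order_refl shift_snth_less stream.sel(2))
  qed
  then show ?thesis using assms(2)[of k] by (metis stream.collapse)
qed

text \<open>Repeated desubstitution gives a sequence of operations. If one of the two stops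
  occurring, the word that remains is forced: \<open>b^\<infinity>\<close> under \<open>U\<close>
  alone and \<open>b a^\<infinity>\<close> under \<open>V\<close> alone.\<close>

lemma markov_structure:
  assumes "markov S" "shd S = Lb"
  shows "(\<exists>os. S = foldr stsub os (cycle [Lb])) \<or> (\<exists>os. S = foldr stsub os (Lb ## cycle [La]))
    \<or> (\<exists>d T. infinite {n. d n} \<and> infinite {n. \<not> d n} \<and>
        (\<forall>n. S = foldr stsub (map d [0..<n]) (T n) \<and> shd (T n) = Lb))"
proof -
  have "\<exists>T. \<forall>n. (markov (T n) \<and> shd (T n) = Lb \<and> (n = 0 \<longrightarrow> T n = S)) \<and> (\<exists>d. T n = stsub d (T (Suc n)))"
  proof (rule dependent_nat_choice)
    show "\<exists>x. markov x \<and> shd x = Lb \<and> (0 = 0 \<longrightarrow> x = S)" using assms by blast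
    show "\<exists>y. (markov y \<and> shd y = Lb \<and> (Suc n = 0 \<longrightarrow> y = S)) \<and> (\<exists>d. x = stsub d y)"
      if "markov x \<and> shd x = Lb \<and> (n = 0 \<longrightarrow> x = S)" for x n
      using markov_preimage[of x] that by auto
  qed
  then obtain T where T: "\<And>n. markov (T n)" "\<And>n. shd (T n) = Lb" "T 0 = S" "\<And>n. \<exists>d. T n = stsub d (T (Suc n))"
    by blast
  from T(4) obtain d where d: "\<And>n. T n = stsub (d n) (T (Suc n))" by metis
  have S: "S = foldr stsub (map d [0..<n]) (T n)" for n
  proof (induction n)
    case (Suc n) then show ?case by (simp flip: d[of n])
  qed (simp add: T(3))
  consider "finite {n. d n}" | "finite {n. \<not> d n}" | "infinite {n. d n}" "infinite {n. \<not> d n}" by blast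
  then show ?thesis
  proof cases
    case 1
    then obtain k where "\<And>n. n \<in> {n. d n} \<Longrightarrow> n < k" by (metis finite_nat_set_iff_bounded)
    then have k: "\<And>n. k \<le> n \<Longrightarrow> \<not> d n" by fastforce
    have "T k = Lb ## cycle [La]"
    proof (rule eventually_V_constant)
      show "T n = stsub False (T (Suc n))" if "k \<le> n" for n using d[of n] k[OF that] by simp
    qed (rule T(2))
    then have "S = foldr stsub (map d [0..<k]) (Lb ## cycle [La])" using S[of k] by simp
    then show ?thesis by blast
  next
    case 2
    then obtain k where "\<And>n. n \<in> {n. \<not> d n} \<Longrightarrow> n < k" by (metis finite_nat_set_iff_bounded)
    then have k: "\<And>n. k \<le> n \<Longrightarrow> d n" by fastforce
    have "T k = cycle [Lb]"
    proof (rule eventually_U_constant)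
      show "T n = stsub True (T (Suc n))" if "k \<le> n" for n using d[of n] k[OF that] by simp
    qed
    then have "S = foldr stsub (map d [0..<k]) (cycle [Lb])" using S[of k] by simp
    then show ?thesis by blast
  next
    case 3
    then have "\<exists>d T. infinite {n. d n} \<and> infinite {n. \<not> d n} \<and>
        (\<forall>n. S = foldr stsub (map d [0..<n]) (T n) \<and> shd (T n) = Lb)"
      using S T(2) by (intro exI[of _ d] exI[of _ T]) simp
    then show ?thesis by blast
  qed
qed

subsection \<open>Renormalized pairs\<close>

text \<open>The head of \<open>os\<close> is the outermost substitution. An operation appended at
  the end acts on the letters first, and this is what an exterior operator does to the pair.\<close>

definition alp :: "bool list \<Rightarrow> letter list" where "alp os = foldr lsub os [La]"
definition bet :: "bool list \<Rightarrow> letter list" where "bet os = foldr lsub os [Lb]"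

lemma alp_bet_Nil: "alp [] = [La]" "bet [] = [Lb]" by (simp_all add: alp_def bet_def)

lemma alp_bet_snoc:
  "alp (os @ [True]) = alp os @ bet os" "bet (os @ [True]) = bet os"
  "alp (os @ [False]) = alp os" "bet (os @ [False]) = alp os @ bet os"
  using foldr_lsub_append[of os "[La]" "[Lb]"] by (simp_all add: alp_def bet_def)

lemma alp_nonempty [simp]: "alp os \<noteq> []" and bet_nonempty [simp]: "bet os \<noteq> []"
  by (simp_all add: alp_def bet_def)

lemma alp_Cons: "\<exists>t. alp os = La # t"
proof (induction os)
  case (Cons d os)
  then obtain t where "alp os = La # t" by blast
  then show ?case by (cases d) (auto simp: alp_def)
qed (simp add: alp_def)

lemma rev_alp: "rev (alp os) = foldr ltsub os [La]" and rev_bet: "rev (bet os) = foldr ltsub os [Lb]"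
  by (simp_all add: alp_def bet_def rev_foldr_lsub)

lemma Pbar_iff: "(\<alpha>, \<beta>) \<in> Pbar \<longleftrightarrow> (\<exists>os. \<alpha> = alp os \<and> \<beta> = bet os)"
proof
  have "p \<in> Pbar \<Longrightarrow> \<exists>os. p = (alp os, bet os)" for p
  proof (induction rule: Pbar.induct)
    case base show ?case by (intro exI[of _ "[]"]) (simp add: alp_bet_Nil)
  next
    case (U p)
    then obtain os where "p = (alp os, bet os)" by blast
    then show ?case by (intro exI[of _ "os @ [True]"]) (simp add: alp_bet_snoc)
  next
    case (V p)
    then obtain os where "p = (alp os, bet os)" by blast
    then show ?case by (intro exI[of _ "os @ [False]"]) (simp add: alp_bet_snoc)
  qed
  then show "(\<alpha>, \<beta>) \<in> Pbar \<Longrightarrow> \<exists>os. \<alpha> = alp os \<and> \<beta> = bet os" by blast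
  have "(alp os, bet os) \<in> Pbar" for os
  proof (induction os rule: rev_induct)
    case Nil show ?case by (simp add: alp_bet_Nil Pbar.base)
  next
    case (snoc d os)
    show ?case using Pbar.U[OF snoc] Pbar.V[OF snoc] by (cases d) (auto simp: alp_bet_snoc)
  qed
  then show "\<exists>os. \<alpha> = alp os \<and> \<beta> = bet os \<Longrightarrow> (\<alpha>, \<beta>) \<in> Pbar" by blast
qed

lemma renormalization_sequenceD:
  assumes "renormalization_sequence (\<lambda>n. (\<alpha> n, \<beta> n))"
  obtains d where "infinite {n. d n}" "infinite {n. \<not> d n}"
    "\<And>n. \<alpha> n = alp (map d [0..<n])" "\<And>n. \<beta> n = bet (map d [0..<n])"
proof -
  define d where "d n \<longleftrightarrow> (\<alpha> (Suc n), \<beta> (Suc n)) = Ubar (\<alpha> n, \<beta> n)" for n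
  have step: "(\<alpha> (Suc n), \<beta> (Suc n)) = (if d n then Ubar (\<alpha> n, \<beta> n) else Vbar (\<alpha> n, \<beta> n))" for n
    using assms by (auto simp: renormalization_sequence_def d_def)
  have ab: "\<alpha> n = alp (map d [0..<n]) \<and> \<beta> n = bet (map d [0..<n])" for n
  proof (induction n)
    case 0 show ?case using assms by (simp add: renormalization_sequence_def alp_bet_Nil)
  next
    case (Suc n) then show ?case using step[of n] by (cases "d n") (simp_all add: alp_bet_snoc)
  qed
  \<comment> \<open>The two operators never agree on a pair of nonempty words, so each step is
    counted for exactly one of them.\<close>
  have "(\<alpha> (Suc n), \<beta> (Suc n)) = Vbar (\<alpha> n, \<beta> n) \<longleftrightarrow> \<not> d n" for n
    using step[of n] ab[of n] by (auto simp: d_def)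
  then have "infinite {n. \<not> d n}" "infinite {n. d n}"
    using assms by (simp_all add: renormalization_sequence_def d_def del: Ubar.simps Vbar.simps)
  then show ?thesis using that ab by blast
qed

lemma renormalization_sequenceI:
  assumes "infinite {n. d n}" "infinite {n. \<not> d n}"
  shows "renormalization_sequence (\<lambda>n. (alp (map d [0..<n]), bet (map d [0..<n])))"
proof -
  let ?p = "\<lambda>n. (alp (map d [0..<n]), bet (map d [0..<n]))"
  have "?p (Suc n) = Ubar (?p n)" if "d n" for n using that by (simp add: alp_bet_snoc)
  moreover have "?p (Suc n) = Vbar (?p n)" if "\<not> d n" for n using that by (simp add: alp_bet_snoc)
  ultimately have "{n. d n} \<subseteq> {n. ?p (Suc n) = Ubar (?p n)}" "{n. \<not> d n} \<subseteq> {n. ?p (Suc n) = Vbar (?p n)}"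
    "\<And>n. ?p (Suc n) \<in> {Ubar (?p n), Vbar (?p n)}" by blast+
  then have "infinite {n. ?p (Suc n) = Ubar (?p n)}" "infinite {n. ?p (Suc n) = Vbar (?p n)}"
    "\<And>n. ?p (Suc n) \<in> {Ubar (?p n), Vbar (?p n)}"
    using assms infinite_super by blast+
  then show ?thesis
    unfolding renormalization_sequence_def by (simp only: alp_bet_Nil list.map upt_0 simp_thms)
qed

subsection \<open>Limits of words\<close>

lemma unbounded_of_infinite_steps:
  fixes f :: "nat \<Rightarrow> nat"
  assumes "\<And>n. f n \<le> f (Suc n)" "infinite {n. f n < f (Suc n)}"
  shows "\<exists>n. k \<le> f n"
proof (induction k)
  case (Suc k)
  then obtain n where n: "k \<le> f n" by blast
  obtain m where m: "n \<le> m" "f m < f (Suc m)" using assms(2) by (auto simp: infinite_nat_iff_unbounded_le)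
  have "f n \<le> f m" using lift_Suc_mono_le[of f, OF assms(1) m(1)] .
  then show ?case using n m by (intro exI[of _ "Suc m"]) simp
qed simp

lemma prefix_stream_iff: "(\<exists>Y. L = w @- Y) \<longleftrightarrow> stake (length w) L = w"
  by (metis stake_sdrop append_Nil2 diff_self_eq_0 order_refl stake.simps(1) stake_shift take_all)

lemma prefix_chain:
  assumes "\<And>n. prefix (w n) (w (Suc n))" "n \<le> m"
  shows "prefix (w n) (w m)"
  using assms(2) by (induction rule: dec_induct) (auto intro: prefix_order.trans assms(1))

lemma prefix_chain_limit:
  assumes chain: "\<And>n. prefix (w n) (w (Suc n))" and unb: "\<And>k. \<exists>n. k \<le> length (w n)"
  shows "\<exists>L. \<forall>n. \<exists>Y. L = w n @- Y"
proof -
  define N where "N i = (SOME n. Suc i \<le> length (w n))" for i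
  have N: "Suc i \<le> length (w (N i))" for i unfolding N_def by (rule someI_ex) (rule unb)
  define L where "L = smap (\<lambda>i. w (N i) ! i) nats"
  have "stake (length (w n)) L = w n" for n
  proof (rule nth_equalityI)
    fix i assume "i < length (stake (length (w n)) L)"
    then have i: "i < length (w n)" by simp
    have "L !! i = w (N i) ! i" by (simp add: L_def)
    also have "\<dots> = w n ! i"
    proof (cases "n \<le> N i")
      case True
      then show ?thesis using prefix_chain[of w, OF chain True] i by (auto simp: prefix_def nth_append)
    next
      case False
      then have "N i \<le> n" by simp
      then show ?thesis using prefix_chain[of w, OF chain, of "N i" n] N[of i] by (auto simp: prefix_def nth_append)
    qed
    finally show "stake (length (w n)) L ! i = w n ! i" using i by simp
  qed simp
  then show ?thesis by (auto simp: prefix_stream_iff)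
qed

lemma word_tendstoI:
  assumes chain: "\<And>n. prefix (w n) (w (Suc n))" and unb: "\<And>k. \<exists>n. k \<le> length (w n)"
    and L: "\<And>n. \<exists>Y. L = w n @- Y"
  shows "word_tendsto w L"
  unfolding word_tendsto_def
proof
  fix k
  obtain n where n: "k \<le> length (w n)" using unb by blast
  have "prefix (stake k L) (w m)" if "n \<le> m" for m
  proof -
    have "prefix (w n) (w m)" using prefix_chain[of w, OF chain that] .
    moreover have "stake k L = take k (w n)" using L[of n] n
      unfolding prefix_stream_iff by (metis min.absorb1 take_stake)
    ultimately show ?thesis by (metis prefix_order.trans take_is_prefix)
  qed
  then show "\<forall>\<^sub>F n in sequentially. prefix (stake k L) (w n)"
    unfolding eventually_sequentially by blast
qed

lemma word_tendstoD:
  assumes chain: "\<And>n. prefix (w n) (w (Suc n))" and L: "word_tendsto w L"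
  shows "\<exists>Y. L = w n @- Y"
proof -
  obtain N where N: "\<And>m. N \<le> m \<Longrightarrow> prefix (stake (length (w n)) L) (w m)"
    using L unfolding word_tendsto_def eventually_sequentially by blast
  have "prefix (stake (length (w n)) L) (w (max N n))" using N by simp
  moreover have "prefix (w n) (w (max N n))" by (rule prefix_chain[of w, OF chain]) simp
  ultimately have "stake (length (w n)) L = w n"
    by (metis length_stake order_refl prefix_length_prefix prefix_order.antisym)
  then show ?thesis by (simp add: prefix_stream_iff)
qed

lemma stream_eq_of_common_prefixes:
  assumes "\<And>n. \<exists>Y. S = w n @- Y" "\<And>n. \<exists>Y. S' = w n @- Y" "\<And>k. \<exists>n. k \<le> length (w n)"
  shows "S = S'"
proof (rule stream_eq_stakeI)
  fix k
  obtain n where n: "k \<le> length (w n)" using assms(3) by blast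
  have "stake (length (w n)) S = stake (length (w n)) S'"
    using assms(1)[of n] assms(2)[of n] by (simp add: prefix_stream_iff)
  then have "take k (stake (length (w n)) S) = take k (stake (length (w n)) S')" by simp
  then show "stake k S = stake k S'" using n by (simp add: take_stake min_absorb1)
qed

lemma alp_chain: "prefix (alp (map d [0..<n])) (alp (map d [0..<Suc n]))"
  by (cases "d n") (simp_all add: alp_bet_snoc)

lemma rev_bet_chain: "prefix (rev (bet (map d [0..<n]))) (rev (bet (map d [0..<Suc n])))"
  by (cases "d n") (simp_all add: alp_bet_snoc)

text \<open>Only the \<open>U\<close> steps lengthen \<alpha> and only the \<open>V\<close> steps
  lengthen \<beta>, so each of the two limits asks for infinitely many steps of one kind.\<close>

lemma alp_unbounded:
  assumes "infinite {n. d n}" shows "\<exists>n. k \<le> length (alp (map d [0..<n]))"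
proof (rule unbounded_of_infinite_steps)
  show "length (alp (map d [0..<n])) \<le> length (alp (map d [0..<Suc n]))" for n
    using alp_chain prefix_length_le by blast
  have "{n. d n} \<subseteq> {n. length (alp (map d [0..<n])) < length (alp (map d [0..<Suc n]))}"
    by (auto simp: alp_bet_snoc)
  then show "infinite {n. length (alp (map d [0..<n])) < length (alp (map d [0..<Suc n]))}"
    using assms infinite_super by blast
qed

lemma rev_bet_unbounded:
  assumes "infinite {n. \<not> d n}" shows "\<exists>n. k \<le> length (rev (bet (map d [0..<n])))"
proof (rule unbounded_of_infinite_steps)
  show "length (rev (bet (map d [0..<n]))) \<le> length (rev (bet (map d [0..<Suc n])))" for n
    using rev_bet_chain prefix_length_le by blast
  have "{n. \<not> d n} \<subseteq> {n. length (rev (bet (map d [0..<n]))) < length (rev (bet (map d [0..<Suc n])))}"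
    by (auto simp: alp_bet_snoc)
  then show "infinite {n. length (rev (bet (map d [0..<n]))) < length (rev (bet (map d [0..<Suc n])))}"
    using assms infinite_super by blast
qed

text \<open>The reversed \<beta>_n extend each other to the right, so their limit is the stream that
  has all of them as prefixes.\<close>

definition beta_limit :: "(nat \<Rightarrow> bool) \<Rightarrow> letter stream \<Rightarrow> bool" where
  "beta_limit d S \<longleftrightarrow> (\<forall>n. \<exists>Y. S = rev (bet (map d [0..<n])) @- Y)"

definition alpha_limit :: "(nat \<Rightarrow> bool) \<Rightarrow> letter stream \<Rightarrow> bool" where
  "alpha_limit d L \<longleftrightarrow> (\<forall>n. \<exists>Y. L = alp (map d [0..<n]) @- Y)"

lemma beta_limit_exists: "infinite {n. \<not> d n} \<Longrightarrow> \<exists>S. beta_limit d S"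
  unfolding beta_limit_def
  by (rule prefix_chain_limit[where w = "\<lambda>n. rev (bet (map d [0..<n]))"])
    (rule rev_bet_chain, rule rev_bet_unbounded)

lemma alpha_limit_exists: "infinite {n. d n} \<Longrightarrow> \<exists>S. alpha_limit d S"
  unfolding alpha_limit_def
  by (rule prefix_chain_limit[where w = "\<lambda>n. alp (map d [0..<n])"])
    (rule alp_chain, rule alp_unbounded)

lemma beta_limit_iff:
  assumes "infinite {n. \<not> d n}"
  shows "word_tendsto (\<lambda>n. rev (bet (map d [0..<n]))) S \<longleftrightarrow> beta_limit d S"
  unfolding beta_limit_def
  using word_tendstoI[of "\<lambda>n. rev (bet (map d [0..<n]))" S, OF rev_bet_chain rev_bet_unbounded[OF assms]]
    word_tendstoD[of "\<lambda>n. rev (bet (map d [0..<n]))", OF rev_bet_chain] by blast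

lemma alpha_limit_iff:
  assumes "infinite {n. d n}"
  shows "word_tendsto (\<lambda>n. alp (map d [0..<n])) S \<longleftrightarrow> alpha_limit d S"
  unfolding alpha_limit_def
  using word_tendstoI[of "\<lambda>n. alp (map d [0..<n])" S, OF alp_chain alp_unbounded[OF assms]]
    word_tendstoD[of "\<lambda>n. alp (map d [0..<n])", OF alp_chain] by blast

lemma shd_beta_limit: "beta_limit d S \<Longrightarrow> shd S = Lb"
  unfolding beta_limit_def by (drule spec[of _ 0]) (auto simp: alp_bet_Nil)

lemma infinite_shift:
  assumes "infinite {n. P n}" shows "infinite {n::nat. P (k + n)}"
proof
  assume "finite {n. P (k + n)}"
  then have "finite ((+) k ` {n. P (k + n)} \<union> {..<k})" by simp
  moreover have "{n. P n} \<subseteq> (+) k ` {n. P (k + n)} \<union> {..<k}"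
  proof
    fix n assume "n \<in> {n. P n}"
    then show "n \<in> (+) k ` {n. P (k + n)} \<union> {..<k}"
      by (cases "n < k") (auto intro!: image_eqI[of _ _ "n - k"])
  qed
  ultimately show False using assms finite_subset by blast
qed

text \<open>The first operation is the outermost substitution, so it can be removed from all
  reversed \<beta>_n with \<open>n > 0\<close> at once.\<close>

lemma beta_limit_desubst:
  assumes inf: "infinite {n. \<not> d n}" and S: "beta_limit d S"
  shows "\<exists>S'. S = stsub (d 0) S' \<and> beta_limit (\<lambda>i. d (Suc i)) S'"
proof -
  have inf': "infinite {n. \<not> d (Suc n)}" using infinite_shift[OF inf, of 1] by simp
  then obtain S' where S': "beta_limit (\<lambda>i. d (Suc i)) S'" using beta_limit_exists[of "\<lambda>i. d (Suc i)"] by blast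
  have e: "rev (bet (map d [0..<Suc n])) = ltsub (d 0) (rev (bet (map (\<lambda>i. d (Suc i)) [0..<n])))" for n
    by (simp add: rev_bet map_upt_0_Suc del: upt_Suc)
  have "S = stsub (d 0) S'"
  proof (rule stream_eq_of_common_prefixes[where w = "\<lambda>n. rev (bet (map d [0..<Suc n]))"])
    show "\<exists>Y. S = rev (bet (map d [0..<Suc n])) @- Y" for n using S unfolding beta_limit_def by blast
    show "\<exists>Y. stsub (d 0) S' = rev (bet (map d [0..<Suc n])) @- Y" for n
      using S' unfolding beta_limit_def e by (metis stsub_simps(2))
    show "\<exists>n. k \<le> length (rev (bet (map d [0..<Suc n])))" for k
      using rev_bet_unbounded[OF inf, of k] rev_bet_chain prefix_length_le le_trans by metis
  qed
  then show ?thesis using S' by blast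
qed

lemma beta_limit_foldr:
  assumes inf: "infinite {n. \<not> d n}" and S: "beta_limit d S"
  shows "\<exists>T. S = foldr stsub (map d [0..<n]) T \<and> beta_limit (\<lambda>i. d (n + i)) T"
proof (induction n)
  case 0 show ?case using S by simp
next
  case (Suc n)
  then obtain T where T: "S = foldr stsub (map d [0..<n]) T" "beta_limit (\<lambda>i. d (n + i)) T" by blast
  obtain T' where "T = stsub (d (n + 0)) T'" "beta_limit (\<lambda>i. d (n + Suc i)) T'"
    using beta_limit_desubst[OF infinite_shift[OF inf, of n] T(2)] by blast
  then show ?case using T by (intro exI[of _ T']) simp
qed

section \<open>The words of the forms satisfy the combinatorial condition\<close>

lemma markov_foldr_stsub: "markov S \<Longrightarrow> markov (foldr stsub os S)"
proof (induction os)
  case (Cons d os) then show ?case by (cases d) (auto simp: markov_stsub_True markov_stsub_False)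
qed simp

lemma markov_b: "markov (cycle [Lb])"
proof -
  have "cycle [Lb] \<noteq> u @- La ## X" for u X
    by (metis Un_iff insertI1 letter.distinct(1) list.set(1) list.set(2) sset_cycle sset_shift singletonD
        stream.set_intros(1) list.distinct(1))
  moreover have "u @- Lb ## La ## X = (u @ [Lb]) @- La ## X" for u X by simp
  ultimately show ?thesis unfolding markov_def by metis
qed

lemma markov_ba: "markov (Lb ## cycle [La])"
proof -
  have nb: "cycle [La] \<noteq> u @- Lb ## X" for u X
    by (metis Un_iff insertI1 letter.distinct(1) list.set(1) list.set(2) sset_cycle sset_shift singletonD
        stream.set_intros(1) list.distinct(1))
  have 1: "Lb ## cycle [La] \<noteq> u @- La ## Lb ## R" for u R
  proof (cases u)
    case (Cons c v)
    then show ?thesis using nb[of "v @ [La]" R] by auto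
  qed simp
  have 2: "u = []" if "Lb ## cycle [La] = u @- Lb ## La ## R" for u R
    using that nb[of _ "La ## R"] by (cases u) auto
  show ?thesis unfolding markov_def using 1 2 by fastforce
qed

lemma markov_if_prefixes:
  assumes "\<And>n. \<exists>S'. markov S' \<and> stake n S' = stake n S"
  shows "markov S"
proof -
  have lex_gt_cong: "lex_gt x R = lex_gt x R'" if "stake (length x) R = stake (length x) R'" for x R R'
    using that
  proof (induction x arbitrary: R R')
    case (Cons c x) show ?case using Cons.prems Cons.IH[of "stl R" "stl R'"] by simp
  qed simp
  \<comment> \<open>The condition at \<open>u\<close> looks at \<open>u\<close>, two letters and at
    most \<open>length u\<close> letters of \<open>R\<close>, hence the bound
    \<open>2 * length u + 2\<close>.\<close>
  have split: "\<exists>R'. S' = u @- c ## e ## R' \<and> stake (length u) R' = stake (length u) R"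
    if "stake (2 * length u + 2) S' = stake (2 * length u + 2) S" "S = u @- c ## e ## R" for S' u c e R
  proof -
    let ?m = "length (u @ [c, e])"
    have "2 * length u + 2 = ?m + length u" by simp
    then have *: "stake ?m S' @ stake (length u) (sdrop ?m S') = stake ?m S @ stake (length u) (sdrop ?m S)"
      using that(1) by (metis stake_add)
    then have "stake ?m S' = stake ?m S" "stake (length u) (sdrop ?m S') = stake (length u) (sdrop ?m S)"
      by (auto simp del: stake_add)
    moreover have "S = (u @ [c, e]) @- R" using that(2) by simp
    then have "stake ?m S = u @ [c, e]" "sdrop ?m S = R"
      by (simp_all only: stake_shift sdrop_shift diff_self_eq_0 stake.simps sdrop.simps take_all drop_all order_refl append_Nil2 shift.simps)
    moreover have "S' = stake ?m S' @- sdrop ?m S'" by (simp only: stake_sdrop)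
    ultimately show ?thesis by (metis append_Cons append_Nil shift.simps shift_append)
  qed
  show ?thesis unfolding markov_def
  proof (intro conjI allI impI)
    fix u R assume S: "S = u @- La ## Lb ## R"
    obtain S' where "markov S'" "stake (2 * length u + 2) S' = stake (2 * length u + 2) S" using assms by blast
    moreover then obtain R' where "S' = u @- La ## Lb ## R'" "stake (length u) R' = stake (length u) R"
      using split S by blast
    ultimately show "lex_gt (rev u) R" using lex_gt_cong[of "rev u" R R'] unfolding markov_def by simp
  next
    fix u R assume S: "S = u @- Lb ## La ## R"
    obtain S' where "markov S'" "stake (2 * length u + 2) S' = stake (2 * length u + 2) S" using assms by blast
    moreover then obtain R' where "S' = u @- Lb ## La ## R'" "stake (length u) R' = stake (length u) R"
      using split S by blast
    ultimately show "\<not> lex_gt (rev u) R" using lex_gt_cong[of "rev u" R R'] unfolding markov_def by simp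
  qed
qed

text \<open>Prefixes of the limit are prefixes of periodic words with period a reversed \<beta>_n,
  and these are images of \<open>b^\<infinity>\<close>.\<close>

lemma markov_beta_limit:
  assumes inf: "infinite {n. \<not> d n}" and S: "beta_limit d S"
  shows "markov S"
proof (rule markov_if_prefixes)
  fix k
  obtain n where n: "k \<le> length (rev (bet (map d [0..<n])))" (is "_ \<le> length ?w")
    using rev_bet_unbounded[OF inf] by blast
  have "cycle ?w = foldr stsub (map d [0..<n]) (cycle [Lb])" by (simp add: foldr_stsub_cycle rev_bet)
  then have "markov (cycle ?w)" using markov_foldr_stsub[OF markov_b] by simp
  moreover have "stake k (cycle ?w) = stake k S"
  proof -
    obtain Y where "S = ?w @- Y" using S unfolding beta_limit_def by blast
    then have "stake k S = take k ?w" using n by (simp add: stake_shift)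
    moreover have "cycle ?w = ?w @- cycle ?w" by (rule cycle_decomp) simp
    then have "stake k (cycle ?w) = take k ?w" using n
      by (metis append_Nil2 diff_is_0_eq stake.simps(1) stake_shift)
    ultimately show ?thesis by simp
  qed
  ultimately show "\<exists>S'. markov S' \<and> stake k S' = stake k S" by blast
qed


subsection \<open>Factorizations\<close>

definition mirrored :: "letter stream \<Rightarrow> letter list \<Rightarrow> letter stream \<Rightarrow> bool" where
  "mirrored S \<theta> R \<longleftrightarrow> S = (rev \<theta> @ [Lb, La] @ \<theta>) @- R"

text \<open>The centre \<open>ba\<close> leads to a centre \<open>ba\<close> of the image. Under
  \<open>U\<close> the conjugacy moves one \<open>b\<close> across on both sides, so \<theta>
  becomes \<open>b\<close> followed by its image; under \<open>V\<close> it becomes its image. The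
  remainder changes from \<open>stsub\<close> to \<open>ssub\<close>. Every \<open>U\<close> makes
  \<theta> longer.\<close>

lemma mirrored_foldr_stsub:
  "\<exists>\<theta>. length (filter (\<lambda>x. x) os) \<le> length \<theta> \<and> mirrored (foldr stsub os (Lb ## La ## X)) \<theta> (foldr ssub os X)"
proof (induction os)
  case Nil show ?case by (intro exI[of _ "[]"]) (simp add: mirrored_def)
next
  case (Cons d os)
  then obtain \<theta> where \<theta>: "length (filter (\<lambda>x. x) os) \<le> length \<theta>"
    "foldr stsub os (Lb ## La ## X) = (rev \<theta> @ [Lb, La] @ \<theta>) @- foldr ssub os X"
    unfolding mirrored_def by blast
  have len: "length \<theta> \<le> length (lsub d \<theta>)" for d
  proof (induction \<theta>)
    case (Cons c w) then show ?case by (cases d; cases c) auto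
  qed simp
  show ?case
  proof (cases d)
    case True
    have "ltsub True \<theta> @- stsub True (foldr ssub os X) = (Lb # lsub True \<theta>) @- ssub True (foldr ssub os X)"
      using ltsub_True_Lb[of \<theta>] by (metis stsub_True_eq shift.simps(1,2) shift_append)
    then have "mirrored (foldr stsub (d # os) (Lb ## La ## X)) (Lb # lsub True \<theta>) (foldr ssub (d # os) X)"
      using True \<theta>(2) by (simp add: mirrored_def)
    moreover have "length (filter (\<lambda>x. x) (d # os)) \<le> length (Lb # lsub True \<theta>)"
      using \<theta>(1) len[of True] True by simp
    ultimately show ?thesis by blast
  next
    case False
    have "La ## (ltsub False \<theta> @- stsub False (foldr ssub os X)) = lsub False \<theta> @- ssub False (foldr ssub os X)"
      using lsub_False_La[of \<theta>] by (metis ssub_False_eq shift.simps(1,2) shift_append)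
    then have "mirrored (foldr stsub (d # os) (Lb ## La ## X)) (lsub False \<theta>) (foldr ssub (d # os) X)"
      using False \<theta>(2) by (simp add: mirrored_def)
    moreover have "length (filter (\<lambda>x. x) (d # os)) \<le> length (lsub False \<theta>)"
      using \<theta>(1) len[of False] False by simp
    ultimately show ?thesis by blast
  qed
qed

text \<open>A \<open>V\<close> step puts \<alpha> in front of \<beta>, and the later steps keep this
  beginning in both words.\<close>

lemma alpha_limit_prefix_alp_bet:
  assumes "infinite {n. d n}" "infinite {n. \<not> d n}" "alpha_limit d L"
  shows "\<exists>n0. \<forall>n\<ge>n0. prefix (stake k L) (alp (map d [0..<n])) \<and> prefix (stake k L) (bet (map d [0..<n]))"
proof -
  have "word_tendsto (\<lambda>n. alp (map d [0..<n])) L" using assms alpha_limit_iff by blast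
  then obtain n1 where n1: "\<And>n. n1 \<le> n \<Longrightarrow> prefix (stake k L) (alp (map d [0..<n]))"
    unfolding word_tendsto_def eventually_sequentially by blast
  obtain n2 where n2: "n1 \<le> n2" "\<not> d n2" using assms(2) by (auto simp: infinite_nat_iff_unbounded_le)
  have "prefix (stake k L) (bet (map d [0..<n]))" if "Suc n2 \<le> n" for n
    using that
  proof (induction n rule: dec_induct)
    case base
    show ?case using n1[of n2] n2 by (simp add: alp_bet_snoc prefix_prefix)
  next
    case (step n)
    show ?case using step n1[of n] n2 by (cases "d n") (simp_all add: alp_bet_snoc prefix_prefix)
  qed
  then show ?thesis using n1 n2 by (intro exI[of _ "Suc n2"]) auto
qed

text \<open>Stop the desubstitution right before a \<open>V\<close>, where the remaining word begins
  with \<open>ba\<close>, and carry this factorization back. Its remainder begins with \<alpha>_n or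
  \<beta>_n, and both begin with a long prefix of \<open>L\<close>. The length of \<theta> is at
  least the number of \<open>U\<close> steps so far.\<close>

lemma beta_limit_mirrored:
  assumes d: "infinite {n. d n}" "infinite {n. \<not> d n}" and S: "beta_limit d S" and L: "alpha_limit d L"
  shows "\<exists>\<theta> R. mirrored S \<theta> R \<and> l \<le> length \<theta> \<and> stake k R = stake k L"
proof -
  obtain n0 where n0: "\<And>n. n0 \<le> n \<Longrightarrow> prefix (stake k L) (alp (map d [0..<n]))"
    "\<And>n. n0 \<le> n \<Longrightarrow> prefix (stake k L) (bet (map d [0..<n]))"
    using alpha_limit_prefix_alp_bet[OF d L] by blast
  let ?c = "\<lambda>n. length (filter (\<lambda>x. x) (map d [0..<n]))"
  have mono: "?c n \<le> ?c (Suc n)" for n by simp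
  have "\<exists>n. l \<le> ?c n"
  proof (rule unbounded_of_infinite_steps[of ?c, OF mono])
    have "{n. ?c n < ?c (Suc n)} = {n. d n}" by auto
    then show "infinite {n. ?c n < ?c (Suc n)}" using d by simp
  qed
  then obtain n1 where n1: "l \<le> ?c n1" by blast
  obtain n where n: "max n0 n1 \<le> n" "\<not> d n"
    using d(2) unfolding infinite_nat_iff_unbounded_le by blast
  have ln: "l \<le> ?c n" using n1 lift_Suc_mono_le[of ?c, OF mono, of n1 n] n by simp
  obtain T where T: "S = foldr stsub (map d [0..<n]) T" "beta_limit (\<lambda>i. d (n + i)) T"
    using beta_limit_foldr[OF d(2) S] by blast
  obtain T' where T': "T = stsub (d (n + 0)) T'" "beta_limit (\<lambda>i. d (n + Suc i)) T'"
    using beta_limit_desubst[OF infinite_shift[OF d(2), of n] T(2)] by blast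
  obtain Y where Y: "T' = Lb ## Y" using shd_beta_limit[OF T'(2)] by (metis stream.collapse)
  let ?X = "stsub False Y"
  have "T = Lb ## La ## ?X" using T' Y n by simp
  then obtain \<theta> where \<theta>: "?c n \<le> length \<theta>" "mirrored S \<theta> (foldr ssub (map d [0..<n]) ?X)"
    using mirrored_foldr_stsub[of "map d [0..<n]" ?X] T by auto
  obtain e Z where e: "?X = [e] @- Z" by (metis shift.simps stream.collapse)
  have "foldr ssub (map d [0..<n]) ?X = foldr lsub (map d [0..<n]) [e] @- foldr ssub (map d [0..<n]) Z"
    unfolding e by (rule foldr_ssub_shift)
  moreover have "prefix (stake k L) (foldr lsub (map d [0..<n]) [e])"
    using n0[of n] n by (cases e) (simp_all add: alp_def bet_def)
  ultimately have "stake k (foldr ssub (map d [0..<n]) ?X) = stake k L"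
    by (auto simp: prefix_def stake_shift)
  then show ?thesis using \<theta> ln by (meson le_trans)
qed

lemma mirrored_length_bounded:
  assumes "ultimately_periodic S"
  shows "\<exists>B. \<forall>\<theta> R. mirrored S \<theta> R \<longrightarrow> length \<theta> \<le> B"
proof -
  obtain k p where p: "p > 0" "\<And>n. n \<ge> k \<Longrightarrow> S !! (n + p) = S !! n"
    using assms unfolding ultimately_periodic_def by blast
  have "length \<theta> \<le> k + p" if "mirrored S \<theta> R" for \<theta> R
  proof (rule ccontr)
    assume "\<not> length \<theta> \<le> k + p"
    define m where "m = length \<theta>"
    have m: "k + p < m" using \<open>\<not> length \<theta> \<le> k + p\<close> by (simp add: m_def)
    have S: "S = (rev \<theta> @ Lb # La # \<theta>) @- R" using that by (simp add: mirrored_def)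
    have 1: "S !! i = (rev \<theta> @ Lb # La # \<theta>) ! i" if "i < 2 * m + 2" for i
      using that unfolding S by (intro shift_snth_less) (simp add: m_def)
    \<comment> \<open>The centre is at \<open>m\<close> and \<open>m + 1\<close>. Moving outwards by
      the period leads to two mirror positions, both holding
      \<open>\<theta> ! (p - 1)\<close>.\<close>
    have "S !! (m - p) = S !! m" using p(2)[of "m - p"] m by simp
    moreover have "S !! (m + 1 + p) = S !! (m + 1)" using p(2)[of "m + 1"] m by simp
    moreover have "S !! m = Lb" using 1[of m] by (simp add: nth_append m_def)
    moreover have "S !! (m + 1) = La" using 1[of "m + 1"] by (simp add: nth_append m_def)
    moreover have "S !! (m - p) = \<theta> ! (p - 1)" 
    proof -
      have "m - p < length \<theta>" "length \<theta> - Suc (m - p) = p - 1" using p(1) m by (auto simp: m_def)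
      then show ?thesis using 1[of "m - p"] by (simp add: nth_append m_def rev_nth)
    qed
    moreover have "S !! (m + 1 + p) = \<theta> ! (p - 1)"
      using 1[of "m + 1 + p"] p(1) m by (simp add: nth_append m_def nth_Cons')
    ultimately show False by simp
  qed
  then show ?thesis by blast
qed

definition slt :: "letter stream \<Rightarrow> letter stream \<Rightarrow> bool" where
  "slt X Y \<longleftrightarrow> (\<exists>w X' Y'. X = w @- La ## X' \<and> Y = w @- Lb ## Y')"

lemma slt_Stream: "slt (c ## X) (c ## Y) = slt X Y"
proof
  assume "slt (c ## X) (c ## Y)"
  then obtain w X' Y' where w: "c ## X = w @- La ## X'" "c ## Y = w @- Lb ## Y'" unfolding slt_def by blast
  then obtain w' where "w = c # w'" by (cases w) auto
  then show "slt X Y" using w unfolding slt_def by auto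
next
  assume "slt X Y"
  then obtain w X' Y' where "X = w @- La ## X'" "Y = w @- Lb ## Y'" unfolding slt_def by blast
  then show "slt (c ## X) (c ## Y)" unfolding slt_def
    by (intro exI[of _ "c # w"] exI[of _ X'] exI[of _ Y']) simp
qed

lemma slt_shift: "slt (w @- X) (w @- Y) = slt X Y"
  by (induction w) (auto simp: slt_Stream)

text \<open>Raising an \<open>a\<close> of the larger word to \<open>b\<close> keeps it larger
  whatever follows. This turns a comparison with a finite word into one of streams.\<close>

lemma lex_gt_imp_slt:
  assumes "lex_gt (\<tau> @ La # x) A"
  shows "slt A (\<tau> @- Lb ## Y)"
  using assms
proof (induction \<tau> arbitrary: A)
  case Nil
  obtain e A' where e: "A = e ## A'" by (cases A)
  have "e = La" using Nil e by (auto split: if_splits)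
  then show ?case unfolding slt_def using e by (intro exI[of _ "[]"]) simp
next
  case (Cons c \<tau>)
  obtain e A' where e: "A = e ## A'" by (cases A)
  show ?case
  proof (cases "c = e")
    case True
    then show ?thesis using Cons e by (simp add: slt_Stream)
  next
    case False
    then have "c = Lb" "e = La" using Cons.prems e by (cases c; cases e; simp)+
    then show ?thesis unfolding slt_def using e by (intro exI[of _ "[]"]) simp
  qed
qed

text \<open>Lowering a \<open>b\<close> of the smaller word keeps it smaller; if the finite word is
  a prefix, the lowered letter is the first difference.\<close>

lemma lex_lt_imp_slt:
  assumes "lex_lt (\<tau> @ Lb # x) A \<or> (\<exists>R. A = (\<tau> @ Lb # x) @- R)"
  shows "slt (\<tau> @- La ## Y) A"
  using assms
proof (induction \<tau> arbitrary: A)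
  case Nil
  obtain e A' where e: "A = e ## A'" by (cases A)
  have "e = Lb" using Nil e by (auto split: if_splits)
  then show ?case unfolding slt_def using e by (intro exI[of _ "[]"]) simp
next
  case (Cons c \<tau>)
  obtain e A' where e: "A = e ## A'" by (cases A)
  show ?case
  proof (cases "c = e")
    case True
    then have "lex_lt (\<tau> @ Lb # x) A' \<or> (\<exists>R. A' = (\<tau> @ Lb # x) @- R)" using Cons.prems e by simp
    then show ?thesis using Cons.IH True e by (simp add: slt_Stream)
  next
    case False
    then have "c = La" "e = Lb" using Cons.prems e by (cases c; cases e; simp)+
    then show ?thesis unfolding slt_def using e by (intro exI[of _ "[]"]) simp
  qed
qed

text \<open>The centre of the shorter factorization lies in the reversal of \<open>\<theta>2\<close>
  and reappears in \<open>\<theta>2\<close> as \<open>ab\<close>, followed by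
  \<open>\<theta>1 R2\<close>. The \<open>ab\<close> condition there puts
  \<open>\<theta>1 R2\<close> below a word that begins with \<open>\<tau> a\<close>, while
  \<open>\<theta>1 R1\<close> begins with \<open>\<tau> b\<close>.\<close>

lemma longer_mirrored_smaller:
  assumes M: "markov S" and f1: "mirrored S \<theta>1 R1" and f2: "mirrored S \<theta>2 R2" and len: "length \<theta>1 < length \<theta>2"
  shows "slt R2 R1"
proof -
  have eq: "rev \<theta>2 @- Lb ## La ## (\<theta>2 @- R2) = rev \<theta>1 @- Lb ## La ## (\<theta>1 @- R1)"
    using f1 f2 by (simp add: mirrored_def)
  define \<rho> where "\<rho> = drop (length \<theta>1) (rev \<theta>2)"
  have r: "rev \<theta>2 = take (length \<theta>1) (rev \<theta>2) @ \<rho>" by (simp add: \<rho>_def)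
  have "take (length \<theta>1) (rev \<theta>2) @- (\<rho> @- Lb ## La ## (\<theta>2 @- R2)) = rev \<theta>1 @- Lb ## La ## (\<theta>1 @- R1)"
    using eq r by (metis shift_append)
  then have t: "take (length \<theta>1) (rev \<theta>2) = rev \<theta>1" and \<rho>: "\<rho> @- Lb ## La ## (\<theta>2 @- R2) = Lb ## La ## (\<theta>1 @- R1)"
    using len by (subst (asm) shift_eq_shift_same_length; simp)+
  have "\<rho> \<noteq> []" using len by (simp add: \<rho>_def)
  then obtain \<rho>' where \<rho>': "\<rho> = Lb # \<rho>'" using \<rho> by (cases \<rho>) auto
  then obtain \<tau> where \<tau>: "\<rho> = Lb # La # \<tau>" using \<rho> by (cases \<rho>') auto
  have B: "\<theta>1 @- R1 = \<tau> @- Lb ## La ## (\<theta>2 @- R2)" using \<rho> \<tau> by simp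
  have "rev \<theta>2 = rev \<theta>1 @ Lb # La # \<tau>" using r t \<tau> by simp
  then have \<theta>2: "\<theta>2 = rev \<tau> @ [La, Lb] @ \<theta>1" by (metis append.assoc append_Cons append_Nil rev.simps rev_append rev_rev_ident)
  have "S = (rev \<theta>1 @ [Lb, La] @ \<tau> @ [Lb, La] @ rev \<tau>) @- La ## Lb ## (\<theta>1 @- R2)"
    using f2 \<theta>2 by (simp add: mirrored_def)
  then have "lex_gt (rev (rev \<theta>1 @ [Lb, La] @ \<tau> @ [Lb, La] @ rev \<tau>)) (\<theta>1 @- R2)"
    using M unfolding markov_def by blast
  then have "lex_gt (\<tau> @ La # (Lb # rev \<tau> @ [La, Lb] @ \<theta>1)) (\<theta>1 @- R2)" by simp
  then have "slt (\<theta>1 @- R2) (\<theta>1 @- R1)" unfolding B by (rule lex_gt_imp_slt)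
  then show ?thesis by (simp add: slt_shift)
qed

lemma mirrored_same_length:
  assumes "mirrored S \<theta>1 R1" "mirrored S \<theta>2 R2" "length \<theta>1 = length \<theta>2"
  shows "\<theta>1 = \<theta>2" "R1 = R2"
proof -
  have "(rev \<theta>1 @ [Lb, La] @ \<theta>1) @- R1 = (rev \<theta>2 @ [Lb, La] @ \<theta>2) @- R2"
    using assms by (simp only: mirrored_def)
  then have "rev \<theta>1 @ [Lb, La] @ \<theta>1 = rev \<theta>2 @ [Lb, La] @ \<theta>2 \<and> R1 = R2"
    using assms(3) by (subst (asm) shift_eq_shift_same_length) auto
  then show "\<theta>1 = \<theta>2" "R1 = R2" using assms(3) by auto
qed

text \<open>Look at the first \<open>ba\<close>. The word before it is a power of \<open>b\<close>,
  which is never the smaller one, so the \<open>ba\<close> condition only leaves the case that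
  \<open>R\<close> begins with the same power.\<close>

lemma markov_mirrored_exists:
  assumes M: "markov S" and b: "shd S = Lb" and ne: "S \<noteq> cycle [Lb]"
  shows "\<exists>\<theta> R. mirrored S \<theta> R"
proof -
  have "\<exists>j. S !! j = La" using stream_all_eq_imp_cycle[of S Lb] ne letter.exhaust by metis
  then have "\<exists>j. S !! j = La \<and> (\<forall>i<j. S !! i \<noteq> La)" by (rule exists_least_iff[THEN iffD1])
  then obtain j where j: "S !! j = La" "\<And>i. i < j \<Longrightarrow> S !! i \<noteq> La" by blast
  have "j \<noteq> 0" using j b by (cases j) auto
  then obtain i where i: "j = Suc i" by (cases j) auto
  have st: "stake i S = replicate i Lb"
    using j(2) i by (intro nth_equalityI) (auto simp: letter_neq)
  have "S !! i = Lb" using j(2)[of i] i by (simp add: letter_neq)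
  then have S: "S = replicate i Lb @- Lb ## La ## sdrop (Suc (Suc i)) S"
    using snth_split2[of S i] j(1) i st by simp
  then have "\<not> lex_gt (rev (replicate i Lb)) (sdrop (Suc (Suc i)) S)" using M unfolding markov_def by blast
  moreover have "\<not> lex_lt (replicate i Lb) X" for X
  proof
    assume "lex_lt (replicate i Lb) X"
    then obtain w x' where "replicate i Lb = w @ La # x'" by (auto simp: lex_lt_iff)
    then have "La \<in> set (replicate i Lb)" by simp
    then show False by simp
  qed
  ultimately obtain R' where "sdrop (Suc (Suc i)) S = replicate i Lb @- R'"
    using lex_gt_lt_prefix_cases[of "replicate i Lb" "sdrop (Suc (Suc i)) S"] by auto
  then have "mirrored S (replicate i Lb) R'" using S by (simp add: mirrored_def)
  then show ?thesis by blast
qed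

lemma longest_mirrored_exists:
  assumes "ultimately_periodic S" "markov S" "shd S = Lb" "S \<noteq> cycle [Lb]"
  shows "\<exists>\<theta> R. mirrored S \<theta> R \<and> (\<forall>\<theta>' R'. mirrored S \<theta>' R' \<longrightarrow> length \<theta>' \<le> length \<theta>)"
proof -
  obtain B where B: "\<And>\<theta> R. mirrored S \<theta> R \<Longrightarrow> length \<theta> \<le> B" using mirrored_length_bounded[OF assms(1)] by blast
  let ?P = "\<lambda>n. \<exists>\<theta> R. mirrored S \<theta> R \<and> length \<theta> = n"
  obtain n where n: "?P n" using markov_mirrored_exists[OF assms(2-4)] by blast
  have bd: "\<And>y. ?P y \<Longrightarrow> y \<le> B" using B by blast
  have "?P (Greatest ?P)" by (rule GreatestI_nat[of ?P n B]) (use n bd in auto)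
  moreover have "length \<theta>' \<le> Greatest ?P" if "mirrored S \<theta>' R'" for \<theta>' R'
    by (rule Greatest_le_nat[of ?P _ B]) (use that bd in auto)
  ultimately show ?thesis by metis
qed

text \<open>The limit has factorizations with arbitrarily long \<theta>, an ultimately periodic word
  has not.\<close>

lemma beta_limit_not_periodic:
  assumes "infinite {n. d n}" "infinite {n. \<not> d n}" "beta_limit d S"
  shows "\<not> ultimately_periodic S"
proof
  assume "ultimately_periodic S"
  then obtain B where B: "\<And>\<theta> R. mirrored S \<theta> R \<Longrightarrow> length \<theta> \<le> B" using mirrored_length_bounded by blast
  obtain L where "alpha_limit d L" using alpha_limit_exists[OF assms(1)] by blast
  then obtain \<theta> R where "mirrored S \<theta> R" "Suc B \<le> length \<theta>" using beta_limit_mirrored[OF assms, of L "Suc B" 0] by blast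
  then show False using B[of \<theta> R] by simp
qed

subsection \<open>Admissible words\<close>

text \<open>\<open>E R\<close> stands for: the past is smaller than \<open>R\<close>.\<close>

definition admissible :: "letter stream \<Rightarrow> (letter stream \<Rightarrow> bool) \<Rightarrow> bool" where
  "admissible T E \<longleftrightarrow>
     (\<forall>u R. T = u @- La ## Lb ## R \<longrightarrow> lex_gt (rev u) R \<or> (\<exists>R'. R = rev u @- R' \<and> \<not> E R')) \<and>
     (\<forall>u R. T = u @- Lb ## La ## R \<longrightarrow> lex_lt (rev u) R \<or> (\<exists>R'. R = rev u @- R' \<and> E R'))"

text \<open>An upper set in which membership of each word is decided by finitely many of its
  letters. Comparison with a rational past has this property, because no value equals the
  past.\<close>

definition lex_cut :: "(letter stream \<Rightarrow> bool) \<Rightarrow> bool" where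
  "lex_cut E \<longleftrightarrow> (\<forall>X Y. slt X Y \<longrightarrow> E X \<longrightarrow> E Y) \<and> (\<forall>L. \<exists>k. \<forall>R. stake k R = stake k L \<longrightarrow> E R = E L)"

text \<open>The hypothesis on \<open>a R1\<close> is what minimality of \<open>N\<close> provides. A
  tie at \<open>ab\<close> leaves a remainder \<open>R'\<close> that does not exceed the past. If
  \<open>R'\<close> begins with \<open>b\<close>, it is above \<open>a R1\<close>. If it begins with
  \<open>a\<close>, the tie creates a junction \<open>ba\<close> further on, whose condition again
  puts \<open>R'\<close> above \<open>a R1\<close>. Either way the past is smaller than
  \<open>R'\<close>, a contradiction.\<close>

lemma admissible_imp_markov:
  assumes A: "admissible T E" and E: "lex_cut E" and T: "T = Lb ## R1" and E1: "E (La ## R1)"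
  shows "markov T"
proof -
  have up: "slt X Y \<Longrightarrow> E X \<Longrightarrow> E Y" for X Y using E unfolding lex_cut_def by blast
  have 1: "lex_gt (rev u) R" if u: "T = u @- La ## Lb ## R" for u R
  proof (rule ccontr)
    assume "\<not> lex_gt (rev u) R"
    then obtain R' where R': "R = rev u @- R'" "\<not> E R'" using A u unfolding admissible_def by blast
    obtain u1 where u1: "u = Lb # u1" using u T by (cases u) auto
    have R1: "R1 = u1 @- La ## (Lb ## R)" using T u u1 by simp
    obtain e R'' where e: "R' = e ## R''" by (cases R')
    show False
    proof (cases e)
      case Lb
      then have "slt (La ## R1) R'" unfolding slt_def using e by (intro exI[of _ "[]"]) simp
      then show False using up E1 R' by blast
    next
      case La
      \<comment> \<open>The last letter of \<open>rev u\<close> is the first letter \<open>b\<close>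
        of \<open>u\<close>; with the \<open>a\<close> after it this is the new junction.\<close>
      let ?v = "Lb # u1 @ [La, Lb] @ rev u1"
      have "T = ?v @- Lb ## La ## R''" using u u1 R' e La by simp
      then have "lex_lt (rev ?v) R'' \<or> (\<exists>R'. R'' = rev ?v @- R')" using A unfolding admissible_def by blast
      then have "lex_lt (u1 @ Lb # (La # rev u1 @ [Lb])) R'' \<or> (\<exists>R'. R'' = (u1 @ Lb # (La # rev u1 @ [Lb])) @- R')"
        by simp
      then have "slt R1 R''" unfolding R1 by (rule lex_lt_imp_slt)
      then have "slt (La ## R1) R'" using e La by (simp add: slt_Stream)
      then show False using up E1 R' by blast
    qed
  qed
  have 2: "\<not> lex_gt (rev u) R" if "T = u @- Lb ## La ## R" for u R
  proof -
    have "lex_lt (rev u) R \<or> (\<exists>R'. R = rev u @- R')" using A that unfolding admissible_def by blast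
    then show ?thesis using not_lex_gt_and_lex_lt not_lex_gt_prefix by blast
  qed
  show ?thesis unfolding markov_def using 1 2 by blast
qed

lemma admissible_mirrored:
  assumes "admissible T E" "mirrored T \<theta> R"
  shows "E R"
proof -
  have "T = rev \<theta> @- Lb ## La ## (\<theta> @- R)" using assms(2) by (simp add: mirrored_def)
  then have "lex_lt (rev (rev \<theta>)) (\<theta> @- R) \<or> (\<exists>R'. \<theta> @- R = rev (rev \<theta>) @- R' \<and> E R')"
    using assms(1) unfolding admissible_def by blast
  then show ?thesis by (auto simp: not_lex_lt_prefix)
qed

lemma markov_imp_admissible:
  assumes M: "markov T" and F: "\<And>\<theta> R. mirrored T \<theta> R \<Longrightarrow> E R"
  shows "admissible T E"
  unfolding admissible_def
proof (intro conjI allI impI)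
  show "lex_gt (rev u) R \<or> (\<exists>R'. R = rev u @- R' \<and> \<not> E R')" if "T = u @- La ## Lb ## R" for u R
    using M that unfolding markov_def by blast
  show "lex_lt (rev u) R \<or> (\<exists>R'. R = rev u @- R' \<and> E R')" if T: "T = u @- Lb ## La ## R" for u R
  proof -
    have "\<not> lex_gt (rev u) R" using M T unfolding markov_def by blast
    moreover have "E R'" if "R = rev u @- R'" for R'
      using T that by (intro F[of "rev u"]) (simp add: mirrored_def)
    ultimately show ?thesis using lex_gt_lt_prefix_cases by blast
  qed
qed

text \<open>The longest \<theta> has the smallest remainder, and \<open>E\<close> is an upper
  set.\<close>

lemma mirrored_all_if_longest:
  assumes M: "markov T" and E: "lex_cut E" and l: "mirrored T \<theta> R" "\<And>\<theta>' R'. mirrored T \<theta>' R' \<Longrightarrow> length \<theta>' \<le> length \<theta>"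
    and ER: "E R" and f: "mirrored T \<theta>' R'"
  shows "E R'"
proof (cases "length \<theta>' = length \<theta>")
  case True then show ?thesis using mirrored_same_length[OF f l(1)] ER by simp
next
  case False
  then have "slt R R'" using longer_mirrored_smaller[OF M f l(1)] l(2)[OF f] by simp
  then show ?thesis using E ER unfolding lex_cut_def by blast
qed

text \<open>At \<open>L\<close> the set \<open>E\<close> is decided by \<open>k\<close> letters, and
  remainders with these \<open>k\<close> letters occur for arbitrarily long \<theta>, hence below
  any given remainder.\<close>

lemma mirrored_all_if_alpha_limit:
  assumes d: "infinite {n. d n}" "infinite {n. \<not> d n}" and S: "beta_limit d S" and L: "alpha_limit d L"
    and E: "lex_cut E"
  shows "(\<forall>\<theta> R. mirrored S \<theta> R \<longrightarrow> E R) \<longleftrightarrow> E L"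
proof -
  obtain k where k: "\<And>R. stake k R = stake k L \<Longrightarrow> E R = E L" using E unfolding lex_cut_def by blast
  show ?thesis
  proof
    assume "\<forall>\<theta> R. mirrored S \<theta> R \<longrightarrow> E R"
    then show "E L" using beta_limit_mirrored[OF d S L, of 0 k] k by blast
  next
    assume EL: "E L"
    show "\<forall>\<theta> R. mirrored S \<theta> R \<longrightarrow> E R"
    proof (intro allI impI)
      fix \<theta> R assume f: "mirrored S \<theta> R"
      obtain \<theta>' R' where f': "mirrored S \<theta>' R'" "Suc (length \<theta>) \<le> length \<theta>'" "stake k R' = stake k L"
        using beta_limit_mirrored[OF d S L] by blast
      then have "slt R' R" using longer_mirrored_smaller[OF markov_beta_limit[OF d(2) S] f f'(1)] by simp
      moreover have "E R'" using k f' EL by blast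
      ultimately show "E R" using E unfolding lex_cut_def by blast
    qed
  qed
qed

subsection \<open>Exchanging the letters\<close>

fun swap :: "letter \<Rightarrow> letter" where
  "swap La = Lb" | "swap Lb = La"

lemma swap_swap [simp]: "swap (swap c) = c" by (cases c) auto
lemma map_swap_swap [simp]: "map swap (map swap w) = w" by (induction w) auto
lemma smap_swap_swap [simp]: "smap swap (smap swap S) = S"
  by (rule snth_ext) simp

text \<open>The exchange turns the transpose of \<open>U\<close> into \<open>V\<close> and the
  transpose of \<open>V\<close> into \<open>U\<close>. Therefore a reversed \<beta> becomes the
  \<alpha> of the complementary list of operations.\<close>

lemma map_swap_ltsub: "map swap (ltsub d w) = lsub (\<not> d) (map swap w)"
proof (induction w)
  case (Cons c w) then show ?case by (cases d; cases c) auto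
qed simp

lemma map_swap_foldr_ltsub: "map swap (foldr ltsub os w) = foldr lsub (map Not os) (map swap w)"
  by (induction os) (auto simp: map_swap_ltsub)

lemma map_swap_rev_alp: "map swap (rev (alp os)) = bet (map Not os)"
  and map_swap_rev_bet: "map swap (rev (bet os)) = alp (map Not os)"
  unfolding rev_alp rev_bet map_swap_foldr_ltsub by (simp_all add: alp_def bet_def)

lemma smap_cycle: "w \<noteq> [] \<Longrightarrow> smap f (cycle w) = cycle (map f w)"
  by (rule cycle_eqI) (metis cycle_decomp smap_shift, simp)


subsection \<open>Values of continued fractions\<close>

text \<open>This is \<open>[0; w]\<close> with the real number \<open>t\<close> added to the last
  digit; \<open>t\<close> stands for a past or for the value of an infinite tail.\<close>

definition cfF :: "int list \<Rightarrow> real \<Rightarrow> real" where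
  "cfF w t = foldr (\<lambda>y t. 1 / (of_int y + t)) w t"

lemma cfF_simps [simp]:
  "cfF [] t = t" "cfF (y # w) t = 1 / (of_int y + cfF w t)" "cfF (v @ w) t = cfF v (cfF w t)"
  by (simp_all add: cfF_def)

lemma cf_list_Cons: "cf_list (y # ys) = of_int y + cfF ys 0"
  by (induction ys arbitrary: y) auto

definition pos_list :: "int list \<Rightarrow> bool" where "pos_list w \<longleftrightarrow> (\<forall>y\<in>set w. 1 \<le> y)"
definition pos_stream :: "int stream \<Rightarrow> bool" where "pos_stream s \<longleftrightarrow> (\<forall>n. 1 \<le> s !! n)"

lemma pos_list_simps [simp]: "pos_list []" "pos_list (y # w) \<longleftrightarrow> 1 \<le> y \<and> pos_list w"
  "pos_list (v @ w) \<longleftrightarrow> pos_list v \<and> pos_list w" "pos_list (rev w) \<longleftrightarrow> pos_list w"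
  by (auto simp: pos_list_def)

lemma pos_stream_Stream [simp]: "pos_stream (y ## s) \<longleftrightarrow> 1 \<le> y \<and> pos_stream s"
proof -
  have "(\<forall>n. 1 \<le> (y ## s) !! n) \<longleftrightarrow> 1 \<le> (y ## s) !! 0 \<and> (\<forall>n. 1 \<le> (y ## s) !! Suc n)"
    by (metis not0_implies_Suc)
  then show ?thesis by (simp add: pos_stream_def)
qed

lemma pos_stream_shift [simp]: "pos_stream (w @- s) \<longleftrightarrow> pos_list w \<and> pos_stream s"
  by (induction w) auto

lemma pos_stake: "pos_stream s \<Longrightarrow> pos_list (stake n s)"
  by (metis pos_stream_shift stake_sdrop)
lemma pos_sdrop: "pos_stream s \<Longrightarrow> pos_stream (sdrop n s)"
  by (metis pos_stream_shift stake_sdrop)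

lemma cfF_bounds: "pos_list w \<Longrightarrow> 0 \<le> t \<Longrightarrow> t \<le> 1 \<Longrightarrow> 0 \<le> cfF w t \<and> cfF w t \<le> 1"
proof (induction w)
  case (Cons y w)
  then have "0 \<le> cfF w t" "1 \<le> real_of_int y" by auto
  then show ?case by (simp add: divide_simps)
qed simp

lemma cfF_less:
  "pos_list w \<Longrightarrow> 0 \<le> s \<Longrightarrow> s < t \<Longrightarrow> t \<le> 1 \<Longrightarrow>
    (if even (length w) then cfF w s < cfF w t else cfF w t < cfF w s)"
proof (induction w)
  case (Cons y w)
  then have "0 \<le> cfF w s" "0 \<le> cfF w t" "1 \<le> real_of_int y"
    using cfF_bounds[of w s] cfF_bounds[of w t] by auto
  then show ?case using Cons by (auto simp: divide_strict_left_mono)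
qed simp

lemma cfF_mono_even:
  assumes "pos_list w" "even (length w)" "0 \<le> s" "s \<le> 1" "0 \<le> t" "t \<le> 1"
  shows "cfF w s < cfF w t \<longleftrightarrow> s < t" "cfF w s \<le> cfF w t \<longleftrightarrow> s \<le> t"
  using cfF_less[of w s t] cfF_less[of w t s] assms by (cases s t rule: linorder_cases; simp)+

lemma cfF_mono_odd:
  assumes "pos_list w" "odd (length w)" "0 \<le> s" "s \<le> 1" "0 \<le> t" "t \<le> 1"
  shows "cfF w s < cfF w t \<longleftrightarrow> t < s" "cfF w s \<le> cfF w t \<longleftrightarrow> t \<le> s"
  using cfF_less[of w s t] cfF_less[of w t s] assms by (cases s t rule: linorder_cases; simp)+

lemma cfF_contract1:
  assumes "pos_list w" "0 \<le> s" "s \<le> 1" "0 \<le> t" "t \<le> 1"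
  shows "\<bar>cfF w s - cfF w t\<bar> \<le> \<bar>s - t\<bar>"
  using assms(1)
proof (induction w)
  case (Cons y w)
  define a b Y where "a = cfF w s" and "b = cfF w t" and "Y = real_of_int y"
  have ab: "0 \<le> a" "0 \<le> b" "1 \<le> Y" "\<bar>a - b\<bar> \<le> \<bar>s - t\<bar>"
    using Cons cfF_bounds assms by (auto simp: a_def b_def Y_def)
  have "1 / (Y + a) - 1 / (Y + b) = (b - a) / ((Y + a) * (Y + b))"
    using ab by (simp add: divide_simps)
  then have "\<bar>1 / (Y + a) - 1 / (Y + b)\<bar> = \<bar>a - b\<bar> / ((Y + a) * (Y + b))"
    using ab by (simp add: abs_mult abs_minus_commute)
  also have "\<dots> \<le> \<bar>a - b\<bar> / 1"
    using ab mult_mono[of 1 "Y + a" 1 "Y + b"] by (intro divide_left_mono) auto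
  finally show ?case using ab by (simp add: a_def b_def Y_def)
qed simp

text \<open>One digit need not contract uniformly, for instance a digit 1 near \<open>t = 0\<close>.
  Two digits \<open>x\<close>, \<open>y\<close> divide distances by at least 4, because
  \<open>x (y + t) + 1 \<ge> 2\<close> for \<open>t \<ge> 0\<close>.\<close>

lemma cfF_contract:
  assumes "pos_list w" "2 * n \<le> length w" "0 \<le> s" "s \<le> 1" "0 \<le> t" "t \<le> 1"
  shows "\<bar>cfF w s - cfF w t\<bar> \<le> (1/4) ^ n"
  using assms(1,2)
proof (induction n arbitrary: w)
  case 0 then show ?case using cfF_contract1[of w s t] assms by simp
next
  case (Suc n)
  then obtain x y v where w: "w = x # y # v"
    by (cases w rule: remdups_adj.cases) auto
  define a b X Y where "a = cfF v s" and "b = cfF v t" and "X = real_of_int x" and "Y = real_of_int y"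
  have xy: "1 \<le> X" "1 \<le> Y" and v: "pos_list v" "2 * n \<le> length v" using Suc.prems w by (auto simp: X_def Y_def)
  have ab: "0 \<le> a" "0 \<le> b" "\<bar>a - b\<bar> \<le> (1/4) ^ n"
    using Suc.IH[OF v] cfF_bounds[OF v(1)] assms by (auto simp: a_def b_def)
  have A: "2 \<le> X * (Y + a) + 1" "2 \<le> X * (Y + b) + 1"
    using xy ab mult_mono[of 1 X 1 "Y + a"] mult_mono[of 1 X 1 "Y + b"] by auto
  have f: "1 / (X + 1 / (Y + c)) = (Y + c) / (X * (Y + c) + 1)" if "0 \<le> c" for c
  proof -
    have "X + 1 / (Y + c) = (X * (Y + c) + 1) / (Y + c)" using xy that by (simp add: field_simps)
    then show ?thesis by simp
  qed
  have e: "(Y + a) / (X * (Y + a) + 1) - (Y + b) / (X * (Y + b) + 1)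
      = (a - b) / ((X * (Y + a) + 1) * (X * (Y + b) + 1))"
    using A by (simp add: diff_frac_eq) (simp add: algebra_simps)
  have "\<bar>cfF w s - cfF w t\<bar> = \<bar>(a - b) / ((X * (Y + a) + 1) * (X * (Y + b) + 1))\<bar>"
    using e f[of a] f[of b] ab by (simp add: w a_def b_def X_def Y_def)
  also have "\<dots> = \<bar>a - b\<bar> / ((X * (Y + a) + 1) * (X * (Y + b) + 1))"
    using A by (simp add: abs_mult)
  also have "\<dots> \<le> \<bar>a - b\<bar> / 4"
    using A mult_mono[of 2 "X * (Y + a) + 1" 2 "X * (Y + b) + 1"] by (intro divide_left_mono) auto
  also have "\<dots> \<le> (1/4) ^ Suc n" using ab by simp
  finally show ?case .
qed

text \<open>The value \<open>[0; s]\<close>, that is \<open>cf_stream\<close> without the integer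
  part.\<close>

definition cfv :: "int stream \<Rightarrow> real" where
  "cfv s = lim (\<lambda>n. cfF (stake n s) 0)"

lemma cfF_convergent:
  assumes "pos_stream s"
  shows "convergent (\<lambda>n. cfF (stake n s) 0)"
proof (rule Cauchy_convergent, rule metric_CauchyI)
  fix e :: real assume "0 < e"
  then obtain m where m: "(1/4) ^ m < e / 2" using real_arch_pow_inv[of "e/2" "1/4"] by auto
  have close: "\<bar>cfF (stake (2 * m) s) 0 - cfF (stake n s) 0\<bar> \<le> (1/4) ^ m" if "n \<ge> 2 * m" for n
  proof -
    have "stake n s = stake (2 * m) s @ stake (n - 2 * m) (sdrop (2 * m) s)" using that by simp
    then have "cfF (stake n s) 0 = cfF (stake (2 * m) s) (cfF (stake (n - 2 * m) (sdrop (2 * m) s)) 0)"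
      by (metis cfF_simps(3))
    then show ?thesis using cfF_bounds[OF pos_stake[OF pos_sdrop[OF assms]], of 0]
      by (simp add: cfF_contract[OF pos_stake[OF assms]])
  qed
  have "dist (cfF (stake k s) 0) (cfF (stake n s) 0) < e" if "k \<ge> 2 * m" "n \<ge> 2 * m" for k n
    using close[OF that(1)] close[OF that(2)] m by (simp add: dist_real_def)
  then show "\<exists>M. \<forall>k\<ge>M. \<forall>n\<ge>M. dist (cfF (stake k s) 0) (cfF (stake n s) 0) < e" by blast
qed

lemma cfv_lim: "pos_stream s \<Longrightarrow> (\<lambda>n. cfF (stake n s) 0) \<longlonglongrightarrow> cfv s"
  unfolding cfv_def using cfF_convergent convergent_LIMSEQ_iff by blast

lemma cfv_bounds_weak: "pos_stream s \<Longrightarrow> 0 \<le> cfv s \<and> cfv s \<le> 1"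
proof -
  assume s: "pos_stream s"
  have "0 \<le> cfF (stake n s) 0" "cfF (stake n s) 0 \<le> 1" for n
    using cfF_bounds[OF pos_stake[OF s], of 0 n] by auto
  then show ?thesis using LIMSEQ_le_const[OF cfv_lim[OF s], of 0] LIMSEQ_le_const2[OF cfv_lim[OF s], of 1] by blast
qed

lemma cfv_Stream:
  assumes "1 \<le> y" "pos_stream s"
  shows "cfv (y ## s) = 1 / (of_int y + cfv s)"
proof -
  have "(\<lambda>n. cfF (stake (Suc n) (y ## s)) 0) \<longlonglongrightarrow> cfv (y ## s)"
    by (rule LIMSEQ_Suc[OF cfv_lim]) (use assms in simp)
  moreover have "(\<lambda>n. 1 / (of_int y + cfF (stake n s) 0)) \<longlonglongrightarrow> 1 / (of_int y + cfv s)"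
    using cfv_lim[OF assms(2)] cfv_bounds_weak[OF assms(2)] assms(1) by (intro tendsto_intros) auto
  ultimately show ?thesis using LIMSEQ_unique by auto
qed

lemma cfv_bounds:
  assumes "pos_stream s"
  shows "0 < cfv s" "cfv s < 1"
proof -
  have gen: "0 < cfv (y ## t)" if "pos_stream (y ## t)" for y t
    using cfv_Stream[of y t] cfv_bounds_weak[of t] that by (simp add: add_pos_nonneg)
  then have 1: "0 < cfv t" if "pos_stream t" for t using that by (cases t) auto
  show "0 < cfv s" using 1 assms .
  obtain y t where s: "s = y ## t" by (cases s)
  then have y: "1 \<le> y" "pos_stream t" using assms by auto
  then have "1 < of_int y + cfv t" using 1[of t] by (simp add: add_strict_increasing2)
  then show "cfv s < 1" using s y by (simp add: cfv_Stream)
qed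

lemma cfv_shift: "pos_list w \<Longrightarrow> pos_stream s \<Longrightarrow> cfv (w @- s) = cfF w (cfv s)"
  by (induction w) (auto simp: cfv_Stream)

lemma cf_stream_Stream:
  assumes "pos_stream s"
  shows "cf_stream (y ## s) = of_int y + cfv s"
proof -
  have "(\<lambda>n. of_int y + cfF (stake n s) 0) \<longlonglongrightarrow> of_int y + cfv s"
    by (intro tendsto_intros cfv_lim assms)
  then show ?thesis unfolding cf_stream_def by (simp add: cf_list_Cons limI)
qed

lemma cfF_Rats: "t \<in> \<rat> \<Longrightarrow> cfF w t \<in> \<rat>"
  by (induction w) auto

text \<open>Infinite descent as in Euclid's algorithm: removing the first digit from a value
  \<open>p / q\<close> in the unit interval leaves a fraction with denominator
  \<open>p < q\<close>.\<close>

lemma cfv_not_fraction: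
  "pos_stream s \<Longrightarrow> q > 0 \<Longrightarrow> cfv s \<noteq> of_int p / of_int q" for p q :: int
proof (induction "nat q" arbitrary: q p s rule: less_induct)
  case less
  show ?case
  proof
    assume sq: "cfv s = of_int p / of_int q"
    obtain y t where s: "s = y ## t" by (cases s)
    have t: "1 \<le> y" "pos_stream t" using less.prems s by auto
    have "0 < cfv s" "cfv s < 1" using cfv_bounds less.prems by auto
    then have p: "0 < p" "p < q" using less.prems sq by (auto simp: zero_less_divide_iff)
    have "of_int y + cfv t = 1 / cfv s" using cfv_Stream[OF t] s by simp
    also have "\<dots> = of_int q / of_int p" using sq by simp
    finally have "cfv t = of_int (q - y * p) / of_int p" using p by (simp add: field_simps)
    moreover have "nat p < nat q" using p by simp
    ultimately show False using less.hyps[of p t "q - y * p"] p t by blast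
  qed
qed

lemma cfv_irrational: "pos_stream s \<Longrightarrow> cfv s \<notin> \<rat>"
  using cfv_not_fraction by (metis Rats_cases')

subsection \<open>Convergents\<close>

text \<open>The indices are shifted: \<open>cfP s (Suc n) / cfQ s (Suc n)\<close> is the \<open>n\<close>-th convergent.\<close>

fun cfP :: "int stream \<Rightarrow> nat \<Rightarrow> int" where
  "cfP s 0 = 1"
| "cfP s (Suc 0) = s !! 0"
| "cfP s (Suc (Suc n)) = s !! Suc n * cfP s (Suc n) + cfP s n"

fun cfQ :: "int stream \<Rightarrow> nat \<Rightarrow> int" where
  "cfQ s 0 = 0"
| "cfQ s (Suc 0) = 1"
| "cfQ s (Suc (Suc n)) = s !! Suc n * cfQ s (Suc n) + cfQ s n"

locale cf_expansion =
  fixes x :: real and xs :: "int stream"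
  assumes irr: "x \<notin> \<rat>" and cf: "has_cf x xs"
begin

lemma pos_stl: "pos_stream (stl xs)"
proof -
  have "1 \<le> stl xs !! n" for n using cf unfolding has_cf_def by (auto dest: spec[of _ "Suc n"])
  then show ?thesis by (simp add: pos_stream_def)
qed

lemma pos_tail: "pos_stream (sdrop (Suc n) xs)"
  using pos_sdrop[OF pos_stl] by simp

lemma digit_pos: "n \<ge> 1 \<Longrightarrow> xs !! n \<ge> 1" using cf by (simp add: has_cf_def)

lemma x_eq: "x = of_int (xs !! 0) + cfv (stl xs)"
proof -
  have "(\<lambda>n. cf_list (stake (Suc n) xs)) \<longlonglongrightarrow> x" using cf by (simp add: has_cf_def)
  moreover have "(\<lambda>n. of_int (xs !! 0) + cfF (stake n (stl xs)) 0) \<longlonglongrightarrow> of_int (xs !! 0) + cfv (stl xs)"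
    by (intro tendsto_intros cfv_lim pos_stl)
  ultimately show ?thesis using LIMSEQ_unique by (auto simp: cf_list_Cons)
qed

lemma cfQ_pos: "1 \<le> cfQ xs (Suc n)"
proof -
  have "0 \<le> cfQ xs n \<and> 1 \<le> cfQ xs (Suc n)"
  proof (induction n)
    case (Suc n)
    then have "1 \<le> xs !! Suc n * cfQ xs (Suc n)" using digit_pos[of "Suc n"] mult_mono[of 1 "xs !! Suc n" 1 "cfQ xs (Suc n)"] by simp
    then show ?case using Suc by simp
  qed simp
  then show ?thesis ..
qed

lemma cfQ_nonneg: "0 \<le> cfQ xs n" using cfQ_pos by (cases n) (auto intro: order_trans[of 0 1])

lemma cfQ_step: "cfQ xs (Suc n) + cfQ xs n \<le> cfQ xs (Suc (Suc n))"
proof -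
  have "1 * cfQ xs (Suc n) \<le> xs !! Suc n * cfQ xs (Suc n)"
    using digit_pos[of "Suc n"] cfQ_nonneg[of "Suc n"] by (intro mult_right_mono) auto
  then show ?thesis by simp
qed

lemma cfQ_ge: "int n \<le> cfQ xs (Suc (Suc n))"
proof (induction n)
  case (Suc n)
  then show ?case using cfQ_step[of "Suc n"] cfQ_pos[of n] by simp
qed (simp only: of_nat_0 cfQ_nonneg)

lemma cf_det: "cfP xs (Suc n) * cfQ xs n - cfP xs n * cfQ xs (Suc n) = (-1) ^ Suc n"
proof (induction n)
  case (Suc n)
  then show ?case by (simp add: algebra_simps)
qed simp

text \<open>The complete quotient \<open>[x_n; x_{n+1}, ...]\<close>.\<close>

definition cquot :: "nat \<Rightarrow> real" where "cquot n = of_int (xs !! n) + cfv (sdrop (Suc n) xs)"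

lemma cquot_pos: "1 < cquot (Suc n)"
  using digit_pos[of "Suc n"] cfv_bounds(1)[OF pos_tail, of "Suc n"] unfolding cquot_def by (simp del: snth.simps sdrop.simps)

lemma cquot_rec: "cquot n = of_int (xs !! n) + 1 / cquot (Suc n)"
proof -
  have "sdrop (Suc n) xs = xs !! Suc n ## sdrop (Suc (Suc n)) xs"
    by (metis sdrop_simps stream.collapse)
  then have "cfv (sdrop (Suc n) xs) = 1 / cquot (Suc n)"
    unfolding cquot_def using cfv_Stream[of "xs !! Suc n"] digit_pos[of "Suc n"] pos_tail[of "Suc n"] by simp
  then show ?thesis by (simp add: cquot_def)
qed

lemma x_convergent: "x * (cfQ xs (Suc n) * cquot (Suc n) + cfQ xs n) = cfP xs (Suc n) * cquot (Suc n) + cfP xs n"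
proof (induction n)
  case 0
  have "x = cquot 0" using x_eq by (simp add: cquot_def)
  then show ?case using cquot_rec[of 0] cquot_pos[of 0] by (simp add: field_simps)
next
  case (Suc n)
  define z where "z = cquot (Suc (Suc n))"
  have z: "z > 1" "cquot (Suc n) = of_int (xs !! Suc n) + 1 / z" using cquot_pos[of "Suc n"] cquot_rec[of "Suc n"] by (auto simp: z_def)
  have r: "of_int (A * xs !! Suc n + B) * z + of_int A = (of_int A * cquot (Suc n) + of_int B) * z" for A B :: int
    unfolding z(2) using z(1) by (simp add: field_simps del: snth.simps)
  have "x * (cfQ xs (Suc (Suc n)) * z + cfQ xs (Suc n)) = x * (cfQ xs (Suc n) * cquot (Suc n) + cfQ xs n) * z"
    using r[of "cfQ xs (Suc n)" "cfQ xs n"] by (simp add: mult.commute del: snth.simps)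
  also have "\<dots> = (cfP xs (Suc n) * cquot (Suc n) + cfP xs n) * z" by (simp only: Suc)
  also have "\<dots> = cfP xs (Suc (Suc n)) * z + cfP xs (Suc n)"
    using r[of "cfP xs (Suc n)" "cfP xs n"] by (simp add: mult.commute del: snth.simps)
  finally show ?case unfolding z_def .
qed

definition approx_err :: "nat \<Rightarrow> real" where "approx_err n = cfQ xs (Suc n) * x - cfP xs (Suc n)"

lemma approx_err_eq: "approx_err n = (-1) ^ n / (cfQ xs (Suc n) * cquot (Suc n) + cfQ xs n)"
proof -
  let ?D = "cfQ xs (Suc n) * cquot (Suc n) + cfQ xs n"
  have D: "?D > 0" using cfQ_pos[of n] cfQ_nonneg[of n] cquot_pos[of n]
    by (intro add_pos_nonneg mult_pos_pos) auto
  have "approx_err n * ?D = cfQ xs (Suc n) * (x * ?D) - cfP xs (Suc n) * ?D"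
    by (simp add: approx_err_def algebra_simps)
  also have "\<dots> = cfQ xs (Suc n) * (cfP xs (Suc n) * cquot (Suc n) + cfP xs n) - cfP xs (Suc n) * ?D"
    by (simp only: x_convergent)
  also have "\<dots> = - of_int (cfP xs (Suc n) * cfQ xs n - cfP xs n * cfQ xs (Suc n))"
    by (simp add: algebra_simps)
  also have "\<dots> = (-1) ^ n" by (simp only: cf_det) simp
  finally show ?thesis using D by (simp add: field_simps)
qed

text \<open>The recursion of the denominators, divided by the larger one, is a continued fraction
  with the digits in reverse order. This is how the past enters the approximation error.\<close>

lemma cfQ_ratio: "cfF (rev (stake n (stl xs))) 0 = cfQ xs n / cfQ xs (Suc n)"
proof (induction n)
  case (Suc n)
  have q: "real_of_int (cfQ xs (Suc n)) > 0" using cfQ_pos[of n] by simp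
  have "rev (stake (Suc n) (stl xs)) = xs !! Suc n # rev (stake n (stl xs))"
    by (simp add: stake_Suc del: stake.simps)
  then have "cfF (rev (stake (Suc n) (stl xs))) 0 = 1 / (xs !! Suc n + cfQ xs n / cfQ xs (Suc n))"
    using Suc by (simp del: snth.simps stake.simps)
  also have "\<dots> = cfQ xs (Suc n) / (cfQ xs (Suc (Suc n)))"
    using q by (simp add: field_simps del: snth.simps)
  finally show ?case .
qed simp

lemma cf_past_eq: "cf_past xs n = cfF (rev (stake n (stl xs))) 0"
  by (simp add: cf_past_def cf_list_Cons)

lemma lambda_eq: "cf_lambda xs (Suc n) = of_int (xs !! Suc n) + cfv (sdrop (Suc (Suc n)) xs) + cf_past xs n"
proof -
  have "sdrop (Suc n) xs = xs !! Suc n ## sdrop (Suc (Suc n)) xs"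
    by (metis sdrop_simps stream.collapse)
  then show ?thesis unfolding cf_lambda_def using cf_stream_Stream[OF pos_tail[of "Suc n"], of "xs !! Suc n"] by simp
qed

text \<open>Take the denominator of the convergent out of the classical error term: the quotient of
  consecutive denominators is the past, and what remains is \<lambda>.\<close>

lemma abs_approx_err: "\<bar>approx_err n\<bar> = 1 / (cfQ xs (Suc n) * cf_lambda xs (Suc n))"
proof -
  have q: "real_of_int (cfQ xs (Suc n)) > 0" using cfQ_pos[of n] by simp
  have "cfQ xs (Suc n) * cquot (Suc n) + cfQ xs n = cfQ xs (Suc n) * cf_lambda xs (Suc n)"
    using q by (simp add: lambda_eq cquot_def cf_past_eq cfQ_ratio field_simps del: snth.simps sdrop.simps)
  moreover have "cfQ xs (Suc n) * cquot (Suc n) + cfQ xs n > 0" using q cfQ_nonneg[of n] cquot_pos[of n]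
    by (intro add_pos_nonneg mult_pos_pos) auto
  ultimately show ?thesis by (simp add: approx_err_eq abs_divide power_abs)
qed

lemma lambda_pos: "0 < cf_lambda xs (Suc n)"
proof -
  have "0 \<le> cf_past xs n" using cfF_bounds[of "rev (stake n (stl xs))" 0] pos_stake[OF pos_stl] by (simp add: cf_past_eq)
  then show ?thesis using digit_pos[of "Suc n"] cfv_bounds(1)[OF pos_tail, of "Suc n"]
    unfolding lambda_eq by (simp del: snth.simps sdrop.simps)
qed

lemma convergent_solution_iff:
  "\<bar>x - cfP xs (Suc n) / cfQ xs (Suc n)\<bar> < 1 / (3 * (real_of_int (cfQ xs (Suc n)))\<^sup>2) \<longleftrightarrow> 3 < cf_lambda xs (Suc n)"
proof -
  define q where "q = real_of_int (cfQ xs (Suc n))"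
  have q: "q > 0" using cfQ_pos[of n] by (simp add: q_def)
  have "x - cfP xs (Suc n) / cfQ xs (Suc n) = approx_err n / q" using q by (simp add: approx_err_def q_def field_simps)
  then have e: "\<bar>x - cfP xs (Suc n) / cfQ xs (Suc n)\<bar> = 1 / (q\<^sup>2 * cf_lambda xs (Suc n))"
    using q abs_approx_err[of n] by (simp add: abs_divide q_def power2_eq_square)
  show ?thesis using q lambda_pos[of n] unfolding e unfolding q_def[symmetric] by (simp add: divide_simps)
qed

text \<open>Lagrange's argument: \<open>(p, q)\<close> is an integer combination of two consecutive
  convergents, with coefficients \<open>u\<close> and \<open>w\<close> that do not have the same
  sign. The errors of the convergents alternate in sign, so the two contributions cannot
  cancel.\<close>

lemma best_approximation:
  fixes p q :: int
  assumes q: "1 \<le> q" "q < cfQ xs (Suc (Suc n))"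
  shows "\<bar>approx_err n\<bar> \<le> \<bar>q * x - p\<bar>"
proof -
  define P0 P1 Q0 Q1 where "P0 = cfP xs (Suc n)" and "P1 = cfP xs (Suc (Suc n))"
    and "Q0 = cfQ xs (Suc n)" and "Q1 = cfQ xs (Suc (Suc n))"
  define s :: int where "s = (-1) ^ Suc (Suc n)"
  have ss: "s * s = 1" by (simp add: s_def flip: power_mult_distrib)
  have det: "P1 * Q0 - P0 * Q1 = s" using cf_det[of "Suc n"] by (simp add: P0_def P1_def Q0_def Q1_def s_def)
  \<comment> \<open>Cramer's rule; the determinant \<open>s\<close> is its own inverse.\<close>
  define u w where "u = s * (P1 * q - Q1 * p)" and "w = s * (Q0 * p - P0 * q)"
  have "u * Q0 + w * Q1 = s * q * (P1 * Q0 - P0 * Q1)" by (simp add: u_def w_def algebra_simps)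
  then have qe: "q = u * Q0 + w * Q1" using det ss by (simp add: algebra_simps)
  have "u * P0 + w * P1 = s * p * (P1 * Q0 - P0 * Q1)" by (simp add: u_def w_def algebra_simps)
  then have pe: "p = u * P0 + w * P1" using det ss by (simp add: algebra_simps)
  have Q: "1 \<le> Q0" "1 \<le> Q1" unfolding Q0_def Q1_def by (rule cfQ_pos)+
  have e: "q * x - p = u * approx_err n + w * approx_err (Suc n)"
    unfolding qe pe approx_err_def P0_def P1_def Q0_def Q1_def by (simp add: algebra_simps)
  have u0: "u \<noteq> 0"
  proof
    assume "u = 0"
    then have "q = w * Q1" using qe by simp
    then have "w \<ge> 1" using q Q by (metis int_one_le_iff_zero_less not_le mult_le_0_iff order_trans zero_le_one)
    then have "Q1 \<le> q" using \<open>q = w * Q1\<close> Q by simp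
    then show False using q by (simp add: Q1_def)
  qed
  have opp: "(u \<ge> 0 \<and> w \<le> 0) \<or> (u \<le> 0 \<and> w \<ge> 0)"
  proof (rule ccontr)
    assume "\<not> ?thesis"
    then consider "u \<ge> 1" "w \<ge> 1" | "u \<le> -1" "w \<le> -1" by linarith
    then show False
    proof cases
      case 1
      then have "0 \<le> u * Q0" "Q1 \<le> w * Q1" using Q by auto
      then show False using qe q by (simp add: Q1_def)
    next
      case 2
      then have "u * Q0 \<le> 0" "w * Q1 \<le> 0" using Q by (auto simp: mult_le_0_iff)
      then show False using qe q by simp
    qed
  qed
  have sg: "approx_err n * approx_err (Suc n) \<le> 0"
  proof -
    have D: "0 < cfQ xs (Suc n) * cquot (Suc n) + cfQ xs n" for n
      using cfQ_pos[of n] cfQ_nonneg[of n] cquot_pos[of n] by (intro add_pos_nonneg mult_pos_pos) auto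
    have "approx_err n * approx_err (Suc n) = - ((-1) ^ n * (-1) ^ n) / ((cfQ xs (Suc n) * cquot (Suc n) + cfQ xs n) *
        (cfQ xs (Suc (Suc n)) * cquot (Suc (Suc n)) + cfQ xs (Suc n)))"
      unfolding approx_err_eq by simp
    also have "\<dots> \<le> 0" using D[of n] D[of "Suc n"]
      by (intro divide_nonpos_pos mult_pos_pos) (simp_all flip: power_mult_distrib)
    finally show ?thesis .
  qed
  have prod: "0 \<le> (u * approx_err n) * (w * approx_err (Suc n))"
  proof -
    have "real_of_int u * of_int w \<le> 0" using opp by (auto simp: mult_le_0_iff)
    then have "0 \<le> (real_of_int u * of_int w) * (approx_err n * approx_err (Suc n))" using sg by (simp add: mult_nonpos_nonpos)
    then show ?thesis by (simp add: algebra_simps)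
  qed
  have "\<bar>a\<bar> \<le> \<bar>a + b\<bar>" if "0 \<le> a * b" for a b :: real
    using that by (auto simp: zero_le_mult_iff)
  from this[OF prod] have "\<bar>u * approx_err n\<bar> \<le> \<bar>u * approx_err n + w * approx_err (Suc n)\<bar>" .
  moreover have "1 \<le> \<bar>real_of_int u\<bar>" using u0 by linarith
  then have "\<bar>approx_err n\<bar> \<le> \<bar>u * approx_err n\<bar>" by (simp add: abs_mult mult_le_cancel_right1)
  ultimately show ?thesis using e by simp
qed

text \<open>Let \<open>P / Q\<close> be the last convergent with \<open>Q \<le> q\<close>. If it
  differs from \<open>p / q\<close>, then \<open>|p Q - P q|\<close> is at least 1, but best
  approximation bounds it by \<open>2 q |q x - p| < 2 / 3\<close>.\<close>

lemma solution_is_convergent: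
  fixes p q :: int
  assumes q: "q > 0" and sol: "\<bar>x - p / q\<bar> < 1 / (3 * (real_of_int q)\<^sup>2)"
  shows "\<exists>n. 3 < cf_lambda xs (Suc n) \<and> real_of_int p / q = cfP xs (Suc n) / cfQ xs (Suc n)"
proof -
  have ex: "\<exists>n. q < cfQ xs (Suc (Suc n))"
    using cfQ_ge[of "nat (q + 1)"] q by (intro exI[of _ "nat (q + 1)"]) simp
  define n where "n = (LEAST n. q < cfQ xs (Suc (Suc n)))"
  have n: "q < cfQ xs (Suc (Suc n))" unfolding n_def by (rule LeastI_ex[OF ex])
  have n': "cfQ xs (Suc n) \<le> q"
  proof (cases n)
    case 0 then show ?thesis using q by simp
  next
    case (Suc m)
    then have "\<not> q < cfQ xs (Suc (Suc m))" using not_less_Least[of m "\<lambda>n. q < cfQ xs (Suc (Suc n))"] n_def by simp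
    then show ?thesis using Suc by simp
  qed
  define P Q where "P = cfP xs (Suc n)" and "Q = cfQ xs (Suc n)"
  have Q: "0 < Q" "Q \<le> q" using n' cfQ_pos[of n] by (auto simp: Q_def)
  have best: "\<bar>Q * x - P\<bar> \<le> \<bar>q * x - p\<bar>"
    using best_approximation[of q n p] q n by (simp add: approx_err_def P_def Q_def)
  have qx: "\<bar>q * x - p\<bar> < 1 / (3 * real_of_int q)"
  proof -
    have "\<bar>q * x - p\<bar> = q * \<bar>x - p / q\<bar>" using q by (simp add: abs_mult[symmetric] field_simps flip: abs_of_pos)
    also have "\<dots> < q * (1 / (3 * (real_of_int q)\<^sup>2))" using sol q by (intro mult_strict_left_mono) auto
    also have "\<dots> = 1 / (3 * real_of_int q)" using q by (simp add: power2_eq_square)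
    finally show ?thesis .
  qed
  have eq: "p * Q = P * q"
  proof (rule ccontr)
    assume "p * Q \<noteq> P * q"
    then have "1 \<le> \<bar>p * Q - P * q\<bar>" by linarith
    then have "1 \<le> real_of_int \<bar>p * Q - P * q\<bar>" by linarith
    also have "real_of_int \<bar>p * Q - P * q\<bar> = \<bar>q * (Q * x - P) - Q * (q * x - p)\<bar>" by (simp add: algebra_simps)
    also have "\<dots> \<le> \<bar>q * (Q * x - P)\<bar> + \<bar>Q * (q * x - p)\<bar>" by (rule abs_triangle_ineq4)
    also have "\<dots> = q * \<bar>Q * x - P\<bar> + Q * \<bar>q * x - p\<bar>" using q Q by (simp add: abs_mult)
    also have "\<dots> \<le> q * \<bar>q * x - p\<bar> + q * \<bar>q * x - p\<bar>"
      using best q Q by (intro add_mono mult_mono) auto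
    also have "\<dots> < q * (1 / (3 * real_of_int q)) + q * (1 / (3 * real_of_int q))"
      using qx q by (intro add_strict_mono mult_strict_left_mono) auto
    also have "\<dots> = 2 / 3" using q by (simp add: field_simps)
    finally show False by simp
  qed
  have "real_of_int p * Q = P * q" using eq by (metis of_int_mult)
  then have pq: "real_of_int p / q = P / Q" using q Q by (simp add: frac_eq_eq)
  \<comment> \<open>\<open>P / Q\<close> may be \<open>p / q\<close> in lowest terms; its smaller
    denominator only weakens the bound to be met.\<close>
  have "1 / (3 * (real_of_int q)\<^sup>2) \<le> 1 / (3 * (real_of_int Q)\<^sup>2)"
    using Q q by (intro divide_left_mono mult_left_mono power_mono) auto
  then have "\<bar>x - P / Q\<bar> < 1 / (3 * (real_of_int Q)\<^sup>2)" using sol pq by simp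
  then have "3 < cf_lambda xs (Suc n)" using convergent_solution_iff[of n] by (simp add: P_def Q_def)
  then show ?thesis using pq unfolding P_def Q_def by blast
qed

lemma approx_solutions_eq:
  "approx_solutions x = (\<lambda>n. Fract (cfP xs (Suc n)) (cfQ xs (Suc n))) ` {n. 3 < cf_lambda xs (Suc n)}"
proof (intro set_eqI iffI)
  fix r assume "r \<in> approx_solutions x"
  then obtain p q :: int where r: "q > 0" "r = Fract p q" "\<bar>x - p / q\<bar> < 1 / (3 * (real_of_int q)\<^sup>2)"
    unfolding approx_solutions_def by blast
  obtain n where n: "3 < cf_lambda xs (Suc n)" "real_of_int p / q = cfP xs (Suc n) / cfQ xs (Suc n)"
    using solution_is_convergent[OF r(1,3)] by blast
  have "real_of_int p * cfQ xs (Suc n) = cfP xs (Suc n) * q" using n(2) r(1) cfQ_pos[of n] by (simp add: frac_eq_eq)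
  then have "p * cfQ xs (Suc n) = cfP xs (Suc n) * q" by (metis of_int_eq_iff of_int_mult)
  then have "r = Fract (cfP xs (Suc n)) (cfQ xs (Suc n))" using r(1,2) cfQ_pos[of n] by (simp add: eq_rat)
  then show "r \<in> (\<lambda>n. Fract (cfP xs (Suc n)) (cfQ xs (Suc n))) ` {n. 3 < cf_lambda xs (Suc n)}" using n by blast
next
  fix r assume "r \<in> (\<lambda>n. Fract (cfP xs (Suc n)) (cfQ xs (Suc n))) ` {n. 3 < cf_lambda xs (Suc n)}"
  then obtain n where n: "3 < cf_lambda xs (Suc n)" "r = Fract (cfP xs (Suc n)) (cfQ xs (Suc n))" by blast
  have "0 < cfQ xs (Suc n)" using cfQ_pos[of n] by simp
  then show "r \<in> approx_solutions x" unfolding approx_solutions_def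
    using n convergent_solution_iff[of n] by blast
qed

lemma convergents_inj: "inj_on (\<lambda>n. Fract (cfP xs (Suc n)) (cfQ xs (Suc n))) A"
proof (rule inj_onI)
  define D where "D n = cfQ xs (Suc n) * cquot (Suc n) + cfQ xs n" for n
  have D: "0 < D n" for n
    using cfQ_pos[of n] cfQ_nonneg[of n] cquot_pos[of n] unfolding D_def by (intro add_pos_nonneg mult_pos_pos) auto
  have DS: "D (Suc n) = cquot (Suc (Suc n)) * D n" for n
    unfolding D_def cquot_rec[of "Suc n"] using cquot_pos[of "Suc n"] by (simp add: field_simps del: snth.simps)
  \<comment> \<open>The denominators alone need not increase strictly: the first two agree if
    \<open>x_1 = 1\<close>. The distances to \<open>x\<close> do decrease strictly.\<close>
  have "strict_mono (\<lambda>n. cfQ xs (Suc n) * D n)"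
  proof (rule strict_mono_Suc_iff[THEN iffD2], rule allI)
    fix n
    have "D n < D (Suc n)" using DS[of n] D[of n] cquot_pos[of "Suc n"] by simp
    moreover have "cfQ xs (Suc n) \<le> cfQ xs (Suc (Suc n))" using cfQ_step[of n] cfQ_nonneg[of n] by linarith
    then have "real_of_int (cfQ xs (Suc n)) \<le> real_of_int (cfQ xs (Suc (Suc n)))" by (simp only: of_int_le_iff)
    moreover have "0 < real_of_int (cfQ xs (Suc n))" using cfQ_pos[of n] by simp
    ultimately show "cfQ xs (Suc n) * D n < cfQ xs (Suc (Suc n)) * D (Suc n)"
      using D[of n] by (intro mult_le_less_imp_less) auto
  qed
  then have inj: "inj (\<lambda>n. cfQ xs (Suc n) * D n)" by (rule strict_mono_imp_inj_on)
  have dist: "\<bar>x - cfP xs (Suc n) / cfQ xs (Suc n)\<bar> = 1 / (cfQ xs (Suc n) * D n)" for n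
  proof -
    have q: "0 < real_of_int (cfQ xs (Suc n))" using cfQ_pos[of n] by simp
    then have "x - cfP xs (Suc n) / cfQ xs (Suc n) = approx_err n / cfQ xs (Suc n)" by (simp add: approx_err_def field_simps)
    then show ?thesis using q D[of n] unfolding approx_err_eq D_def[symmetric] by (simp add: abs_divide power_abs)
  qed
  fix m n assume "Fract (cfP xs (Suc m)) (cfQ xs (Suc m)) = Fract (cfP xs (Suc n)) (cfQ xs (Suc n))"
  then have "cfP xs (Suc m) * cfQ xs (Suc n) = cfP xs (Suc n) * cfQ xs (Suc m)"
    using cfQ_pos[of m] cfQ_pos[of n] by (simp add: eq_rat)
  then have "real_of_int (cfP xs (Suc m)) * cfQ xs (Suc n) = cfP xs (Suc n) * cfQ xs (Suc m)"
    by (metis of_int_mult)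
  then have "real_of_int (cfP xs (Suc m)) / cfQ xs (Suc m) = cfP xs (Suc n) / cfQ xs (Suc n)"
    using cfQ_pos[of m] cfQ_pos[of n] by (simp add: frac_eq_eq)
  then have "1 / (cfQ xs (Suc m) * D m) = 1 / (cfQ xs (Suc n) * D n)" using dist[of m] dist[of n] by simp
  then have "cfQ xs (Suc m) * D m = cfQ xs (Suc n) * D n" by (metis div_by_1 divide_divide_eq_right mult_1)
  then show "m = n" using inj by (simp add: inj_def)
qed

lemma finite_solutions_iff: "finite (approx_solutions x) \<longleftrightarrow> finite {n. 3 < cf_lambda xs (Suc n)}"
  unfolding approx_solutions_eq by (rule finite_image_iff[OF convergents_inj])

lemma card_solutions_le:
  assumes "\<And>n. N \<le> n \<Longrightarrow> cf_lambda xs (Suc n) \<le> 3"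
  shows "finite (approx_solutions x) \<and> card (approx_solutions x) \<le> N"
proof -
  have sub: "{n. 3 < cf_lambda xs (Suc n)} \<subseteq> {..<N}" using assms by (auto simp flip: not_le)
  then have fin: "finite {n. 3 < cf_lambda xs (Suc n)}" by (rule finite_subset) simp
  have "card (approx_solutions x) \<le> card {n. 3 < cf_lambda xs (Suc n)}"
    unfolding approx_solutions_eq by (rule card_image_le[OF fin])
  also have "\<dots> \<le> card {..<N}" by (rule card_mono[OF _ sub]) simp
  finally show ?thesis using finite_solutions_iff fin by simp
qed

end


subsection \<open>Values of block words\<close>

lemma digits_simps [simp]: "digits [] = []" "digits (c # w) = block c @ digits w"
  "digits (v @ w) = digits v @ digits w"
  by (simp_all add: digits_def)

lemma block_nonempty [simp]: "block c \<noteq> []" by (cases c) auto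
lemma rev_block [simp]: "rev (block c) = block c" by (cases c) auto
lemma length_block [simp]: "length (block c) = 2" by (cases c) auto
lemma pos_block [simp]: "pos_list (block c)" by (cases c) auto

lemma sdigits_simps [simp]: "sdigits (c ## S) = block c @- sdigits S"
  "sdigits (w @- S) = digits w @- sdigits S"
  by (simp_all add: sdigits_def digits_def flat_smap_shift del: smap_shift)

lemma rev_digits: "rev (digits w) = digits (rev w)"
  by (induction w) auto
lemma length_digits: "length (digits w) = 2 * length w"
  by (induction w) auto
lemma pos_digits [simp]: "pos_list (digits w)"
  by (induction w) auto

lemma snth_sdigits: "sdigits S !! (2 * i) = (if S !! i = La then 2 else 1)"
  "sdigits S !! Suc (2 * i) = (if S !! i = La then 2 else 1)"
proof -
  have "sdigits S !! (2 * i) = (if S !! i = La then 2 else 1) \<and>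
      sdigits S !! Suc (2 * i) = (if S !! i = La then 2 else 1)"
  proof (induction i arbitrary: S)
    case 0
    obtain c S' where "S = c ## S'" by (cases S)
    then show ?case by (cases c) auto
  next
    case (Suc i)
    obtain c S' where "S = c ## S'" by (cases S)
    then show ?case using Suc[of S'] by (cases c) auto
  qed
  then show "sdigits S !! (2 * i) = (if S !! i = La then 2 else 1)"
    "sdigits S !! Suc (2 * i) = (if S !! i = La then 2 else 1)" by blast+
qed

lemma pos_sdigits [simp]: "pos_stream (sdigits S)"
  unfolding pos_stream_def
proof
  fix n
  show "1 \<le> sdigits S !! n"
    using snth_sdigits[of S "n div 2"] by (cases "even n") (auto simp: odd_two_times_div_two_succ[symmetric] elim!: evenE oddE split: if_splits)
qed

lemma sdigits_inject: "sdigits S = sdigits S' \<longleftrightarrow> S = S'"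
proof
  assume eq: "sdigits S = sdigits S'"
  show "S = S'"
  proof (rule snth_ext)
    fix n
    show "S !! n = S' !! n" using snth_sdigits(1)[of S n] snth_sdigits(1)[of S' n] eq
      by (cases "S !! n"; cases "S' !! n") auto
  qed
qed simp

lemma cfv_block:
  "cfv (sdigits (La ## S)) = 1 / (2 + 1 / (2 + cfv (sdigits S)))"
  "cfv (sdigits (Lb ## S)) = 1 / (1 + 1 / (1 + cfv (sdigits S)))"
  by (simp_all add: cfv_Stream)

text \<open>The threshold 1/2 separates the two blocks, so the first different block decides a
  comparison.\<close>

lemma cfv_La: "cfv (sdigits (La ## S)) < 1 / 2"
  using cfv_bounds[of "sdigits S"] unfolding cfv_block by (simp add: divide_simps)
lemma cfv_Lb: "1 / 2 < cfv (sdigits (Lb ## S))"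
  using cfv_bounds[of "sdigits S"] unfolding cfv_block by (simp add: divide_simps)

lemma cfv_digits_mono: "cfv (sdigits (w @- X)) < cfv (sdigits (w @- Y)) \<longleftrightarrow> cfv (sdigits X) < cfv (sdigits Y)"
  using cfv_bounds[of "sdigits X"] cfv_bounds[of "sdigits Y"]
  by (simp add: cfv_shift cfF_mono_even length_digits)

lemma slt_imp_cfv_less: "slt X Y \<Longrightarrow> cfv (sdigits X) < cfv (sdigits Y)"
proof -
  assume "slt X Y"
  then obtain w X' Y' where w: "X = w @- La ## X'" "Y = w @- Lb ## Y'" unfolding slt_def by blast
  show ?thesis unfolding w cfv_digits_mono using cfv_La[of X'] cfv_Lb[of Y'] by linarith
qed

text \<open>At the first different block the values lie on the two sides of 1/2, whatever
  \<open>t\<close> is. The number of digits before it is even, so these preserve the order.\<close>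

lemma lex_gt_imp_cfv_less:
  assumes "lex_gt x R" "0 \<le> t" "t \<le> 1"
  shows "cfv (sdigits R) < cfF (digits x) t"
proof -
  obtain w x' R' where w: "x = w @ Lb # x'" "R = w @- La ## R'" using assms(1) by (auto simp: lex_gt_iff)
  define s where "s = cfF (digits x') t"
  have s: "0 \<le> s" "s \<le> 1" using cfF_bounds[OF pos_digits assms(2,3)] by (auto simp: s_def)
  define z where "z = 1 / (1 + 1 / (1 + s))"
  have b: "1 / 2 \<le> z" "z \<le> 1" using s by (auto simp: z_def divide_simps)
  have "cfF (digits x) t = cfF (digits w) z" by (simp add: w s_def z_def)
  moreover have "cfv (sdigits R) = cfF (digits w) (cfv (sdigits (La ## R')))"
    unfolding w sdigits_simps(2) by (rule cfv_shift) auto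
  ultimately show ?thesis using cfv_La[of R'] b cfv_bounds[of "sdigits (La ## R')"]
    by (simp add: cfF_mono_even length_digits del: sdigits_simps)
qed

lemma lex_lt_imp_cfv_greater:
  assumes "lex_lt x R" "0 \<le> t" "t \<le> 1"
  shows "cfF (digits x) t < cfv (sdigits R)"
proof -
  obtain w x' R' where w: "x = w @ La # x'" "R = w @- Lb ## R'" using assms(1) by (auto simp: lex_lt_iff)
  define s where "s = cfF (digits x') t"
  have s: "0 \<le> s" "s \<le> 1" using cfF_bounds[OF pos_digits assms(2,3)] by (auto simp: s_def)
  define z where "z = 1 / (2 + 1 / (2 + s))"
  have b: "z \<le> 1 / 2" "0 \<le> z" using s by (auto simp: z_def divide_simps)
  have "cfF (digits x) t = cfF (digits w) z" by (simp add: w s_def z_def)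
  moreover have "cfv (sdigits R) = cfF (digits w) (cfv (sdigits (Lb ## R')))"
    unfolding w sdigits_simps(2) by (rule cfv_shift) auto
  ultimately show ?thesis using cfv_Lb[of R'] b cfv_bounds[of "sdigits (Lb ## R')"]
    by (simp add: cfF_mono_even length_digits del: sdigits_simps)
qed

lemma prefix_cfv_le:
  assumes "0 \<le> t" "t \<le> 1"
  shows "cfF (digits x) t \<le> cfv (sdigits (x @- R)) \<longleftrightarrow> t \<le> cfv (sdigits R)"
    "cfv (sdigits (x @- R)) \<le> cfF (digits x) t \<longleftrightarrow> cfv (sdigits R) \<le> t"
  using cfv_bounds[of "sdigits R"] assms by (simp_all add: cfv_shift cfF_mono_even length_digits)

section \<open>Comparison with a rational number as a cut\<close>

lemma cfv_close:
  assumes "pos_stream s" "pos_stream t" "stake (2 * k) s = stake (2 * k) t"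
  shows "\<bar>cfv s - cfv t\<bar> \<le> (1/4) ^ k"
proof -
  have "cfv s = cfF (stake (2 * k) s) (cfv (sdrop (2 * k) s))"
    "cfv t = cfF (stake (2 * k) s) (cfv (sdrop (2 * k) t))"
    using assms by (metis cfv_shift pos_sdrop pos_stake stake_sdrop)+
  then show ?thesis
    using cfF_contract[OF pos_stake[OF assms(1)], of k "2 * k"] cfv_bounds[OF pos_sdrop[OF assms(1)], of "2 * k"]
      cfv_bounds[OF pos_sdrop[OF assms(2)], of "2 * k"] by simp
qed

lemma lex_cutI:
  assumes mono: "\<And>X Y. slt X Y \<Longrightarrow> f X < f Y" and ne: "\<And>X. f X \<noteq> (c::real)"
    and close: "\<And>k X Y. stake k X = stake k Y \<Longrightarrow> \<bar>f X - f Y\<bar> \<le> (1/4) ^ k"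
  shows "lex_cut (\<lambda>R. c < f R)"
  unfolding lex_cut_def
proof (intro conjI allI impI)
  show "c < f Y" if "slt X Y" "c < f X" for X Y using mono that by (meson less_trans)
  fix L
  have "0 < \<bar>f L - c\<bar>" using ne[of L] by simp
  then obtain k where "(1/4) ^ k < \<bar>f L - c\<bar>" using real_arch_pow_inv[of "\<bar>f L - c\<bar>" "1/4"] by auto
  then have "(c < f R) = (c < f L)" if "stake k R = stake k L" for R
    using close[OF that] by linarith
  then show "\<exists>k. \<forall>R. stake k R = stake k L \<longrightarrow> (c < f R) = (c < f L)" by blast
qed

lemma stake_sdigits: "stake (2 * k) (sdigits S) = digits (stake k S)"
proof (induction k arbitrary: S)
  case (Suc k)
  obtain c S' where "S = c ## S'" by (cases S)
  then show ?case using Suc[of S'] by (cases c) auto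
qed simp

lemma lex_cut_sdigits:
  assumes "c \<in> \<rat>"
  shows "lex_cut (\<lambda>R. c < cfv (sdigits R))"
proof (rule lex_cutI)
  show "\<bar>cfv (sdigits X) - cfv (sdigits Y)\<bar> \<le> (1/4) ^ k" if "stake k X = stake k Y" for k X Y
    by (rule cfv_close) (simp_all add: stake_sdigits that)
qed (use slt_imp_cfv_less cfv_irrational[OF pos_sdigits] assms in auto)

lemma slt_smap_swap: "slt X Y \<Longrightarrow> slt (smap swap Y) (smap swap X)"
  unfolding slt_def
proof (elim exE conjE)
  fix w X' Y' assume "X = w @- La ## X'" "Y = w @- Lb ## Y'"
  then show "\<exists>w X' Y'. smap swap Y = w @- La ## X' \<and> smap swap X = w @- Lb ## Y'"
    by (intro exI[of _ "map swap w"] exI[of _ "smap swap Y'"] exI[of _ "smap swap X'"]) simp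
qed

text \<open>The exchange of letters and the single digit 2 in front each reverse the order, so
  together they preserve it.\<close>

lemma lex_cut_sdigits_swap:
  assumes "c \<in> \<rat>"
  shows "lex_cut (\<lambda>R. c < cfv (2 ## sdigits (smap swap R)))"
proof (rule lex_cutI)
  show "cfv (2 ## sdigits (smap swap X)) < cfv (2 ## sdigits (smap swap Y))" if "slt X Y" for X Y
    using slt_imp_cfv_less[OF slt_smap_swap[OF that]] cfv_bounds(1)[of "sdigits (smap swap X)"]
      cfv_bounds(1)[of "sdigits (smap swap Y)"]
    by (simp add: cfv_Stream frac_less2)
  show "\<bar>cfv (2 ## sdigits (smap swap X)) - cfv (2 ## sdigits (smap swap Y))\<bar> \<le> (1/4) ^ k"
    if "stake k X = stake k Y" for k X Y
  proof (rule cfv_close)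
    have "stake (2 * k) (sdigits (smap swap X)) = stake (2 * k) (sdigits (smap swap Y))"
      by (simp add: stake_sdigits that)
    then have "stake (Suc (2 * k)) (2 ## sdigits (smap swap X)) = stake (Suc (2 * k)) (2 ## sdigits (smap swap Y))"
      by simp
    then show "stake (2 * k) (2 ## sdigits (smap swap X)) = stake (2 * k) (2 ## sdigits (smap swap Y))"
      by (metis le_SucI min.absorb1 order_refl take_stake)
  qed simp_all
  show "cfv (2 ## sdigits (smap swap X)) \<noteq> c" for X
    using cfv_irrational[of "2 ## sdigits (smap swap X)"] assms by auto
qed

lemma lex_gt_append_La: "lex_gt (y @ [La]) R \<Longrightarrow> lex_gt y R"
  by (induction y arbitrary: R) (auto split: if_splits)

lemma lex_gt_map_swap: "lex_gt (map swap x) (smap swap R) = lex_lt x R"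
proof (induction x arbitrary: R)
  case (Cons c x)
  obtain e R' where "R = e ## R'" by (cases R)
  then show ?case using Cons[of R'] by (cases c; cases e) auto
qed simp

lemma lex_lt_map_swap: "lex_lt (map swap x) (smap swap R) = lex_gt x R"
  using lex_gt_map_swap[of "map swap x" "smap swap R"] by (simp del: map_map)

text \<open>Unlike for \<open>lex_gt\<close>, the last \<open>a\<close> may be the first difference.
  In the application it is the first block of \<open>2 x_{N+1} ...\<close>, whose outer 2 is not a
  digit of \<open>x\<close>; so this case is kept apart.\<close>

lemma lex_lt_append_La: "lex_lt (y @ [La]) R \<Longrightarrow> lex_lt y R \<or> (\<exists>R'. R = y @- Lb ## R')"
proof (induction y arbitrary: R)
  case Nil
  obtain e R' where e: "R = e ## R'" by (cases R)
  then show ?case using Nil by (cases e) auto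
next
  case (Cons c y)
  obtain e R' where e: "R = e ## R'" by (cases R)
  show ?case
  proof (cases "c = e")
    case True
    then have "lex_lt y R' \<or> (\<exists>R''. R' = y @- Lb ## R'')" using Cons e by auto
    then show ?thesis using True e by auto
  next
    case False
    then show ?thesis using Cons.prems e by auto
  qed
qed

section \<open>\<lambda> at a junction\<close>

lemma junction_iff:
  fixes a b :: real
  assumes "0 \<le> a" "0 \<le> b"
  shows "2 + 1 / (2 + a) + 1 / (1 + 1 / (1 + b)) \<le> 3 \<longleftrightarrow> b \<le> a"
proof -
  have e: "1 / (1 + 1 / (1 + b)) = 1 - 1 / (2 + b)" using assms by (simp add: divide_simps)
  have "1 / (2 + a) \<le> 1 / (2 + b) \<longleftrightarrow> b \<le> a" using assms by (simp add: divide_simps)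
  then show ?thesis unfolding e by linarith
qed

context cf_expansion
begin

abbreviation dg :: "nat \<Rightarrow> int" where "dg n \<equiv> xs !! n"
abbreviation pst :: "nat \<Rightarrow> real" where "pst n \<equiv> cf_past xs n"
definition fut :: "nat \<Rightarrow> real" where "fut n = cfv (sdrop (Suc n) xs)"

lemma pst_0: "pst 0 = 0" by (simp add: cf_past_eq)

lemma pst_Suc: "pst (Suc n) = 1 / (dg (Suc n) + pst n)"
proof -
  have "rev (stake (Suc n) (stl xs)) = dg (Suc n) # rev (stake n (stl xs))"
    by (simp add: stake_Suc del: stake.simps)
  then show ?thesis by (simp add: cf_past_eq del: stake.simps snth.simps)
qed

lemma pst_bounds: "0 \<le> pst n" "pst n \<le> 1"
  using cfF_bounds[of "rev (stake n (stl xs))" 0] pos_stake[OF pos_stl] by (simp_all add: cf_past_eq)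

lemma pst_Rats: "pst n \<in> \<rat>" unfolding cf_past_eq by (rule cfF_Rats) simp

lemma fut_bounds: "0 < fut n" "fut n < 1"
  using cfv_bounds[OF pos_tail] by (simp_all add: fut_def)

lemma fut_rec: "fut n = 1 / (dg (Suc n) + fut (Suc n))"
proof -
  have "sdrop (Suc n) xs = dg (Suc n) ## sdrop (Suc (Suc n)) xs" by (metis sdrop_simps stream.collapse)
  then show ?thesis
    unfolding fut_def using cfv_Stream[of "dg (Suc n)"] digit_pos[of "Suc n"] pos_tail[of "Suc n"] by simp
qed

lemma lambda_fut: "cf_lambda xs (Suc n) = dg (Suc n) + fut (Suc n) + pst n"
  by (simp add: lambda_eq fut_def)

lemma pst_Suc_eq: "dg (Suc n) = c \<Longrightarrow> pst (Suc n) = 1 / (of_int c + pst n)"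
  using pst_Suc[of n] by simp

lemma fut_eq: "dg (Suc n) = c \<Longrightarrow> fut n = 1 / (of_int c + fut (Suc n))"
  using fut_rec[of n] by simp

lemma fut_1: "dg (Suc n) = 1 \<Longrightarrow> 1 / 2 < fut n"
  unfolding fut_rec[of n] using fut_bounds[of "Suc n"] by (simp add: divide_simps del: snth.simps)
lemma fut_2: "dg (Suc n) = 2 \<Longrightarrow> fut n < 1 / 2" "dg (Suc n) = 2 \<Longrightarrow> 1 / 3 < fut n"
  unfolding fut_rec[of n] using fut_bounds[of "Suc n"] by (simp_all add: divide_simps del: snth.simps)
lemma pst_1: "n \<ge> 1 \<Longrightarrow> dg n = 1 \<Longrightarrow> 1 / 2 \<le> pst n"
  using pst_bounds[of "n - 1"] by (cases n) (auto simp: pst_Suc divide_simps simp del: snth.simps)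
lemma pst_ge2: "n \<ge> 1 \<Longrightarrow> 2 \<le> dg n \<Longrightarrow> pst n \<le> 1 / 2"
proof -
  assume "n \<ge> 1" "2 \<le> dg n"
  then obtain m where m: "n = Suc m" by (cases n) auto
  have "2 \<le> real_of_int (dg n) + pst m" using \<open>2 \<le> dg n\<close> pst_bounds[of m] by linarith
  then show "pst n \<le> 1 / 2" using m by (simp add: pst_Suc divide_simps del: snth.simps)
qed

lemma lambda_1: "dg (Suc n) = 1 \<Longrightarrow> cf_lambda xs (Suc n) \<le> 3"
  using lambda_fut[of n] fut_bounds[of "Suc n"] pst_bounds[of n] by (simp del: snth.simps)

lemma junction_12:
  assumes "dg (m + 1) = 1" "dg (m + 2) = 1" "dg (m + 3) = 2" "dg (m + 4) = 2"
  shows "cf_lambda xs (m + 3) \<le> 3 \<longleftrightarrow> pst m \<le> fut (m + 4)"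
proof -
  have "pst (m + 1) = 1 / (1 + pst m)" using pst_Suc_eq[of m 1] assms(1) by (simp del: snth.simps)
  moreover have "pst (m + 2) = 1 / (1 + pst (m + 1))" using pst_Suc_eq[of "m + 1" 1] assms(2) by (simp del: snth.simps)
  moreover have "fut (m + 3) = 1 / (2 + fut (m + 4))"
    using fut_eq[of "m + 3" 2] assms(4) by (simp add: numeral_eq_Suc del: snth.simps)
  moreover have "cf_lambda xs (m + 3) = 2 + fut (m + 3) + pst (m + 2)"
    using lambda_fut[of "m + 2"] assms(3) by (simp add: numeral_eq_Suc del: snth.simps)
  ultimately have "cf_lambda xs (m + 3) = 2 + 1 / (2 + fut (m + 4)) + 1 / (1 + 1 / (1 + pst m))" by simp
  then show ?thesis using junction_iff[of "fut (m + 4)" "pst m"] fut_bounds[of "m + 4"] pst_bounds[of m] by simp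
qed

lemma junction_21:
  assumes "dg (m + 1) = 2" "dg (m + 2) = 2" "dg (m + 3) = 1" "dg (m + 4) = 1"
  shows "cf_lambda xs (m + 2) \<le> 3 \<longleftrightarrow> fut (m + 4) \<le> pst m"
proof -
  have "pst (m + 1) = 1 / (2 + pst m)" using pst_Suc_eq[of m 2] assms(1) by (simp del: snth.simps)
  moreover have "fut (m + 2) = 1 / (1 + fut (m + 3))"
    using fut_eq[of "m + 2" 1] assms(3) by (simp add: numeral_eq_Suc del: snth.simps)
  moreover have "fut (m + 3) = 1 / (1 + fut (m + 4))"
    using fut_eq[of "m + 3" 1] assms(4) by (simp add: numeral_eq_Suc del: snth.simps)
  moreover have "cf_lambda xs (m + 2) = 2 + fut (m + 2) + pst (m + 1)"
    using lambda_fut[of "m + 1"] assms(2) by (simp add: numeral_eq_Suc del: snth.simps)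
  ultimately have "cf_lambda xs (m + 2) = 2 + 1 / (2 + pst m) + 1 / (1 + 1 / (1 + fut (m + 4)))" by simp
  then show ?thesis using junction_iff[of "pst m" "fut (m + 4)"] fut_bounds[of "m + 4"] pst_bounds[of m] by simp
qed

text \<open>Only one 2 is known before \<open>11\<close>, so \<open>[0;1,1,y] = 1 - [0;2,y]\<close>
  leads to a comparison of the past with \<open>[0;2,y]\<close>. This is the source of the 2 in the
  second inequality of the theorem.\<close>

lemma junction_start:
  assumes "dg (m + 1) = 2" "dg (m + 2) = 1" "dg (m + 3) = 1"
  shows "cf_lambda xs (m + 1) \<le> 3 \<longleftrightarrow> pst m \<le> 1 / (2 + fut (m + 3))"
proof -
  have "fut (m + 1) = 1 / (1 + fut (m + 2))"
    using fut_eq[of "m + 1" 1] assms(2) by (simp add: numeral_eq_Suc del: snth.simps)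
  moreover have "fut (m + 2) = 1 / (1 + fut (m + 3))"
    using fut_eq[of "m + 2" 1] assms(3) by (simp add: numeral_eq_Suc del: snth.simps)
  moreover have "cf_lambda xs (m + 1) = 2 + fut (m + 1) + pst m"
    using lambda_fut[of m] assms(1) by (simp add: numeral_eq_Suc del: snth.simps)
  ultimately have e: "cf_lambda xs (m + 1) = 2 + 1 / (1 + 1 / (1 + fut (m + 3))) + pst m" by simp
  have "1 / (1 + 1 / (1 + fut (m + 3))) = 1 - 1 / (2 + fut (m + 3))"
    using fut_bounds[of "m + 3"] by (simp add: divide_simps)
  then show ?thesis unfolding e by linarith
qed

lemma sdrop_block:
  assumes "sdrop (Suc M) xs = sdigits (u @- X)"
  shows "sdrop (Suc (M + 2 * length u)) xs = sdigits X"
    "pst (M + 2 * length u) = cfF (digits (rev u)) (pst M)"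
proof -
  have "sdrop (2 * length u) (sdrop (Suc M) xs) = sdigits X"
    unfolding assms by (simp add: sdrop_shift length_digits)
  then show "sdrop (Suc (M + 2 * length u)) xs = sdigits X" by (simp add: add.commute add.left_commute)
  have "stake (2 * length u) (sdrop M (stl xs)) = digits u"
    using assms by (simp add: stake_shift length_digits)
  then have "stake (M + 2 * length u) (stl xs) = stake M (stl xs) @ digits u" by (metis stake_add)
  then show "pst (M + 2 * length u) = cfF (digits (rev u)) (pst M)"
    by (simp add: cf_past_eq rev_digits)
qed

text \<open>The index \<open>M + 2 * length u + 2\<close> belongs to the second 2 of the block
  \<open>a\<close>, the one next to \<open>11\<close>.\<close>

lemma junction_ab:
  assumes "sdrop (Suc M) xs = sdigits (u @- La ## Lb ## R)"
  shows "cf_lambda xs (M + 2 * length u + 2) \<le> 3 \<longleftrightarrow> cfv (sdigits R) \<le> cfF (digits (rev u)) (pst M)"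
proof -
  define m where "m = M + 2 * length u"
  have s: "sdrop (Suc m) xs = 2 ## 2 ## 1 ## 1 ## sdigits R"
    using sdrop_block(1)[OF assms] by (simp add: m_def)
  have d: "dg (m + 1 + k) = (2 ## 2 ## 1 ## 1 ## sdigits R) !! k" for k
    using sdrop_snth[of "Suc m" xs k] unfolding s by simp
  have "sdrop (Suc (m + 4)) xs = sdrop 4 (sdrop (Suc m) xs)" by (simp add: add.commute del: sdrop.simps)
  then have "fut (m + 4) = cfv (sdigits R)" unfolding fut_def s by (simp add: numeral_eq_Suc)
  moreover have "dg (m + 1) = 2" "dg (m + 2) = 2" "dg (m + 3) = 1" "dg (m + 4) = 1"
    using d[of 0] d[of 1] d[of 2] d[of 3] by (simp_all add: numeral_eq_Suc)
  ultimately show ?thesis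
    using junction_21[of m] sdrop_block(2)[OF assms] unfolding m_def[symmetric] by metis
qed

text \<open>Here the 2 next to \<open>11\<close> is the first digit of the block \<open>a\<close>,
  hence the index ends in \<open>+ 3\<close>.\<close>

lemma junction_ba:
  assumes "sdrop (Suc M) xs = sdigits (u @- Lb ## La ## R)"
  shows "cf_lambda xs (M + 2 * length u + 3) \<le> 3 \<longleftrightarrow> cfF (digits (rev u)) (pst M) \<le> cfv (sdigits R)"
proof -
  define m where "m = M + 2 * length u"
  have s: "sdrop (Suc m) xs = 1 ## 1 ## 2 ## 2 ## sdigits R"
    using sdrop_block(1)[OF assms] by (simp add: m_def)
  have d: "dg (m + 1 + k) = (1 ## 1 ## 2 ## 2 ## sdigits R) !! k" for k
    using sdrop_snth[of "Suc m" xs k] unfolding s by simp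
  have "sdrop (Suc (m + 4)) xs = sdrop 4 (sdrop (Suc m) xs)" by (simp add: add.commute del: sdrop.simps)
  then have "fut (m + 4) = cfv (sdigits R)" unfolding fut_def s by (simp add: numeral_eq_Suc)
  moreover have "dg (m + 1) = 1" "dg (m + 2) = 1" "dg (m + 3) = 2" "dg (m + 4) = 2"
    using d[of 0] d[of 1] d[of 2] d[of 3] by (simp_all add: numeral_eq_Suc)
  ultimately show ?thesis
    using junction_12[of m] sdrop_block(2)[OF assms] unfolding m_def[symmetric] by metis
qed

text \<open>Only the digits \<open>2\<close> adjacent to a block \<open>11\<close>, and a digit \<open>2\<close> at the start, can violate the bound.\<close>

lemma lambda_le_3I:
  assumes W: "sdrop (Suc M) xs = sdigits S"
    and start: "shd S = La \<Longrightarrow> cf_lambda xs (Suc M) \<le> 3"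
    and ab: "\<And>u R. S = u @- La ## Lb ## R \<Longrightarrow> cfv (sdigits R) \<le> cfF (digits (rev u)) (pst M)"
    and ba: "\<And>u R. S = u @- Lb ## La ## R \<Longrightarrow> cfF (digits (rev u)) (pst M) \<le> cfv (sdigits R)"
    and n: "M \<le> n"
  shows "cf_lambda xs (Suc n) \<le> 3"
proof -
  define j where "j = n - M"
  have nj: "n = M + j" using n by (simp add: j_def)
  define i where "i = j div 2"
  define u where "u = stake i S"
  have lu: "length u = i" by (simp add: u_def)
  obtain c X where X: "sdrop i S = c ## X" by (cases "sdrop i S")
  have S: "S = u @- c ## X" using stake_sdrop[of i S] X by (simp add: u_def)
  have sd: "sdrop (Suc (M + 2 * i)) xs = block c @- sdigits X"
    using sdrop_block(1)[of M u "c ## X"] W S lu by simp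
  have d: "dg (M + 2 * i + 1 + k) = (block c @- sdigits X) !! k" for k
    using sdrop_snth[of "Suc (M + 2 * i)" xs k] unfolding sd by simp
  have d1: "dg (Suc (M + 2 * i)) = (if c = La then 2 else 1)"
    and d2: "dg (Suc (Suc (M + 2 * i))) = (if c = La then 2 else 1)"
    using d[of 0] d[of 1] by (cases c; simp del: snth.simps(2); simp)+
  have "j = 2 * i \<or> j = Suc (2 * i)" unfolding i_def by presburger
  then consider "c = Lb" | "c = La" "j = 2 * i" | "c = La" "j = Suc (2 * i)"
    by (cases c) auto
  then show ?thesis
  proof cases
    case 1
    then have "dg (Suc n) = 1" using d1 d2 nj i_def by (cases "even j") (auto elim!: evenE oddE simp del: snth.simps)
    then show ?thesis by (rule lambda_1)
  next
    case 2
    then have nn: "n = M + 2 * i" and dn: "dg (Suc n) = 2" "dg (Suc (Suc n)) = 2" using nj d1 d2 by auto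
    show ?thesis
    proof (cases u rule: rev_cases)
      case Nil
      then show ?thesis using start S 2 lu nn by simp
    next
      case (snoc u' e)
      have S': "S = u' @- e ## La ## X" using S snoc 2 by simp
      have lu': "i = Suc (length u')" using lu snoc by simp
      show ?thesis
      proof (cases e)
        case Lb
        then show ?thesis using junction_ba[of M u' X] W S' ba[of u' X] nn lu' by (simp add: numeral_eq_Suc)
      next
        \<comment> \<open>Both neighbours are 2, so \<lambda> is at most 2 + 1/2 + 1/2.\<close>
        case La
        have "sdrop (Suc (M + 2 * length u')) xs = 2 ## 2 ## sdigits (La ## X)"
          using sdrop_block(1)[of M u' "e ## La ## X"] W S' La by simp
        then have "dg (Suc (M + 2 * length u') + 1) = 2"
          using sdrop_snth[of "Suc (M + 2 * length u')" xs 1] by simp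
        then have "dg n = 2" using nn lu' by (simp del: snth.simps)
        then have "pst n \<le> 1 / 2" using nn lu' by (intro pst_ge2) auto
        then show ?thesis using lambda_fut[of n] dn fut_2(1)[of "Suc n"] by (simp del: snth.simps)
      qed
    qed
  next
    case 3
    then have nn: "n = Suc (M + 2 * i)" and dn: "dg n = 2" "dg (Suc n) = 2" using nj d1 d2 by (auto simp del: snth.simps)
    obtain e Y where e: "X = e ## Y" by (cases X)
    show ?thesis
    proof (cases e)
      case Lb
      then have "S = u @- La ## Lb ## Y" using S e 3 by simp
      then show ?thesis using junction_ab[of M u Y] W ab[of u Y] nn lu by (simp add: numeral_eq_Suc)
    next
      case La
      have "sdrop (Suc (M + 2 * i)) xs = 2 ## 2 ## 2 ## 2 ## sdigits Y" using sd 3 e La by simp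
      then have "dg (Suc (M + 2 * i) + 2) = 2"
        using sdrop_snth[of "Suc (M + 2 * i)" xs 2] by (simp add: numeral_eq_Suc)
      then have "dg (Suc (Suc n)) = 2" using nn by (simp add: numeral_eq_Suc del: snth.simps)
      then have "fut (Suc n) < 1 / 2" by (rule fut_2)
      moreover have "pst n \<le> 1 / 2" using dn nn by (intro pst_ge2) auto
      ultimately show ?thesis using lambda_fut[of n] dn by (simp del: snth.simps)
    qed
  qed
qed

end


section \<open>Runs of equal digits\<close>

context cf_expansion
begin

lemma pst_replicate:
  assumes "\<And>j. j < k \<Longrightarrow> dg (i + 1 + j) = c"
  shows "pst (i + k) = cfF (replicate k c) (pst i)"
  using assms
proof (induction k)
  case (Suc k)
  have "pst (i + Suc k) = 1 / (of_int c + pst (i + k))"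
    using pst_Suc_eq[of "i + k" c] Suc.prems[of k] by (simp del: snth.simps)
  then show ?case using Suc by (simp del: snth.simps)
qed simp

lemma fut_replicate:
  assumes "\<And>j. j < k \<Longrightarrow> dg (i + 1 + j) = c"
  shows "fut i = cfF (replicate k c) (fut (i + k))"
  using assms
proof (induction k arbitrary: i)
  case (Suc k)
  have "fut i = 1 / (of_int c + fut (Suc i))" using fut_eq[of i c] Suc.prems[of 0] by (simp del: snth.simps)
  moreover have "fut (Suc i) = cfF (replicate k c) (fut (Suc i + k))"
    by (rule Suc.IH) (use Suc.prems[of "Suc _"] in \<open>simp del: snth.simps\<close>)
  ultimately show ?case by simp
qed simp

lemma replicate_compare:
  assumes "1 \<le> c"
  shows "even k \<Longrightarrow> cfF (replicate k c) (pst i) \<le> cfF (replicate k c) (fut j) \<longleftrightarrow> pst i \<le> fut j"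
    "even k \<Longrightarrow> cfF (replicate k c) (fut j) \<le> cfF (replicate k c) (pst i) \<longleftrightarrow> fut j \<le> pst i"
    "odd k \<Longrightarrow> cfF (replicate k c) (pst i) \<le> cfF (replicate k c) (fut j) \<longleftrightarrow> fut j \<le> pst i"
    "odd k \<Longrightarrow> cfF (replicate k c) (fut j) \<le> cfF (replicate k c) (pst i) \<longleftrightarrow> pst i \<le> fut j"
  using pst_bounds[of i] fut_bounds[of j] assms
  by (auto simp: cfF_mono_even cfF_mono_odd pos_list_def)

end

locale cf_tail_le_3 = cf_expansion +
  fixes N :: nat
  assumes le3: "\<And>n. N \<le> n \<Longrightarrow> cf_lambda xs (Suc n) \<le> 3"
    and minimal: "N = 0 \<or> 3 < cf_lambda xs N"
begin

lemma dg_12: "N \<le> n \<Longrightarrow> dg (Suc n) = 1 \<or> dg (Suc n) = 2"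
proof -
  assume n: "N \<le> n"
  have "real_of_int (dg (Suc n)) < 3"
    using le3[OF n] lambda_fut[of n] fut_bounds[of "Suc n"] pst_bounds[of n] by linarith
  then have "dg (Suc n) < 3" by linarith
  moreover have "1 \<le> dg (Suc n)" using digit_pos[of "Suc n"] by linarith
  ultimately show ?thesis by linarith
qed

lemma fut_gt: "N \<le> n \<Longrightarrow> 1 / 3 < fut n"
  using dg_12[of n] fut_1[of n] fut_2(2)[of n] by linarith

text \<open>A neighbour 1 on either side of the 2 contributes at least 1/2, the one on the right
  strictly more.\<close>

lemma no_121:
  assumes "N \<le> n" "1 \<le> n" "dg n = 1" "dg (Suc n) = 2"
  shows "dg (Suc (Suc n)) = 2"
proof (rule ccontr)
  assume "dg (Suc (Suc n)) \<noteq> 2"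
  then have "dg (Suc (Suc n)) = 1" using dg_12[of "Suc n"] assms(1) by linarith
  then have "1 / 2 < fut (Suc n)" by (rule fut_1)
  moreover have "1 / 2 \<le> pst n" using pst_1 assms by blast
  ultimately show False using le3[OF assms(1)] lambda_fut[of n] assms(4) by linarith
qed

text \<open>The digit 1 after a past of at most 1/2 gives a new past of at least 2/3, and the future
  exceeds 1/3, so a 2 in the next place would have \<lambda> > 3.\<close>

lemma no_212:
  assumes "N \<le> Suc n" "pst n \<le> 1 / 2" "dg (Suc n) = 1"
  shows "dg (Suc (Suc n)) = 1"
proof (rule ccontr)
  assume "dg (Suc (Suc n)) \<noteq> 1"
  then have d: "dg (Suc (Suc n)) = 2" using dg_12[of "Suc n"] assms(1) by linarith
  have "pst (Suc n) = 1 / (1 + pst n)" using pst_Suc_eq[of n 1] assms(3) by (simp del: snth.simps)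
  moreover have "2 / 3 \<le> 1 / (1 + pst n)" using assms(2) pst_bounds[of n] by (simp add: divide_simps)
  ultimately have "2 / 3 \<le> pst (Suc n)" by simp
  moreover have "1 / 3 < fut (Suc (Suc n))" using fut_gt[of "Suc (Suc n)"] assms(1) by linarith
  ultimately show False using le3[OF assms(1)] lambda_fut[of "Suc n"] d by linarith
qed

text \<open>An odd run of \<open>1\<close>s is followed by \<open>22\<close> and a strictly shorter odd run of \<open>1\<close>s.\<close>

lemma no_odd_run_of_1:
  assumes "N \<le> i" "pst i \<le> 1 / 2" "odd k" "\<And>j. j < k \<Longrightarrow> dg (i + 1 + j) = 1" "dg (i + 1 + k) = 2"
  shows False
  using assms
proof (induction k arbitrary: i rule: less_induct)
  case (less k)
  note ones = less.prems(4)
  show False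
  proof (cases "k = 1")
    case True
    then show False using no_212[of i] less.prems ones[of 0] by (simp del: snth.simps)
  next
    case False
    obtain m where m: "k = 2 * m + 1" using less.prems(3) by (elim oddE)
    \<comment> \<open>The last two digits of the run belong to the junction with \<open>22\<close>.
      The other \<open>l = k - 2\<close> digits, again odd in number, are compared with the digits
      after the junction.\<close>
    define l where "l = 2 * (m - 1) + 1"
    have k: "k = l + 2" "odd l" using m False by (auto simp: l_def)
    have d1: "dg (i + l + 1) = 1" "dg (i + l + 2) = 1" using ones[of l] ones[of "l + 1"] k by (auto simp: algebra_simps simp del: snth.simps)
    have d2: "dg (i + l + 3) = 2" using less.prems(5) k by (simp add: numeral_eq_Suc del: snth.simps)
    have d3: "dg (i + l + 4) = 2"
      using no_121[of "i + l + 2"] d1 d2 less.prems(1) by (simp add: numeral_eq_Suc del: snth.simps)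
    have le: "pst (i + l) \<le> fut (i + l + 4)"
      using junction_12[of "i + l"] d1 d2 d3 le3[of "i + l + 2"] less.prems(1) by (simp add: numeral_eq_Suc del: snth.simps)
    define a where "a = i + l + 4"
    have Na: "N \<le> a" using less.prems(1) by (simp add: a_def)
    have pst_a: "pst a \<le> 1 / 2" using d3 by (intro pst_ge2) (auto simp: a_def simp del: snth.simps)
    have ones_i: "pst (i + m) = cfF (replicate n 1) (pst (i + m - n))" if "n \<le> m" "m \<le> k" for m n
      using pst_replicate[of n "i + m - n" 1] ones[of "m - n + _"] that by (simp add: algebra_simps del: snth.simps)
    show False
    \<comment> \<open>The bound \<open>t \<le> l\<close> is inclusive: after \<open>l\<close> equal
      digits the inequality is reversed because \<open>l\<close> is odd, and the digit at offset
      \<open>l\<close> produces the contradiction with the past before the run.\<close>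
    proof (cases "\<exists>t\<le>l. dg (a + 1 + t) \<noteq> 1")
      case False
      then have A: "dg (a + 1 + t) = 1" if "t \<le> l" for t using that by blast
      have "fut a = cfF (replicate l 1) (fut (a + l))" by (rule fut_replicate) (use A in simp)
      moreover have "pst (i + l) = cfF (replicate l 1) (pst i)" using ones_i[of l l] k by simp
      ultimately have "fut (a + l) \<le> pst i" using le k replicate_compare(3)[of 1 l i "a + l"] by (simp add: a_def)
      moreover have "1 / 2 < fut (a + l)" using A[of l] by (intro fut_1) (simp del: snth.simps)
      ultimately show False using less.prems(2) by simp
    next
      case True
      define t where "t = (LEAST t. t \<le> l \<and> dg (a + 1 + t) \<noteq> 1)"
      have t: "t \<le> l \<and> dg (a + 1 + t) \<noteq> 1" unfolding t_def by (rule LeastI_ex) (use True in blast)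
      have A: "dg (a + 1 + s) = 1" if "s < t" for s
        using not_less_Least[of s "\<lambda>t. t \<le> l \<and> dg (a + 1 + t) \<noteq> 1"] that t unfolding t_def[symmetric] by auto
      have t2: "dg (a + 1 + t) = 2" using dg_12[of "a + t"] t Na by (auto simp del: snth.simps)
      show False
      proof (cases "odd t")
        case True
        show False by (rule less.IH[of t a]) (use True t k A t2 pst_a less.prems(1) in \<open>auto simp: a_def simp del: snth.simps\<close>)
      next
        case False
        \<comment> \<open>An even number of equal digits preserves the inequality, but then the left
          side continues with 1 and the right side with 2.\<close>
        then have tl: "t < l" using t k by (cases "t = l") auto
        have "fut a = cfF (replicate t 1) (fut (a + t))" by (rule fut_replicate) (use A in simp)
        moreover have "pst (i + l) = cfF (replicate t 1) (pst (i + l - t))" using ones_i[of t l] tl k by simp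
        ultimately have "pst (i + l - t) \<le> fut (a + t)"
          using le False replicate_compare(1)[of 1 t "i + l - t" "a + t"] by (simp add: a_def)
        moreover have "fut (a + t) < 1 / 2" using t2 by (intro fut_2) (simp del: snth.simps)
        moreover have "1 / 2 \<le> pst (i + l - t)"
        proof (rule pst_1)
          have e: "i + 1 + (l - t - 1) = i + l - t" using tl by simp
          have "dg (i + 1 + (l - t - 1)) = 1" by (rule ones) (use k in simp)
          then show "dg (i + l - t) = 1" unfolding e .
        qed (use tl in simp)
        ultimately show False by simp
      qed
    qed
  qed
qed

text \<open>The same descent with the inequality reversed. The digit 1 before the run gives a past
  of at least 1/2; a run at the start of the tail is treated separately.\<close>

lemma no_odd_run_of_2:
  assumes "N < i" "dg i = 1" "odd k" "\<And>j. j < k \<Longrightarrow> dg (i + 1 + j) = 2" "dg (i + 1 + k) = 1"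
  shows False
  using assms
proof (induction k arbitrary: i rule: less_induct)
  case (less k)
  note twos = less.prems(4)
  have pst_i: "1 / 2 \<le> pst i" using less.prems by (intro pst_1) auto
  show False
  proof (cases "k = 1")
    case True
    then show False using no_121[of i] less.prems twos[of 0] by (simp del: snth.simps)
  next
    case False
    obtain m where m: "k = 2 * m + 1" using less.prems(3) by (elim oddE)
    define l where "l = 2 * (m - 1) + 1"
    have k: "k = l + 2" "odd l" using m False by (auto simp: l_def)
    have d1: "dg (i + l + 1) = 2" "dg (i + l + 2) = 2" using twos[of l] twos[of "l + 1"] k by (auto simp: algebra_simps simp del: snth.simps)
    have d2: "dg (i + l + 3) = 1" using less.prems(5) k by (simp add: numeral_eq_Suc del: snth.simps)
    have "pst (i + l + 2) \<le> 1 / 2" using d1 by (intro pst_ge2) auto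
    then have d3: "dg (i + l + 4) = 1"
      using no_212[of "i + l + 2"] d2 less.prems(1) by (simp add: numeral_eq_Suc del: snth.simps)
    have le: "fut (i + l + 4) \<le> pst (i + l)"
      using junction_21[of "i + l"] d1 d2 d3 le3[of "i + l + 1"] less.prems(1) by (simp add: numeral_eq_Suc del: snth.simps)
    define a where "a = i + l + 4"
    have Na: "N \<le> a" using less.prems(1) by (simp add: a_def)
    have twos_i: "pst (i + m) = cfF (replicate n 2) (pst (i + m - n))" if "n \<le> m" "m \<le> k" for m n
      using pst_replicate[of n "i + m - n" 2] twos[of "m - n + _"] that by (simp add: algebra_simps del: snth.simps)
    show False
    proof (cases "\<exists>t\<le>l. dg (a + 1 + t) \<noteq> 2")
      case False
      then have A: "dg (a + 1 + t) = 2" if "t \<le> l" for t using that by blast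
      have "fut a = cfF (replicate l 2) (fut (a + l))" by (rule fut_replicate) (use A in simp)
      moreover have "pst (i + l) = cfF (replicate l 2) (pst i)" using twos_i[of l l] k by simp
      ultimately have "pst i \<le> fut (a + l)" using le k replicate_compare(4)[of 2 l "a + l" i] by (simp add: a_def)
      moreover have "fut (a + l) < 1 / 2" using A[of l] by (intro fut_2) (simp del: snth.simps)
      ultimately show False using pst_i by simp
    next
      case True
      define t where "t = (LEAST t. t \<le> l \<and> dg (a + 1 + t) \<noteq> 2)"
      have t: "t \<le> l \<and> dg (a + 1 + t) \<noteq> 2" unfolding t_def by (rule LeastI_ex) (use True in blast)
      have A: "dg (a + 1 + s) = 2" if "s < t" for s
        using not_less_Least[of s "\<lambda>t. t \<le> l \<and> dg (a + 1 + t) \<noteq> 2"] that t unfolding t_def[symmetric] by auto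
      have t2: "dg (a + 1 + t) = 1" using dg_12[of "a + t"] t Na by (auto simp del: snth.simps)
      show False
      proof (cases "odd t")
        case True
        show False by (rule less.IH[of t a]) (use True t k A t2 d3 less.prems(1) in \<open>auto simp: a_def simp del: snth.simps\<close>)
      next
        case False
        then have tl: "t < l" using t k by (cases "t = l") auto
        have "fut a = cfF (replicate t 2) (fut (a + t))" by (rule fut_replicate) (use A in simp)
        moreover have "pst (i + l) = cfF (replicate t 2) (pst (i + l - t))" using twos_i[of t l] tl k by simp
        ultimately have "fut (a + t) \<le> pst (i + l - t)"
          using le False replicate_compare(2)[of 2 t "a + t" "i + l - t"] by (simp add: a_def)
        moreover have "1 / 2 < fut (a + t)" using t2 by (intro fut_1) (simp del: snth.simps)
        moreover have "pst (i + l - t) \<le> 1 / 2"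
        proof (rule pst_ge2)
          have e: "i + 1 + (l - t - 1) = i + l - t" using tl by simp
          have "dg (i + 1 + (l - t - 1)) = 2" by (rule twos) (use k in simp)
          then show "2 \<le> dg (i + l - t)" unfolding e by simp
        qed (use tl in simp)
        ultimately show False by simp
      qed
    qed
  qed
qed

lemma dg_N: "N = 0 \<or> (1 \<le> N \<and> 2 \<le> dg N)"
proof (cases N)
  case (Suc M)
  have "3 < cf_lambda xs (Suc M)" using minimal Suc by simp
  then have "dg (Suc M) \<noteq> 1" using lambda_1[of M] by linarith
  moreover have "1 \<le> dg (Suc M)" using digit_pos[of "Suc M"] by linarith
  ultimately show ?thesis using Suc by (simp del: snth.simps)
qed simp

lemma pst_N_le: "pst N \<le> 1 / 2"
  using dg_N pst_ge2[of N] pst_0 by auto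

text \<open>From \<lambda>_N > 3 and a future below 1/2, the digit \<open>x_N\<close> plus the past
  before it exceeds 5/2; the bound is the reciprocal.\<close>

lemma pst_N_less:
  assumes "dg (Suc N) = 2"
  shows "pst N < 2 / 5"
proof (cases N)
  case 0 then show ?thesis using pst_0 by simp
next
  case (Suc M)
  have l: "3 < dg N + fut N + pst M" using minimal lambda_fut[of M] Suc by (simp del: snth.simps)
  have f: "fut N < 1 / 2" using fut_2(1)[OF assms] .
  have p: "pst N = 1 / (dg N + pst M)" using pst_Suc[of M] Suc by simp
  have "5 / 2 < dg N + pst M" using l f by linarith
  then show ?thesis unfolding p by (simp add: divide_simps)
qed

text \<open>The prefixed 2 makes this run odd, but no digit 1 precedes it in \<open>x\<close>. The
  bound 2/5 on the past takes over the role of that digit.\<close>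

lemma no_even_initial_run_of_2:
  assumes k: "even k" "k > 0" and twos: "\<And>j. j < k \<Longrightarrow> dg (N + 1 + j) = 2" and e: "dg (N + 1 + k) = 1"
  shows False
proof -
  obtain m where m: "k = 2 * m" using k by (elim evenE)
  define l where "l = 2 * (m - 1)"
  have l: "k = l + 2" "even l" using m k by (auto simp: l_def)
  have d1: "dg (N + l + 1) = 2" "dg (N + l + 2) = 2" using twos[of l] twos[of "l + 1"] l by (auto simp: algebra_simps simp del: snth.simps)
  have d2: "dg (N + l + 3) = 1" using e l by (simp add: numeral_eq_Suc del: snth.simps)
  have "pst (N + l + 2) \<le> 1 / 2" using d1 by (intro pst_ge2) auto
  then have d3: "dg (N + l + 4) = 1"
    using no_212[of "N + l + 2"] d2 by (simp add: numeral_eq_Suc del: snth.simps)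
  have le: "fut (N + l + 4) \<le> pst (N + l)"
    using junction_21[of "N + l"] d1 d2 d3 le3[of "N + l + 1"] by (simp add: numeral_eq_Suc del: snth.simps)
  define a where "a = N + l + 4"
  have Na: "N \<le> a" by (simp add: a_def)
  have twos_i: "pst (N + m) = cfF (replicate n 2) (pst (N + m - n))" if "n \<le> m" "m \<le> k" for m n
    using pst_replicate[of n "N + m - n" 2] twos[of "m - n + _"] that by (simp add: algebra_simps del: snth.simps)
  show False
  proof (cases "\<exists>t<l. dg (a + 1 + t) \<noteq> 2")
    case False
    then have A: "dg (a + 1 + t) = 2" if "t < l" for t using that by blast
    have "fut a = cfF (replicate l 2) (fut (a + l))" by (rule fut_replicate) (use A in simp)
    moreover have "pst (N + l) = cfF (replicate l 2) (pst N)" using twos_i[of l l] l by simp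
    ultimately have "fut (a + l) \<le> pst N" using le l replicate_compare(2)[of 2 l "a + l" N] by (simp add: a_def)
    moreover have "dg (Suc N) = 2" using twos[of 0] k by (simp del: snth.simps)
    ultimately have f: "fut (a + l) < 2 / 5" using pst_N_less by simp
    have d4: "dg (Suc (a + l)) = 2"
      using dg_12[of "a + l"] fut_1[of "a + l"] f Na by (auto simp del: snth.simps)
    \<comment> \<open>A value \<open>1 / (2 + f)\<close> below 2/5 means \<open>f > 1/2\<close>, so
      the next digit is 1. This completes an odd run of 2s between digits 1, which is already
      excluded.\<close>
    have "1 / 2 < fut (Suc (a + l))"
      using f fut_eq[OF d4] fut_bounds[of "Suc (a + l)"] by (simp add: divide_simps split: if_splits)
    then have d5: "dg (Suc (Suc (a + l))) = 1"
      using dg_12[of "Suc (a + l)"] fut_2(1)[of "Suc (a + l)"] Na by (auto simp del: snth.simps)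
    show False
    proof (rule no_odd_run_of_2[of a "Suc l"])
      show "dg (a + 1 + j) = 2" if "j < Suc l" for j
        using A[of j] d4 that by (cases "j = l") (simp_all del: snth.simps)
    qed (use d3 d5 l in \<open>auto simp: a_def simp del: snth.simps\<close>)
  next
    case True
    define t where "t = (LEAST t. t < l \<and> dg (a + 1 + t) \<noteq> 2)"
    have t: "t < l \<and> dg (a + 1 + t) \<noteq> 2" unfolding t_def by (rule LeastI_ex) (use True in blast)
    have A: "dg (a + 1 + s) = 2" if "s < t" for s
      using not_less_Least[of s "\<lambda>t. t < l \<and> dg (a + 1 + t) \<noteq> 2"] that t unfolding t_def[symmetric] by auto
    have t2: "dg (a + 1 + t) = 1" using dg_12[of "a + t"] t Na by (auto simp del: snth.simps)
    show False
    proof (cases "odd t")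
      case True
      show False by (rule no_odd_run_of_2[of a t]) (use True A t2 d3 in \<open>auto simp: a_def simp del: snth.simps\<close>)
    next
      case False
      have tl: "t < l" using t by simp
      have "fut a = cfF (replicate t 2) (fut (a + t))" by (rule fut_replicate) (use A in simp)
      moreover have "pst (N + l) = cfF (replicate t 2) (pst (N + l - t))" using twos_i[of t l] tl l by simp
      ultimately have "fut (a + t) \<le> pst (N + l - t)"
        using le False replicate_compare(2)[of 2 t "a + t" "N + l - t"] by (simp add: a_def)
      moreover have "1 / 2 < fut (a + t)" using t2 by (intro fut_1) (simp del: snth.simps)
      moreover have "pst (N + l - t) \<le> 1 / 2"
      proof (rule pst_ge2)
        have e: "N + 1 + (l - t - 1) = N + l - t" using tl by simp
        have "dg (N + 1 + (l - t - 1)) = 2" by (rule twos) (use l in simp)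
        then show "2 \<le> dg (N + l - t)" unfolding e by simp
      qed (use tl in simp)
      ultimately show False by simp
    qed
  qed
qed

end

section \<open>The tail is a block word\<close>

lemma paired_if_even_runs:
  fixes D :: "nat \<Rightarrow> 'a"
  assumes "\<And>r i. even r \<Longrightarrow> r \<le> 2 * i \<Longrightarrow> (\<And>j. r \<le> j \<Longrightarrow> j \<le> 2 * i \<Longrightarrow> D j = D (2 * i)) \<Longrightarrow>
      D (2 * i + 1) \<noteq> D (2 * i) \<Longrightarrow> (r = 0 \<or> D (r - 1) \<noteq> D (2 * i)) \<Longrightarrow> False"
  shows "D (2 * i + 1) = D (2 * i)"
proof (induction i rule: less_induct)
  case (less i)
  show ?case
  proof (rule ccontr)
    assume ne: "D (2 * i + 1) \<noteq> D (2 * i)"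
    \<comment> \<open>In the first pair of different digits, consider the run that ends at the first
      of them. All earlier pairs agree, so it begins at an even position and has odd length.\<close>
    let ?P = "\<lambda>r. r \<le> 2 * i \<and> (\<forall>j. r \<le> j \<longrightarrow> j \<le> 2 * i \<longrightarrow> D j = D (2 * i))"
    define r where "r = (LEAST r. ?P r)"
    have "?P (2 * i)" by auto
    then have r: "?P r" unfolding r_def by (rule LeastI)
    have pre: "r = 0 \<or> D (r - 1) \<noteq> D (2 * i)"
    proof (rule ccontr)
      assume "\<not> ?thesis"
      then have r0: "r > 0" "D (r - 1) = D (2 * i)" by auto
      have "?P (r - 1)"
      proof (intro conjI allI impI)
        show "D j = D (2 * i)" if "r - 1 \<le> j" "j \<le> 2 * i" for j
        proof (cases "j = r - 1")
          case True then show ?thesis using r0(2) by simp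
        next
          case False
          then have "r \<le> j" using that(1) by simp
          then show ?thesis using r that(2) by blast
        qed
        show "r - 1 \<le> 2 * i" using r by linarith
      qed
      then have "Least ?P \<le> r - 1" by (rule Least_le[of ?P])
      then show False using r0(1) by (simp only: r_def[symmetric])
    qed
    have "even r"
    proof (rule ccontr)
      assume "odd r"
      then obtain i' where i': "r = 2 * i' + 1" by (elim oddE)
      then have "i' < i" using r by linarith
      then have "D (2 * i' + 1) = D (2 * i')" by (rule less.IH)
      moreover have "D r = D (2 * i)" using r by blast
      ultimately show False using pre i' by simp
    qed
    then show False using assms[of r i] r ne pre by blast
  qed
qed

context cf_tail_le_3
begin

lemma tail_blocks_1:
  assumes "dg (Suc N) = 1"
  shows "\<exists>T. cf_tail xs N = sdigits T \<and> shd T = Lb"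
proof -
  define D where "D j = dg (N + 1 + j)" for j
  have D12: "D j = 1 \<or> D j = 2" for j using dg_12[of "N + j"] by (auto simp: D_def simp del: snth.simps)
  have pair: "D (2 * i + 1) = D (2 * i)" for i
  proof (rule paired_if_even_runs)
    fix r i assume r: "even r" "r \<le> 2 * i" and run: "\<And>j. r \<le> j \<Longrightarrow> j \<le> 2 * i \<Longrightarrow> D j = D (2 * i)"
      and ne: "D (2 * i + 1) \<noteq> D (2 * i)" and pre: "r = 0 \<or> D (r - 1) \<noteq> D (2 * i)"
    define k where "k = 2 * i + 1 - r"
    have k: "odd k" "r + k = 2 * i + 1" using r by (auto simp: k_def)
    show False
    proof (cases "D (2 * i) = 1")
      case True
      then have e: "D (2 * i + 1) = 2" using ne D12[of "2 * i + 1"] by auto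
      have "pst (N + r) \<le> 1 / 2"
      proof (cases "r = 0")
        case True then show ?thesis using pst_N_le by simp
      next
        case False
        then have "D (r - 1) = 2" using pre D12[of "r - 1"] True by auto
        then have "dg (N + r) = 2" using False by (simp add: D_def del: snth.simps)
        then show ?thesis using False by (intro pst_ge2) auto
      qed
      then show False
      proof (rule no_odd_run_of_1[rotated])
        show "dg (N + r + 1 + j) = 1" if "j < k" for j
          using run[of "r + j"] that True k by (simp add: D_def algebra_simps del: snth.simps)
        show "dg (N + r + 1 + k) = 2" using e k by (simp add: D_def algebra_simps del: snth.simps)
      qed (use k in auto)
    next
      case False
      then have t: "D (2 * i) = 2" and e: "D (2 * i + 1) = 1" using ne D12[of "2 * i"] D12[of "2 * i + 1"] by auto
      have r0: "r > 0" using run[of 0] t assms by (cases "r = 0") (auto simp: D_def simp del: snth.simps)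
      then have p: "D (r - 1) = 1" using pre D12[of "r - 1"] t by auto
      show False
      proof (rule no_odd_run_of_2[of "N + r" k])
        show "dg (N + r) = 1" using p r0 by (simp add: D_def del: snth.simps)
        show "dg (N + r + 1 + j) = 2" if "j < k" for j
          using run[of "r + j"] that t k by (simp add: D_def algebra_simps del: snth.simps)
        show "dg (N + r + 1 + k) = 1" using e k by (simp add: D_def algebra_simps del: snth.simps)
      qed (use k r0 in auto)
    qed
  qed
  define T where "T = smap (\<lambda>i. if D (2 * i) = 2 then La else Lb) nats"
  have "cf_tail xs N = sdigits T"
  proof (rule snth_ext)
    fix n
    have "cf_tail xs N !! n = D n" by (simp add: cf_tail_def sdrop_snth D_def del: sdrop.simps snth.simps)
    also have "D n = sdigits T !! n"
    proof (cases "even n")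
      case True
      then obtain i where "n = 2 * i" by (elim evenE)
      then show ?thesis using D12[of "2 * i"] snth_sdigits(1)[of T i] by (auto simp: T_def)
    next
      case False
      then obtain i where "n = 2 * i + 1" by (elim oddE)
      then show ?thesis using D12[of "2 * i"] pair[of i] snth_sdigits(2)[of T i] by (auto simp: T_def)
    qed
    finally show "cf_tail xs N !! n = sdigits T !! n" .
  qed
  moreover have "shd T = Lb" using assms by (simp add: T_def D_def del: snth.simps(2))
  ultimately show ?thesis by blast
qed

lemma tail_blocks_2:
  assumes "dg (Suc N) = 2"
  shows "\<exists>S. 2 ## cf_tail xs N = sdigits S \<and> shd S = La"
proof -
  define D where "D j = (case j of 0 \<Rightarrow> 2 | Suc j \<Rightarrow> dg (N + 1 + j))" for j
  have D0: "D 0 = 2" "D 1 = 2" using assms by (simp_all add: D_def del: snth.simps)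
  have DS: "D j = dg (N + j)" if "j > 0" for j using that by (cases j) (simp_all add: D_def del: snth.simps)
  have D12: "D j = 1 \<or> D j = 2" for j
    using dg_12[of "N + (j - 1)"] by (cases j) (auto simp: D_def simp del: snth.simps)
  have pair: "D (2 * i + 1) = D (2 * i)" for i
  proof (rule paired_if_even_runs)
    fix r i assume r: "even r" "r \<le> 2 * i" and run: "\<And>j. r \<le> j \<Longrightarrow> j \<le> 2 * i \<Longrightarrow> D j = D (2 * i)"
      and ne: "D (2 * i + 1) \<noteq> D (2 * i)" and pre: "r = 0 \<or> D (r - 1) \<noteq> D (2 * i)"
    define k where "k = 2 * i + 1 - r"
    have k: "odd k" "r + k = 2 * i + 1" using r by (auto simp: k_def)
    show False
    proof (cases "r = 0")
      \<comment> \<open>A run through the prefixed digit has length \<open>2 * i + 1\<close>, of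
        which only \<open>2 * i\<close> are digits of \<open>x\<close>.\<close>
      case True
      then have t: "D (2 * i) = 2" using run[of 0] D0 by simp
      then have e: "D (2 * i + 1) = 1" using ne D12[of "2 * i + 1"] by auto
      have i0: "i > 0" using e D0 by (cases i) auto
      show False
      proof (rule no_even_initial_run_of_2[of "2 * i"])
        show "dg (N + 1 + j) = 2" if "j < 2 * i" for j
          using run[of "Suc j"] that True t DS[of "Suc j"] by (simp del: snth.simps)
        show "dg (N + 1 + 2 * i) = 1" using e DS[of "2 * i + 1"] by (simp del: snth.simps)
      qed (use i0 in auto)
    next
      case False
      then have r2: "r \<ge> 2" using r(1) by (cases "r = 1") auto
      define m where "m = N + r - 1"
      have m: "N < m" "1 \<le> m" "D (r - 1) = dg m" using r2 DS[of "r - 1"] by (auto simp: m_def simp del: snth.simps)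
      have run': "dg (m + 1 + j) = D (2 * i)" if "j < k" for j
        using run[of "r + j"] DS[of "r + j"] that r2 k by (simp add: m_def algebra_simps del: snth.simps)
      have "m + 1 + k = N + (2 * i + 1)" using k r2 by (simp add: m_def)
      then have end': "dg (m + 1 + k) = D (2 * i + 1)" using DS[of "2 * i + 1"] by (simp del: snth.simps)
      show False
      proof (cases "D (2 * i) = 1")
        case True
        then have "D (2 * i + 1) = 2" "D (r - 1) = 2" using ne pre False D12[of "2 * i + 1"] D12[of "r - 1"] by auto
        moreover have "pst m \<le> 1 / 2" using m calculation by (intro pst_ge2) auto
        ultimately show False using no_odd_run_of_1[of m k] m k run' end' True by simp
      next
        case t: False
        then have "D (2 * i) = 2" "D (2 * i + 1) = 1" "D (r - 1) = 1"
          using ne pre False D12[of "2 * i"] D12[of "2 * i + 1"] D12[of "r - 1"] by auto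
        then show False using no_odd_run_of_2[of m k] m k run' end' by simp
      qed
    qed
  qed
  define S where "S = smap (\<lambda>i. if D (2 * i) = 2 then La else Lb) nats"
  have "2 ## cf_tail xs N = sdigits S"
  proof (rule snth_ext)
    fix n
    have "(2 ## cf_tail xs N) !! n = D n"
      by (cases n) (simp_all add: cf_tail_def sdrop_snth D_def snth_Stream del: sdrop.simps snth.simps(2))
    also have "D n = sdigits S !! n"
    proof (cases "even n")
      case True
      then obtain i where "n = 2 * i" by (elim evenE)
      then show ?thesis using D12[of "2 * i"] snth_sdigits(1)[of S i] by (auto simp: S_def)
    next
      case False
      then obtain i where "n = 2 * i + 1" by (elim oddE)
      then show ?thesis using D12[of "2 * i"] pair[of i] snth_sdigits(2)[of S i] by (auto simp: S_def)
    qed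
    finally show "(2 ## cf_tail xs N) !! n = sdigits S !! n" .
  qed
  moreover have "shd S = La" using D0 by (simp add: S_def)
  ultimately show ?thesis by blast
qed

end


subsection \<open>The bound on \<open>\<lambda>\<close> as a condition on the block word\<close>

lemma cfv_La_eq: "cfv (sdigits (La ## R)) = 1 / (2 + cfv (2 ## sdigits R))"
  by (simp add: cfv_Stream)

lemma inverse_le_iff_2:
  fixes a b :: real
  assumes "0 \<le> a" "0 \<le> b"
  shows "1 / (2 + a) \<le> 1 / (2 + b) \<longleftrightarrow> b \<le> a"
  using assms by (simp add: divide_simps)

text \<open>Here \<open>t\<close> is the past up to \<open>N\<close>, and \<open>1 / (2 + t)\<close>
  is the past after the digit \<open>x_{N+1} = 2\<close>. Cancelling this digit against one 2 of the
  last block reverses the inequality and leaves \<open>[0; 2, R]\<close>.\<close>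

lemma prefix_La_cfv_le:
  assumes "0 \<le> t"
  shows "cfF (digits y) (1 / (2 + t)) \<le> cfv (sdigits ((y @ [La]) @- R)) \<longleftrightarrow> cfv (2 ## sdigits R) \<le> t"
    "cfv (sdigits ((y @ [La]) @- R)) \<le> cfF (digits y) (1 / (2 + t)) \<longleftrightarrow> t \<le> cfv (2 ## sdigits R)"
proof -
  have t: "0 \<le> 1 / (2 + t)" "1 / (2 + t) \<le> 1" using assms by (auto simp: divide_simps)
  have "0 < cfv (2 ## sdigits R)" by (rule cfv_bounds) simp
  then show "cfF (digits y) (1 / (2 + t)) \<le> cfv (sdigits ((y @ [La]) @- R)) \<longleftrightarrow> cfv (2 ## sdigits R) \<le> t"
    "cfv (sdigits ((y @ [La]) @- R)) \<le> cfF (digits y) (1 / (2 + t)) \<longleftrightarrow> t \<le> cfv (2 ## sdigits R)"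
    using prefix_cfv_le[OF t, of y "La ## R"] assms unfolding cfv_La_eq shift_append shift.simps
    by (simp_all add: inverse_le_iff_2)
qed

context cf_expansion
begin

text \<open>A rational number is compared with an irrational one. So the weak bound on \<lambda>
  yields the strict inequalities of the theorem.\<close>

lemma pst_less_cfv: "pos_stream s \<Longrightarrow> pst n < cfv s \<longleftrightarrow> pst n \<le> cfv s"
  using cfv_irrational[of s] pst_Rats[of n] by (auto simp: order.order_iff_strict)

lemma admissible_1:
  assumes W: "cf_tail xs N = sdigits T" and le3: "\<And>n. N \<le> n \<Longrightarrow> cf_lambda xs (Suc n) \<le> 3"
  shows "admissible T (\<lambda>R. pst N < cfv (sdigits R))"
  unfolding admissible_def
proof (intro conjI allI impI)
  fix u R assume T: "T = u @- La ## Lb ## R"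
  then have sd: "sdrop (Suc N) xs = sdigits (u @- La ## Lb ## R)" using W by (simp add: cf_tail_def)
  have "cf_lambda xs (N + 2 * length u + 2) \<le> 3" using le3[of "N + 2 * length u + 1"] by simp
  then have le: "cfv (sdigits R) \<le> cfF (digits (rev u)) (pst N)" using junction_ab[OF sd] by simp
  consider "lex_gt (rev u) R" | "lex_lt (rev u) R" | R' where "R = rev u @- R'" using lex_gt_lt_prefix_cases by blast
  then show "lex_gt (rev u) R \<or> (\<exists>R'. R = rev u @- R' \<and> \<not> pst N < cfv (sdigits R'))"
  proof cases
    case 2
    then show ?thesis using lex_lt_imp_cfv_greater[OF 2 pst_bounds] le by (simp add: not_le[symmetric])
  next
    case 3
    then show ?thesis using le prefix_cfv_le(2)[OF pst_bounds, of "rev u" R' N] by auto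
  qed blast
next
  fix u R assume T: "T = u @- Lb ## La ## R"
  then have sd: "sdrop (Suc N) xs = sdigits (u @- Lb ## La ## R)" using W by (simp add: cf_tail_def)
  have "cf_lambda xs (N + 2 * length u + 3) \<le> 3" using le3[of "N + 2 * length u + 2"] by (simp add: numeral_eq_Suc)
  then have le: "cfF (digits (rev u)) (pst N) \<le> cfv (sdigits R)" using junction_ba[OF sd] by simp
  consider "lex_gt (rev u) R" | "lex_lt (rev u) R" | R' where "R = rev u @- R'" using lex_gt_lt_prefix_cases by blast
  then show "lex_lt (rev u) R \<or> (\<exists>R'. R = rev u @- R' \<and> pst N < cfv (sdigits R'))"
  proof cases
    case 1
    then show ?thesis using lex_gt_imp_cfv_less[OF 1 pst_bounds] le by (simp add: not_le[symmetric])
  next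
    case 3
    then show ?thesis using le prefix_cfv_le(1)[OF pst_bounds, of "rev u" N R'] pst_less_cfv by auto
  qed blast
qed

lemma admissible_1_imp_le_3:
  assumes W: "cf_tail xs N = sdigits T" and b: "shd T = Lb"
    and A: "admissible T (\<lambda>R. pst N < cfv (sdigits R))" and n: "N \<le> n"
  shows "cf_lambda xs (Suc n) \<le> 3"
proof (rule lambda_le_3I[of N T, OF _ _ _ _ n])
  show "sdrop (Suc N) xs = sdigits T" using W by (simp add: cf_tail_def)
  show "cf_lambda xs (Suc N) \<le> 3" if "shd T = La" using b that by simp
  show "cfv (sdigits R) \<le> cfF (digits (rev u)) (pst N)" if "T = u @- La ## Lb ## R" for u R
  proof -
    have "lex_gt (rev u) R \<or> (\<exists>R'. R = rev u @- R' \<and> \<not> pst N < cfv (sdigits R'))"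
      using A that unfolding admissible_def by blast
    then show ?thesis
      using lex_gt_imp_cfv_less[OF _ pst_bounds, of "rev u" R N] prefix_cfv_le(2)[OF pst_bounds, of "rev u" _ N] by fastforce
  qed
  show "cfF (digits (rev u)) (pst N) \<le> cfv (sdigits R)" if "T = u @- Lb ## La ## R" for u R
  proof -
    have "lex_lt (rev u) R \<or> (\<exists>R'. R = rev u @- R' \<and> pst N < cfv (sdigits R'))"
      using A that unfolding admissible_def by blast
    then show ?thesis
      using lex_lt_imp_cfv_greater[OF _ pst_bounds, of "rev u" R N] prefix_cfv_le(1)[OF pst_bounds, of "rev u" N] by fastforce
  qed
qed

lemma tail_2:
  assumes "2 ## cf_tail xs N = sdigits (La ## S1)"
  shows "dg (Suc N) = 2" "sdrop (Suc (Suc N)) xs = sdigits S1" "pst (Suc N) = 1 / (2 + pst N)" "pst (Suc N) \<le> 1 / 2"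
proof -
  have W: "sdrop (Suc N) xs = 2 ## sdigits S1" using assms by (simp add: cf_tail_def)
  show d: "dg (Suc N) = 2" using sdrop_snth[of "Suc N" xs 0] unfolding W by simp
  show "sdrop (Suc (Suc N)) xs = sdigits S1" using W by (metis sdrop_simps(2) stream.sel(2))
  show "pst (Suc N) = 1 / (2 + pst N)" using pst_Suc_eq[OF d] by simp
  show "pst (Suc N) \<le> 1 / 2" using d by (intro pst_ge2) (simp_all del: snth.simps)
qed

lemma tail_2_start:
  assumes "2 ## cf_tail xs N = sdigits (La ## Lb ## R)"
  shows "cf_lambda xs (Suc N) \<le> 3 \<longleftrightarrow> pst N \<le> cfv (2 ## sdigits R)"
proof -
  note t = tail_2[OF assms]
  have s: "sdrop (Suc (N + 1)) xs = 1 ## 1 ## sdigits R" using t(2) by simp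
  have "dg (N + 2) = 1" using sdrop_snth[of "Suc (N + 1)" xs 0] unfolding s by simp
  moreover have "dg (N + 3) = 1" using sdrop_snth[of "Suc (N + 1)" xs 1] unfolding s by (simp add: numeral_eq_Suc)
  moreover have "sdrop (Suc (N + 3)) xs = sdrop 2 (sdrop (Suc (N + 1)) xs)" by (simp add: numeral_eq_Suc del: sdrop.simps)
  then have "fut (N + 3) = cfv (sdigits R)" unfolding fut_def s by (simp add: numeral_eq_Suc)
  ultimately show ?thesis using junction_start[of N] t(1) by (simp add: cfv_Stream del: snth.simps)
qed

text \<open>The letters of \<open>T\<close> are exchanged, so its junctions \<open>ab\<close> are
  junctions \<open>ba\<close> of the digits. All junctions except one at the very start are read
  with the past at \<open>N + 1\<close>, which contains the real half of the first block.\<close>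

lemma admissible_2:
  assumes W: "2 ## cf_tail xs N = sdigits (smap swap T)" and le3: "\<And>n. N \<le> n \<Longrightarrow> cf_lambda xs (Suc n) \<le> 3"
    and b: "shd T = Lb"
  shows "admissible T (\<lambda>R. pst N < cfv (2 ## sdigits (smap swap R)))"
proof -
  obtain T1 where T1: "T = Lb ## T1" using b by (metis stream.collapse)
  define S1 where "S1 = smap swap T1"
  have S: "smap swap T = La ## S1" using T1 by (simp add: S1_def)
  have W': "2 ## cf_tail xs N = sdigits (La ## S1)" using W S by simp
  note t = tail_2[OF W']
  have p: "0 \<le> 1 / (2 + pst N)" "1 / (2 + pst N) \<le> 1" using pst_bounds[of "Suc N"] t(3) by auto
  show ?thesis unfolding admissible_def
  proof (intro conjI allI impI)
    fix u R assume u: "T = u @- La ## Lb ## R"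
    then obtain u1 where u1: "u = Lb # u1" using T1 by (cases u) auto
    define R2 where "R2 = smap swap R"
    define y where "y = rev (map swap u1)"
    have sd: "sdrop (Suc (Suc N)) xs = sdigits (map swap u1 @- Lb ## La ## R2)"
      using t(2) u u1 T1 by (simp add: S1_def R2_def)
    have "cf_lambda xs (Suc N + 2 * length (map swap u1) + 3) \<le> 3"
      using le3[of "Suc N + 2 * length u1 + 2"] by (simp add: numeral_eq_Suc)
    then have le: "cfF (digits y) (1 / (2 + pst N)) \<le> cfv (sdigits R2)"
      using junction_ba[OF sd] t(3) by (simp add: y_def)
    have yu: "map swap (rev u) = y @ [La]" using u1 by (simp add: y_def rev_map)
    consider "lex_gt (y @ [La]) R2" | "lex_lt (y @ [La]) R2" | R' where "R2 = (y @ [La]) @- R'" using lex_gt_lt_prefix_cases by blast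
    then show "lex_gt (rev u) R \<or> (\<exists>R'. R = rev u @- R' \<and> \<not> pst N < cfv (2 ## sdigits (smap swap R')))"
    proof cases
      case 1
      then show ?thesis using lex_gt_imp_cfv_less[OF lex_gt_append_La[OF 1] p] le by simp
    next
      case 2
      then show ?thesis using lex_lt_map_swap[of "rev u" R] yu by (simp add: R2_def)
    next
      case 3
      have "smap swap R2 = map swap (y @ [La]) @- smap swap R'" unfolding 3 by (rule smap_shift)
      then have "R = rev u @- smap swap R'" unfolding yu[symmetric] R2_def by (simp del: map_map)
      moreover have "cfv (2 ## sdigits R') \<le> pst N" using le prefix_La_cfv_le(1)[OF pst_bounds(1), of y N R'] 3 by simp
      ultimately show ?thesis by (intro disjI2 exI[of _ "smap swap R'"]) simp
    qed
  next
    fix u R assume u: "T = u @- Lb ## La ## R"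
    define R2 where "R2 = smap swap R"
    have pos: "pos_stream (2 ## sdigits X)" for X by simp
    show "lex_lt (rev u) R \<or> (\<exists>R'. R = rev u @- R' \<and> pst N < cfv (2 ## sdigits (smap swap R')))"
    proof (cases u)
      \<comment> \<open>This junction uses the prefixed block, so only one real 2 stands before
        \<open>11\<close>.\<close>
      case Nil
      then have "2 ## cf_tail xs N = sdigits (La ## Lb ## R2)" using W u by (simp add: R2_def)
      then have "pst N \<le> cfv (2 ## sdigits R2)" using tail_2_start le3[of N] by simp
      then have "pst N < cfv (2 ## sdigits (smap swap R))" using pst_less_cfv[OF pos] by (simp add: R2_def)
      then show ?thesis using Nil by simp
    next
      case (Cons c u1)
      then have u1: "u = Lb # u1" using u T1 by simp
      define y where "y = rev (map swap u1)"
      have sd: "sdrop (Suc (Suc N)) xs = sdigits (map swap u1 @- La ## Lb ## R2)"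
        using t(2) u u1 T1 by (simp add: S1_def R2_def)
      have "cf_lambda xs (Suc N + 2 * length (map swap u1) + 2) \<le> 3"
        using le3[of "Suc N + 2 * length u1 + 1"] by (simp add: numeral_eq_Suc)
      then have le: "cfv (sdigits R2) \<le> cfF (digits y) (1 / (2 + pst N))"
        using junction_ab[OF sd] t(3) by (simp add: y_def)
      have yu: "map swap (rev u) = y @ [La]" using u1 by (simp add: y_def rev_map)
      consider "lex_gt (y @ [La]) R2" | "lex_lt (y @ [La]) R2" | R' where "R2 = (y @ [La]) @- R'" using lex_gt_lt_prefix_cases by blast
      then show ?thesis
      proof cases
        case 1
        then show ?thesis using lex_gt_map_swap[of "rev u" R] yu by (simp add: R2_def)
      next
        case 2
        then consider "lex_lt y R2" | R'' where "R2 = y @- Lb ## R''" using lex_lt_append_La by blast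
        then have False
        proof cases
          case 1 then show False using lex_lt_imp_cfv_greater[OF 1 p] le by simp
        next
          \<comment> \<open>The first difference would be at the first block. There the right side
            exceeds 1/2, while the past at \<open>N + 1\<close> is at most 1/2 because
            \<open>x_{N+1} = 2\<close>.\<close>
          case 2
          then have "cfv (sdigits (Lb ## R'')) \<le> 1 / (2 + pst N)" using prefix_cfv_le(2)[OF p, of y "Lb ## R''"] le by (simp del: sdigits_simps)
          then show False using cfv_Lb[of R''] t(3,4) by linarith
        qed
        then show ?thesis ..
      next
        case 3
        have "smap swap R2 = map swap (y @ [La]) @- smap swap R'" unfolding 3 by (rule smap_shift)
        then have "R = rev u @- smap swap R'" unfolding yu[symmetric] R2_def by (simp del: map_map)
        moreover have "pst N \<le> cfv (2 ## sdigits R')" using le prefix_La_cfv_le(2)[OF pst_bounds(1), of y R' N] 3 by simp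
        then have "pst N < cfv (2 ## sdigits R')" using pst_less_cfv[OF pos] by simp
        ultimately show ?thesis by (intro disjI2 exI[of _ "smap swap R'"]) simp
      qed
    qed
  qed
qed

text \<open>The hypothesis \<open>pst N \<le> 1 / 2\<close> serves the index \<open>N + 1\<close>
  when \<open>x_{N+2} = 2\<close>: no junction controls \<lambda> there.\<close>

lemma admissible_2_imp_le_3:
  assumes W: "2 ## cf_tail xs N = sdigits (smap swap T)" and b: "shd T = Lb"
    and A: "admissible T (\<lambda>R. pst N < cfv (2 ## sdigits (smap swap R)))" and h: "pst N \<le> 1 / 2" and n: "N \<le> n"
  shows "cf_lambda xs (Suc n) \<le> 3"
proof -
  obtain T1 where T1: "T = Lb ## T1" using b by (metis stream.collapse)
  define S1 where "S1 = smap swap T1"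
  have T1': "T1 = smap swap S1" by (simp add: S1_def)
  have S: "smap swap T = La ## S1" using T1 by (simp add: S1_def)
  have W': "2 ## cf_tail xs N = sdigits (La ## S1)" using W S by simp
  note t = tail_2[OF W']
  have p: "0 \<le> 1 / (2 + pst N)" "1 / (2 + pst N) \<le> 1" using pst_bounds[of "Suc N"] t(3) by auto
  have p2: "1 / (2 + pst N) \<le> 1 / 2" using t(3,4) by simp
  obtain e X where e: "S1 = e ## X" by (cases S1)
  show ?thesis
  proof (cases "n = N")
    case True
    show ?thesis
    proof (cases e)
      case La
      then have "sdrop (Suc (Suc N)) xs = 2 ## 2 ## sdigits X" using t(2) e by simp
      then have "dg (Suc (Suc N)) = 2" using sdrop_snth[of "Suc (Suc N)" xs 0] by (simp del: sdrop.simps snth.simps(2))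
      then have "fut (Suc N) < 1 / 2" by (rule fut_2)
      then show ?thesis using True lambda_fut[of N] t(1) h by (simp del: snth.simps)
    next
      case Lb
      have "T = [] @- Lb ## La ## smap swap X" using T1 T1' e Lb by simp
      then have "pst N < cfv (2 ## sdigits X)" using A unfolding admissible_def by fastforce
      then show ?thesis using True tail_2_start[of N X] W' e Lb by simp
    qed
  next
    case False
    show ?thesis
    proof (rule lambda_le_3I[of "Suc N" S1])
      show "sdrop (Suc (Suc N)) xs = sdigits S1" by (rule t)
      show "Suc N \<le> n" using n False by simp
      show "cf_lambda xs (Suc (Suc N)) \<le> 3" if "shd S1 = La"
      proof -
        have s: "sdrop (Suc (Suc N)) xs = 2 ## 2 ## sdigits X" using t(2) e that by simp
        have d: "dg (Suc (Suc N)) = 2" "dg (Suc (Suc (Suc N))) = 2"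
          using sdrop_snth[of "Suc (Suc N)" xs 0] sdrop_snth[of "Suc (Suc N)" xs 1] unfolding s by simp_all
        then show ?thesis using lambda_fut[of "Suc N"] fut_2(1)[of "Suc (Suc N)"] t(4) by (simp del: snth.simps)
      qed
      show "cfv (sdigits R) \<le> cfF (digits (rev u)) (pst (Suc N))" if u: "S1 = u @- La ## Lb ## R" for u R
      proof -
        let ?v = "map swap (La # u)"
        have "T = ?v @- Lb ## La ## smap swap R" using T1 T1' u by simp
        then have "lex_lt (rev ?v) (smap swap R) \<or> (\<exists>R'. smap swap R = rev ?v @- R' \<and> pst N < cfv (2 ## sdigits (smap swap R')))"
          using A unfolding admissible_def by blast
        moreover have "rev ?v = map swap (rev u @ [La])" by (simp add: rev_map)
        ultimately consider "lex_gt (rev u @ [La]) R"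
          | R' where "smap swap R = map swap (rev u @ [La]) @- R'" "pst N < cfv (2 ## sdigits (smap swap R'))"
          using lex_lt_map_swap by metis
        then show ?thesis
        proof cases
          case 1
          then show ?thesis using lex_gt_imp_cfv_less[OF lex_gt_append_La[OF 1] p] t(3) by simp
        next
          case 2
          have "R = smap swap (map swap (rev u @ [La]) @- R')" using 2(1) by (metis smap_swap_swap)
          also have "\<dots> = (rev u @ [La]) @- smap swap R'" unfolding smap_shift by (simp only: map_swap_swap)
          finally show ?thesis using 2(2) prefix_La_cfv_le(2)[OF pst_bounds(1), of "rev u" "smap swap R'" N] t(3) by simp
        qed
      qed
      show "cfF (digits (rev u)) (pst (Suc N)) \<le> cfv (sdigits R)" if u: "S1 = u @- Lb ## La ## R" for u R
      proof -
        let ?v = "map swap (La # u)"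
        have "T = ?v @- La ## Lb ## smap swap R" using T1 T1' u by simp
        then have "lex_gt (rev ?v) (smap swap R) \<or> (\<exists>R'. smap swap R = rev ?v @- R' \<and> \<not> pst N < cfv (2 ## sdigits (smap swap R')))"
          using A unfolding admissible_def by blast
        moreover have "rev ?v = map swap (rev u @ [La])" by (simp add: rev_map)
        ultimately consider "lex_lt (rev u @ [La]) R"
          | R' where "smap swap R = map swap (rev u @ [La]) @- R'" "\<not> pst N < cfv (2 ## sdigits (smap swap R'))"
          using lex_gt_map_swap by metis
        then show ?thesis
        proof cases
          case 1
          then consider "lex_lt (rev u) R" | R'' where "R = rev u @- Lb ## R''" using lex_lt_append_La by blast
          then show ?thesis
          proof cases
            case 1 then show ?thesis using lex_lt_imp_cfv_greater[OF 1 p] t(3) by simp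
          next
            case 2
            then show ?thesis using prefix_cfv_le(1)[OF p, of "rev u" "Lb ## R''"] cfv_Lb[of R''] p2 t(3) by (simp del: sdigits_simps)
          qed
        next
          case 2
          have "R = smap swap (map swap (rev u @ [La]) @- R')" using 2(1) by (metis smap_swap_swap)
          also have "\<dots> = (rev u @ [La]) @- smap swap R'" unfolding smap_shift by (simp only: map_swap_swap)
          finally show ?thesis using 2(2) prefix_La_cfv_le(1)[OF pst_bounds(1), of "rev u" N "smap swap R'"] t(3) by simp
        qed
      qed
    qed
  qed
qed

end

section \<open>Consequences of the minimality of \<open>N\<close>\<close>

context cf_tail_le_3
begin

lemma markov_tail_1:
  assumes d: "dg (Suc N) = 1"
  obtains T where "cf_tail xs N = sdigits T" "shd T = Lb" "markov T"
    "admissible T (\<lambda>R. pst N < cfv (sdigits R))"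
proof -
  obtain T where T: "cf_tail xs N = sdigits T" "shd T = Lb" using tail_blocks_1[OF d] by blast
  obtain R1 where R1: "T = Lb ## R1" using T(2) by (metis stream.collapse)
  have A: "admissible T (\<lambda>R. pst N < cfv (sdigits R))" using admissible_1[OF T(1) le3] .
  define r where "r = cfv (sdigits R1)"
  have r: "0 < r" unfolding r_def by (rule cfv_bounds) simp
  \<comment> \<open>With \<open>[0;1,1,R1] = 1 - [0;2,R1]\<close>, the inequality \<lambda>_N > 3
    says that \<open>[x_N; x_{N-1}, ...]\<close> exceeds \<open>[2;2,R1]\<close>; take
    reciprocals.\<close>
  have "pst N < cfv (sdigits (La ## R1))"
  proof (cases N)
    case 0 then show ?thesis using pst_0 cfv_bounds(1)[of "sdigits (La ## R1)"] by simp
  next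
    case (Suc M)
    have l: "3 < dg N + fut N + pst M" using minimal lambda_fut[of M] Suc by (simp del: snth.simps)
    have f: "fut N = 1 / (1 + 1 / (1 + r))" using T(1) R1 unfolding fut_def cf_tail_def r_def by (simp add: cfv_block(2)[simplified])
    have "1 / (1 + 1 / (1 + r)) = 1 - 1 / (2 + r)" using r by (simp add: divide_simps)
    then have "2 + 1 / (2 + r) < dg N + pst M" using l f by linarith
    then have "1 / (dg N + pst M) < 1 / (2 + 1 / (2 + r))" using r by (intro frac_less2) (auto intro!: add_pos_pos)
    then show ?thesis unfolding cfv_block r_def[symmetric] using pst_Suc[of M] Suc by simp
  qed
  then have "markov T" using admissible_imp_markov[OF A lex_cut_sdigits[OF pst_Rats] R1] by simp
  then show ?thesis using that T A by blast
qed

lemma markov_tail_2: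
  assumes d: "dg (Suc N) = 2"
  obtains T where "2 ## cf_tail xs N = sdigits (smap swap T)" "shd T = Lb" "markov T"
    "admissible T (\<lambda>R. pst N < cfv (2 ## sdigits (smap swap R)))"
proof -
  obtain S where S: "2 ## cf_tail xs N = sdigits S" "shd S = La" using tail_blocks_2[OF d] by blast
  obtain S1 where S1: "S = La ## S1" using S(2) by (metis stream.collapse)
  define T where "T = smap swap S"
  have T: "2 ## cf_tail xs N = sdigits (smap swap T)" "T = Lb ## smap swap S1" using S S1 by (simp_all add: T_def)
  have A: "admissible T (\<lambda>R. pst N < cfv (2 ## sdigits (smap swap R)))"
    by (rule admissible_2[OF T(1) le3]) (use T in simp_all)
  define r where "r = cfv (sdigits S1)"
  have r: "0 < r" unfolding r_def by (rule cfv_bounds) simp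
  \<comment> \<open>The same identity in the other direction,
    \<open>1 - [0;2,S1] = [0;1,1,S1]\<close>, bounds the past by \<open>[0;2,1,1,S1]\<close>. This
    is the value attached to \<open>a\<close> followed by the exchanged \<open>S1\<close>.\<close>
  have "pst N < cfv (2 ## sdigits (smap swap (La ## smap swap S1)))"
  proof (cases N)
    case 0 then show ?thesis using pst_0 cfv_bounds(1)[of "2 ## sdigits (smap swap (La ## smap swap S1))"] by simp
  next
    case (Suc M)
    have l: "3 < dg N + fut N + pst M" using minimal lambda_fut[of M] Suc by (simp del: snth.simps)
    have f: "fut N = 1 / (2 + r)" using S(1) S1 unfolding fut_def cf_tail_def r_def by (simp add: cfv_Stream)
    have e: "1 / (1 + 1 / (1 + r)) = 1 - 1 / (2 + r)" using r by (simp add: divide_simps)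
    have "2 + 1 / (1 + 1 / (1 + r)) < dg N + pst M" unfolding e using l f by linarith
    then have "1 / (dg N + pst M) < 1 / (2 + 1 / (1 + 1 / (1 + r)))" using r by (intro frac_less2) (auto intro!: add_pos_pos)
    then show ?thesis using pst_Suc[of M] Suc by (simp add: cfv_Stream r_def)
  qed
  then have "markov T" using admissible_imp_markov[OF A lex_cut_sdigits_swap[OF pst_Rats] T(2)] by simp
  moreover have "shd T = Lb" using T(2) by simp
  ultimately show ?thesis using that[OF T(1)] A by blast
qed

end

subsection \<open>Ultimately periodic words\<close>

lemma ultimately_periodic_sdrop: "ultimately_periodic (sdrop m s) \<longleftrightarrow> ultimately_periodic s"
proof
  assume "ultimately_periodic (sdrop m s)"
  then obtain k p where p: "p > 0" "\<And>n. n \<ge> k \<Longrightarrow> s !! (m + (n + p)) = s !! (m + n)"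
    unfolding ultimately_periodic_def by (auto simp: sdrop_snth)
  have "s !! (n + p) = s !! n" if "n \<ge> m + k" for n using p(2)[of "n - m"] that by simp
  then show "ultimately_periodic s" unfolding ultimately_periodic_def using p(1) by blast
next
  assume "ultimately_periodic s"
  then obtain k p where p: "p > 0" "\<And>n. n \<ge> k \<Longrightarrow> s !! (n + p) = s !! n"
    unfolding ultimately_periodic_def by blast
  have "sdrop m s !! (n + p) = sdrop m s !! n" if "n \<ge> k" for n
    using p(2)[of "m + n"] that by (simp add: sdrop_snth add.assoc)
  then show "ultimately_periodic (sdrop m s)" unfolding ultimately_periodic_def using p(1) by blast
qed

lemma ultimately_periodic_Stream: "ultimately_periodic (c ## s) \<longleftrightarrow> ultimately_periodic s"
  using ultimately_periodic_sdrop[of 1 "c ## s"] by simp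

lemma ultimately_periodic_smap: "ultimately_periodic s \<Longrightarrow> ultimately_periodic (smap f s)"
  unfolding ultimately_periodic_def by (metis snth_smap)

lemma ultimately_periodic_sdigits: "ultimately_periodic (sdigits S) \<longleftrightarrow> ultimately_periodic S"
proof
  assume "ultimately_periodic (sdigits S)"
  then obtain k p where p: "p > 0" "\<And>n. n \<ge> k \<Longrightarrow> sdigits S !! (n + p) = sdigits S !! n"
    unfolding ultimately_periodic_def by blast
  \<comment> \<open>The period of the digits may be odd; twice the period keeps in step with the
    blocks.\<close>
  have "S !! (n + p) = S !! n" if "n \<ge> k" for n
  proof -
    have "sdigits S !! (2 * n + p + p) = sdigits S !! (2 * n)"
      using p(2)[of "2 * n"] p(2)[of "2 * n + p"] that by simp
    moreover have "2 * n + p + p = 2 * (n + p)" by simp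
    ultimately have "sdigits S !! (2 * (n + p)) = sdigits S !! (2 * n)" by (simp only:)
    then show ?thesis unfolding snth_sdigits by (cases "S !! (n + p)"; cases "S !! n") auto
  qed
  then show "ultimately_periodic S" unfolding ultimately_periodic_def using p(1) by blast
next
  assume "ultimately_periodic S"
  then obtain k p where p: "p > 0" "\<And>n. n \<ge> k \<Longrightarrow> S !! (n + p) = S !! n"
    unfolding ultimately_periodic_def by blast
  have "sdigits S !! (n + 2 * p) = sdigits S !! n" if "n \<ge> 2 * k" for n
  proof (cases "even n")
    case True
    then obtain i where i: "n = 2 * i" by (elim evenE)
    then have "n + 2 * p = 2 * (i + p)" by simp
    then show ?thesis unfolding i using snth_sdigits(1)[of S "i + p"] snth_sdigits(1)[of S i] p(2)[of i] that i by simp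
  next
    case False
    then obtain i where i: "n = 2 * i + 1" by (elim oddE)
    then have "n + 2 * p = Suc (2 * (i + p))" "n = Suc (2 * i)" by auto
    then show ?thesis using snth_sdigits(2)[of S "i + p"] snth_sdigits(2)[of S i] p(2)[of i] that i
      by (simp del: snth.simps)
  qed
  then show "ultimately_periodic (sdigits S)" unfolding ultimately_periodic_def using p(1)
    by (intro exI[of _ "2 * k"] exI[of _ "2 * p"]) simp
qed

lemma ultimately_periodic_cycle:
  assumes "q \<noteq> []"
  shows "ultimately_periodic (cycle q)"
proof -
  have "cycle q !! (n + length q) = cycle q !! n" for n
    using sdrop_snth[of "length q" "cycle q" n] sdrop_cycle_eq[OF assms] by (simp add: add.commute)
  then show ?thesis unfolding ultimately_periodic_def
    using assms by (intro exI[of _ 0] exI[of _ "length q"]) simp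
qed

lemma ultimately_periodic_shift: "ultimately_periodic s \<Longrightarrow> ultimately_periodic (w @- s)"
  by (induction w) (auto simp: ultimately_periodic_Stream)

lemma word_tendsto_unique:
  assumes "word_tendsto w S" "word_tendsto w S'"
  shows "S = S'"
proof (rule stream_eq_stakeI)
  fix k
  have "\<forall>\<^sub>F n in sequentially. prefix (stake k S) (w n) \<and> prefix (stake k S') (w n)"
    using assms unfolding word_tendsto_def by (auto intro: eventually_conj)
  then obtain n where "prefix (stake k S) (w n)" "prefix (stake k S') (w n)"
    unfolding eventually_sequentially by blast
  then show "stake k S = stake k S'"
    by (metis length_stake order_refl prefix_length_prefix prefix_order.antisym)
qed

lemma word_tendsto_digits:
  assumes "word_tendsto w S"
  shows "word_tendsto (\<lambda>n. digits (w n)) (sdigits S)"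
  unfolding word_tendsto_def
proof
  fix k
  have "prefix (stake k (sdigits S)) (digits v)" if "prefix (stake k S) v" for v
  proof -
    have "prefix (stake k (sdigits S)) (stake (2 * k) (sdigits S))"
      by (metis min.absorb1 mult_2 le_add1 take_is_prefix take_stake)
    also have "\<dots> = digits (stake k S)" by (rule stake_sdigits)
    also have "prefix \<dots> (digits v)" using that by (auto simp: prefix_def)
    finally show ?thesis .
  qed
  then show "\<forall>\<^sub>F n in sequentially. prefix (stake k (sdigits S)) (digits (w n))"
    using assms unfolding word_tendsto_def by (metis (mono_tags, lifting) eventually_mono)
qed

lemma word_tendsto_map:
  assumes "word_tendsto w S"
  shows "word_tendsto (\<lambda>n. map f (w n)) (smap f S)"
  unfolding word_tendsto_def
proof
  fix k
  have "\<forall>\<^sub>F n in sequentially. prefix (stake k S) (w n)" using assms unfolding word_tendsto_def by blast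
  then show "\<forall>\<^sub>F n in sequentially. prefix (stake k (smap f S)) (map f (w n))"
    by (rule eventually_mono) (simp add: map_mono_prefix)
qed

lemma word_tendsto_Cons: "word_tendsto (\<lambda>n. c # w n) (c ## S) \<longleftrightarrow> word_tendsto w S"
proof
  assume h: "word_tendsto (\<lambda>n. c # w n) (c ## S)"
  show "word_tendsto w S" unfolding word_tendsto_def
  proof
    fix k
    have "\<forall>\<^sub>F n in sequentially. prefix (stake (Suc k) (c ## S)) (c # w n)" using h unfolding word_tendsto_def by blast
    then show "\<forall>\<^sub>F n in sequentially. prefix (stake k S) (w n)" by simp
  qed
next
  assume h: "word_tendsto w S"
  show "word_tendsto (\<lambda>n. c # w n) (c ## S)" unfolding word_tendsto_def
  proof
    fix k
    have "\<forall>\<^sub>F n in sequentially. prefix (stake (k - 1) S) (w n)" using h unfolding word_tendsto_def by blast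
    then show "\<forall>\<^sub>F n in sequentially. prefix (stake k (c ## S)) (c # w n)" by (cases k) simp_all
  qed
qed


section \<open>The periodic forms as words over the letters\<close>

definition christoffel_form :: "letter stream \<Rightarrow> bool" where
  "christoffel_form T \<longleftrightarrow> (\<exists>os. T = cycle (rev (bet os)) \<or> T = rev (bet os) @- cycle (rev (alp os)))"

lemma foldr_stsub_b: "foldr stsub os (cycle [Lb]) = cycle (rev (bet os))"
  by (simp add: foldr_stsub_cycle rev_bet)

lemma foldr_stsub_ba: "foldr stsub os (Lb ## cycle [La]) = rev (bet os) @- cycle (rev (alp os))"
  using foldr_stsub_shift[of os "[Lb]" "cycle [La]"] by (simp add: foldr_stsub_cycle rev_bet rev_alp)

lemma rev_bet_Cons: "\<exists>t. rev (bet os) = Lb # t"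
proof (induction os)
  case (Cons d os)
  then obtain t where "foldr ltsub os [Lb] = Lb # t" unfolding rev_bet by blast
  then show ?case by (cases d) (auto simp: rev_bet)
qed (simp add: alp_bet_Nil)

lemma christoffel_form_markov: "christoffel_form T \<Longrightarrow> markov T"
  unfolding christoffel_form_def foldr_stsub_b[symmetric] foldr_stsub_ba[symmetric]
  using markov_foldr_stsub markov_b markov_ba by blast

lemma christoffel_form_shd:
  assumes "christoffel_form T"
  shows "shd T = Lb"
proof -
  obtain os where os: "T = cycle (rev (bet os)) \<or> T = rev (bet os) @- cycle (rev (alp os))"
    using assms unfolding christoffel_form_def by blast
  have "cycle (rev (bet os)) = rev (bet os) @- cycle (rev (bet os))" by (rule cycle_decomp) simp
  then obtain Y where "T = rev (bet os) @- Y" using os by metis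
  then show ?thesis using rev_bet_Cons[of os] by auto
qed

lemma christoffel_form_periodic: "christoffel_form T \<Longrightarrow> ultimately_periodic T"
  unfolding christoffel_form_def
  by (auto intro!: ultimately_periodic_shift ultimately_periodic_cycle)

lemma markov_cases:
  assumes "markov T" "shd T = Lb"
  obtains "christoffel_form T"
  | d where "infinite {n. d n}" "infinite {n. \<not> d n}" "beta_limit d T"
proof -
  consider os where "T = foldr stsub os (cycle [Lb])" | os where "T = foldr stsub os (Lb ## cycle [La])"
    | d U where "infinite {n. d n}" "infinite {n. \<not> d n}"
        "\<And>n. T = foldr stsub (map d [0..<n]) (U n)" "\<And>n. shd (U n) = Lb"
    using markov_structure[OF assms] by blast
  then show ?thesis
  proof cases
    case 1 then show ?thesis using that(1) unfolding christoffel_form_def foldr_stsub_b by blast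
  next
    case 2 then show ?thesis using that(1) unfolding christoffel_form_def foldr_stsub_ba by blast
  next
    case 3
    have "\<exists>Y. T = rev (bet (map d [0..<n])) @- Y" for n
    proof -
      have "U n = [Lb] @- stl (U n)" using 3(4)[of n] by (metis shift.simps stream.collapse)
      then have "T = foldr ltsub (map d [0..<n]) [Lb] @- foldr stsub (map d [0..<n]) (stl (U n))"
        using 3(3)[of n] foldr_stsub_shift by metis
      then show ?thesis unfolding rev_bet by blast
    qed
    then show ?thesis using that(2) 3(1,2) unfolding beta_limit_def by blast
  qed
qed

lemma markov_periodic:
  assumes "markov T" "shd T = Lb" "ultimately_periodic T"
  shows "christoffel_form T"
  by (rule markov_cases[OF assms(1,2)]) (use beta_limit_not_periodic assms(3) in blast)+

lemma christoffel_form_swap: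
  "(\<exists>T. christoffel_form T \<and> S = smap swap T) \<longleftrightarrow>
    (\<exists>os. S = cycle (alp os) \<or> S = alp os @- cycle (bet os))"
proof -
  have s: "smap swap (cycle (rev (bet os))) = cycle (alp (map Not os))"
    "smap swap (rev (bet os) @- cycle (rev (alp os))) = alp (map Not os) @- cycle (bet (map Not os))" for os
    by (simp_all add: smap_cycle map_swap_rev_alp map_swap_rev_bet)
  show ?thesis
  proof
    assume "\<exists>T. christoffel_form T \<and> S = smap swap T"
    then show "\<exists>os. S = cycle (alp os) \<or> S = alp os @- cycle (bet os)"
      unfolding christoffel_form_def using s by auto
  next
    assume "\<exists>os. S = cycle (alp os) \<or> S = alp os @- cycle (bet os)"
    then obtain os where os: "S = cycle (alp os) \<or> S = alp os @- cycle (bet os)" by blast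
    have "map Not (map Not os) = os" by (simp add: comp_def)
    then have "S = smap swap (cycle (rev (bet (map Not os)))) \<or>
        S = smap swap (rev (bet (map Not os)) @- cycle (rev (alp (map Not os))))"
      using os s[of "map Not os"] by simp
    then show "\<exists>T. christoffel_form T \<and> S = smap swap T" unfolding christoffel_form_def by blast
  qed
qed

lemma sdigits_alp: "sdigits (alp os @- X) = 2 ## 2 ## digits (tl (alp os)) @- sdigits X"
  using alp_Cons[of os] by auto

text \<open>With the missing 2 restored, the last two forms read \<alpha>\<alpha>^\<infinity> =
  \<alpha>^\<infinity> and \<alpha>\<beta>^\<infinity>. These are the first two forms with exchanged
  letters.\<close>

lemma periodic_form_iff:
  "periodic_form W \<longleftrightarrow> (\<exists>T. christoffel_form T \<and> (W = sdigits T \<or> 2 ## W = sdigits (smap swap T)))"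
proof -
  have "periodic_form W \<longleftrightarrow> (\<exists>os. W = sdigits (cycle (rev (bet os))) \<or>
     W = sdigits (rev (bet os) @- cycle (rev (alp os))) \<or>
     W = 2 ## digits (tl (alp os)) @- sdigits (cycle (alp os)) \<or>
     W = 2 ## digits (tl (alp os)) @- sdigits (cycle (bet os)))"
    unfolding periodic_form_def using Pbar_iff by (auto simp del: sdigits_simps)
  also have "\<dots> \<longleftrightarrow> (\<exists>T. christoffel_form T \<and> W = sdigits T) \<or>
      (\<exists>os. 2 ## W = sdigits (cycle (alp os)) \<or> 2 ## W = sdigits (alp os @- cycle (bet os)))"
  proof -
    have "cycle (alp os) = alp os @- cycle (alp os)" for os by (rule cycle_decomp) simp
    then have "(2 ## W = sdigits (cycle (alp os))) = (W = 2 ## digits (tl (alp os)) @- sdigits (cycle (alp os)))" for os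
      by (metis sdigits_alp stream.inject)
    moreover have "(2 ## W = sdigits (alp os @- cycle (bet os))) = (W = 2 ## digits (tl (alp os)) @- sdigits (cycle (bet os)))" for os
      unfolding sdigits_alp by simp
    ultimately show ?thesis unfolding christoffel_form_def by (simp only:) blast
  qed
  also have "(\<exists>os. 2 ## W = sdigits (cycle (alp os)) \<or> 2 ## W = sdigits (alp os @- cycle (bet os))) \<longleftrightarrow>
      (\<exists>T. christoffel_form T \<and> 2 ## W = sdigits (smap swap T))"
  proof
    assume "\<exists>os. 2 ## W = sdigits (cycle (alp os)) \<or> 2 ## W = sdigits (alp os @- cycle (bet os))"
    then obtain S where S: "2 ## W = sdigits S" "\<exists>os. S = cycle (alp os) \<or> S = alp os @- cycle (bet os)" by metis
    from S(2) obtain T where "christoffel_form T" "S = smap swap T" unfolding christoffel_form_swap[symmetric] by blast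
    then show "\<exists>T. christoffel_form T \<and> 2 ## W = sdigits (smap swap T)" using S(1) by metis
  next
    assume "\<exists>T. christoffel_form T \<and> 2 ## W = sdigits (smap swap T)"
    then obtain T where T: "christoffel_form T" "2 ## W = sdigits (smap swap T)" by blast
    have "\<exists>os. smap swap T = cycle (alp os) \<or> smap swap T = alp os @- cycle (bet os)"
      using christoffel_form_swap[of "smap swap T"] T(1) by metis
    then show "\<exists>os. 2 ## W = sdigits (cycle (alp os)) \<or> 2 ## W = sdigits (alp os @- cycle (bet os))"
      using T(2) by metis
  qed
  finally show ?thesis by metis
qed

lemma factorization_iff_1: "factorization [Lb, La] (sdigits T) \<theta> R \<longleftrightarrow> mirrored T \<theta> R"
  unfolding factorization_def mirrored_def sdigits_inject ..

lemma factorization_iff_2: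
  "factorization [La, Lb] (sdigits (smap swap T)) \<theta> R \<longleftrightarrow> mirrored T (map swap \<theta>) (smap swap R)"
proof -
  have "smap swap T = X \<longleftrightarrow> T = smap swap X" for X by (metis smap_swap_swap)
  then show ?thesis unfolding factorization_def mirrored_def sdigits_inject by (simp add: rev_map)
qed

lemma longest_unique:
  assumes ex: "\<exists>\<theta> R. Q \<theta> R \<and> (\<forall>\<theta>' R'. Q \<theta>' R' \<longrightarrow> length \<theta>' \<le> length (\<theta> :: 'a list))"
    and uniq: "\<And>\<theta> R \<theta>' R'. Q \<theta> R \<Longrightarrow> Q \<theta>' R' \<Longrightarrow> length \<theta> = length \<theta>' \<Longrightarrow> \<theta> = \<theta>' \<and> R = R'"
  shows "\<exists>!(\<theta>, R). Q \<theta> R \<and> (\<forall>\<theta>' R'. Q \<theta>' R' \<longrightarrow> length \<theta>' \<le> length \<theta>)"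
proof -
  obtain \<theta> R where t: "Q \<theta> R" "\<And>\<theta>' R'. Q \<theta>' R' \<Longrightarrow> length \<theta>' \<le> length \<theta>" using ex by blast
  show ?thesis
  proof (rule ex1I[of _ "(\<theta>, R)"])
    fix p assume "case p of (\<theta>, R) \<Rightarrow> Q \<theta> R \<and> (\<forall>\<theta>' R'. Q \<theta>' R' \<longrightarrow> length \<theta>' \<le> length \<theta>)"
    moreover obtain \<theta>2 R2 where p: "p = (\<theta>2, R2)" by (cases p)
    ultimately have q: "Q \<theta>2 R2" "length \<theta> \<le> length \<theta>2" using t(1) by auto
    have "length \<theta>2 = length \<theta>" using q(2) t(2)[OF q(1)] by (rule order.antisym[rotated])
    then show "p = (\<theta>, R)" using uniq[OF q(1) t(1)] p by blast
  next
    show "case (\<theta>, R) of (\<theta>, R) \<Rightarrow> Q \<theta> R \<and> (\<forall>\<theta>' R'. Q \<theta>' R' \<longrightarrow> length \<theta>' \<le> length \<theta>)"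
      unfolding prod.case using t by blast
  qed
qed

lemma longest_factorization_unique_1:
  assumes "ultimately_periodic T" "markov T" "shd T = Lb" "T \<noteq> cycle [Lb]"
  shows "\<exists>!(\<theta>, R). longest_factorization [Lb, La] (sdigits T) \<theta> R"
  unfolding longest_factorization_def factorization_iff_1
  by (rule longest_unique[OF longest_mirrored_exists[OF assms]]) (use mirrored_same_length in blast)

lemma longest_factorization_unique_2:
  assumes "ultimately_periodic T" "markov T" "shd T = Lb" "T \<noteq> cycle [Lb]"
  shows "\<exists>!(\<theta>, R). longest_factorization [La, Lb] (sdigits (smap swap T)) \<theta> R"
  unfolding longest_factorization_def factorization_iff_2
proof (rule longest_unique)
  obtain \<theta> R where t: "mirrored T \<theta> R" "\<And>\<theta>' R'. mirrored T \<theta>' R' \<Longrightarrow> length \<theta>' \<le> length \<theta>"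
    using longest_mirrored_exists[OF assms] by blast
  have "length \<theta>' \<le> length (map swap \<theta>)" if "mirrored T (map swap \<theta>') R'" for \<theta>' R'
    using t(2)[OF that] by simp
  moreover have "mirrored T (map swap (map swap \<theta>)) (smap swap (smap swap R))"
    using t(1) by (simp only: map_swap_swap smap_swap_swap)
  ultimately show "\<exists>\<theta> R. mirrored T (map swap \<theta>) (smap swap R) \<and>
      (\<forall>\<theta>' R'. mirrored T (map swap \<theta>') (smap swap R') \<longrightarrow> length \<theta>' \<le> length \<theta>)" by blast
  fix \<theta> \<theta>' R R'
  assume "mirrored T (map swap \<theta>) (smap swap R)" "mirrored T (map swap \<theta>') (smap swap R')" "length \<theta> = length \<theta>'"
  then have "map swap \<theta> = map swap \<theta>'" "smap swap R = smap swap R'"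
    using mirrored_same_length[of T "map swap \<theta>" "smap swap R" "map swap \<theta>'" "smap swap R'"] by simp_all
  then show "\<theta> = \<theta>' \<and> R = R'" by (metis map_swap_swap smap_swap_swap)
qed

text \<open>This is why \<open>b^\<infinity>\<close> and, after the exchange,
  \<open>a^\<infinity>\<close> are excepted in the theorem.\<close>

lemma not_mirrored_b: "\<not> mirrored (cycle [Lb]) \<theta> R"
proof
  assume "mirrored (cycle [Lb]) \<theta> R"
  then have "La \<in> sset (cycle [Lb])" unfolding mirrored_def by (metis UnCI in_set_conv_decomp append_Cons append_Nil append.assoc sset_shift)
  then show False by simp
qed

lemma cf_stream_0: "pos_stream s \<Longrightarrow> cf_stream (0 ## s) = cfv s"
  using cf_stream_Stream[of s 0] by simp

lemma sdigits_cycle_swap: "sdigits (smap swap (cycle [Lb])) = sdigits (cycle [La])"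
  by (simp add: smap_cycle)

text \<open>A word consisting of digits 2 absorbs the prefixed 2, so the tail
  \<open>a^\<infinity>\<close> belongs to \<open>T = b^\<infinity>\<close>.\<close>

lemma sdigits_cycle_La: "2 ## W = sdigits (cycle [La]) \<longleftrightarrow> W = sdigits (cycle [La])"
proof -
  have two: "sdigits (cycle [La]) = 2 ## sdigits (cycle [La])"
  proof (rule snth_ext)
    fix n
    have all: "sdigits (cycle [La]) !! m = 2" for m
      using snth_sdigits[of "cycle [La]" "m div 2"]
      by (cases "even m") (auto elim!: evenE oddE simp flip: sconst_cycle)
    have "(2 ## sdigits (cycle [La])) !! n = 2"
      by (cases n) (simp, simp add: snth_Stream all del: snth.simps)
    then show "sdigits (cycle [La]) !! n = (2 ## sdigits (cycle [La])) !! n" using all[of n] by simp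
  qed
  show ?thesis by (metis two stream.inject)
qed

lemma Not_infinite:
  assumes "infinite {n. d n}" "infinite {n. \<not> d n}"
  shows "infinite {n. (Not \<circ> d) n}" "infinite {n. \<not> (Not \<circ> d) n}"
  using assms by simp_all

lemma map_Not_comp: "map (Not \<circ> d) ns = map Not (map d ns)" by simp

lemma digits_alp: "digits (alp os) = 2 # 2 # digits (tl (alp os))"
  using alp_Cons[of os] by auto

lemma aperiodic_formI_1:
  assumes "renormalization_sequence (\<lambda>n. (\<alpha> n, \<beta> n))" "xs !! (N + 1) = 1"
    "word_tendsto (\<lambda>n. digits (rev (\<beta> n))) (cf_tail xs N)"
    "word_tendsto \<alpha> L" "cf_past xs N < cf_stream (0 ## sdigits L)"
  shows "aperiodic_form xs N"
  unfolding aperiodic_form_def using assms by blast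

lemma aperiodic_formI_2:
  assumes "renormalization_sequence (\<lambda>n. (\<alpha> n, \<beta> n))" "xs !! (N + 1) = 2"
    "word_tendsto (\<lambda>n. 2 # digits (tl (\<alpha> n))) (cf_tail xs N)"
    "word_tendsto (\<lambda>n. rev (\<beta> n)) L" "cf_past xs N < cf_stream (0 ## 2 ## sdigits L)"
  shows "aperiodic_form xs N"
  unfolding aperiodic_form_def using assms by blast

section \<open>From the bound to the forms\<close>

context cf_tail_le_3
begin

lemma forward_periodic:
  assumes per: "ultimately_periodic xs"
  shows "periodic_form (cf_tail xs N) \<and>
         (N \<ge> 1 \<and> cf_tail xs N \<noteq> sdigits (cycle [La]) \<and>
          cf_tail xs N \<noteq> sdigits (cycle [Lb]) \<longrightarrow>
            (xs !! (N + 1) = 1 \<longrightarrow>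
               (\<exists>!(\<theta>, R). longest_factorization [Lb, La] (cf_tail xs N) \<theta> R) \<and>
               (\<forall>\<theta> R. factorization [Lb, La] (cf_tail xs N) \<theta> R \<longrightarrow>
                  cf_past xs N < cf_stream (0 ## sdigits R))) \<and>
            (xs !! (N + 1) = 2 \<longrightarrow>
               (\<exists>!(\<theta>, R). longest_factorization [La, Lb] (2 ## cf_tail xs N) \<theta> R) \<and>
               (\<forall>\<theta> R. factorization [La, Lb] (2 ## cf_tail xs N) \<theta> R \<longrightarrow>
                  cf_past xs N < cf_stream (0 ## 2 ## sdigits R))))"
proof -
  have pW: "ultimately_periodic (cf_tail xs N)" unfolding cf_tail_def using per ultimately_periodic_sdrop by blast
  consider "dg (N + 1) = 1" | "dg (N + 1) = 2" using dg_12[of N] by auto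
  then show ?thesis
  proof cases
    case 1
    then obtain T where T: "cf_tail xs N = sdigits T" "shd T = Lb" "markov T"
      "admissible T (\<lambda>R. pst N < cfv (sdigits R))" using markov_tail_1 by auto
    have pT: "ultimately_periodic T" using pW T(1) ultimately_periodic_sdigits by simp
    have "periodic_form (cf_tail xs N)"
      unfolding periodic_form_iff using markov_periodic[OF T(3,2) pT] T(1) by blast
    moreover have "\<exists>!(\<theta>, R). longest_factorization [Lb, La] (cf_tail xs N) \<theta> R"
      if "cf_tail xs N \<noteq> sdigits (cycle [Lb])"
      unfolding T(1) by (rule longest_factorization_unique_1[OF pT T(3,2)]) (use that T(1) in auto)
    moreover have "cf_past xs N < cf_stream (0 ## sdigits R)" if "factorization [Lb, La] (cf_tail xs N) \<theta> R" for \<theta> R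
      using that admissible_mirrored[OF T(4)] unfolding T(1) factorization_iff_1 by (simp add: cf_stream_0)
    ultimately show ?thesis using 1 by simp
  next
    case 2
    then obtain T where T: "2 ## cf_tail xs N = sdigits (smap swap T)" "shd T = Lb" "markov T"
      "admissible T (\<lambda>R. pst N < cfv (2 ## sdigits (smap swap R)))" using markov_tail_2 by auto
    have "ultimately_periodic (smap swap T)"
      using pW T(1) ultimately_periodic_sdigits ultimately_periodic_Stream by metis
    then have pT: "ultimately_periodic T" using ultimately_periodic_smap[of "smap swap T" swap] by simp
    have "periodic_form (cf_tail xs N)"
      unfolding periodic_form_iff using markov_periodic[OF T(3,2) pT] T(1) by blast
    moreover have "\<exists>!(\<theta>, R). longest_factorization [La, Lb] (2 ## cf_tail xs N) \<theta> R"
      if "cf_tail xs N \<noteq> sdigits (cycle [La])"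
    proof -
      have "T \<noteq> cycle [Lb]" using that T(1) sdigits_cycle_swap sdigits_cycle_La[of "cf_tail xs N"] by auto
      then show ?thesis unfolding T(1) by (rule longest_factorization_unique_2[OF pT T(3,2)])
    qed
    moreover have "cf_past xs N < cf_stream (0 ## 2 ## sdigits R)" if "factorization [La, Lb] (2 ## cf_tail xs N) \<theta> R" for \<theta> R
      using that admissible_mirrored[OF T(4)] unfolding T(1) factorization_iff_2 by (fastforce simp: cf_stream_0)
    ultimately show ?thesis using 2 by simp
  qed
qed

lemma forward_aperiodic:
  assumes per: "\<not> ultimately_periodic xs"
  shows "aperiodic_form xs N"
proof -
  have pW: "\<not> ultimately_periodic (cf_tail xs N)" unfolding cf_tail_def using per ultimately_periodic_sdrop by blast
  consider "dg (N + 1) = 1" | "dg (N + 1) = 2" using dg_12[of N] by auto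
  then show ?thesis
  proof cases
    case 1
    then obtain T where T: "cf_tail xs N = sdigits T" "shd T = Lb" "markov T"
      "admissible T (\<lambda>R. pst N < cfv (sdigits R))" using markov_tail_1 by auto
    have pT: "\<not> ultimately_periodic T" using pW T(1) ultimately_periodic_sdigits by simp
    obtain d where d: "infinite {n. d n}" "infinite {n. \<not> d n}" and S: "beta_limit d T"
      by (rule markov_cases[OF T(3,2)]) (use pT christoffel_form_periodic in blast)+
    obtain L where L: "alpha_limit d L" using alpha_limit_exists[OF d(1)] by blast
    have "pst N < cfv (sdigits L)"
      using mirrored_all_if_alpha_limit[OF d S L lex_cut_sdigits[OF pst_Rats[of N]]] admissible_mirrored[OF T(4)] by blast
    moreover have "word_tendsto (\<lambda>n. digits (rev (bet (map d [0..<n])))) (cf_tail xs N)"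
      unfolding T(1) using S beta_limit_iff[OF d(2)] by (intro word_tendsto_digits) blast
    moreover have "word_tendsto (\<lambda>n. alp (map d [0..<n])) L" using L alpha_limit_iff[OF d(1)] by blast
    ultimately show ?thesis
      using aperiodic_formI_1[OF renormalization_sequenceI[OF d] 1] cf_stream_0[OF pos_sdigits[of L]] by metis
  next
    case 2
    then obtain T where T: "2 ## cf_tail xs N = sdigits (smap swap T)" "shd T = Lb" "markov T"
      "admissible T (\<lambda>R. pst N < cfv (2 ## sdigits (smap swap R)))" using markov_tail_2 by auto
    have pT: "\<not> ultimately_periodic T"
      using pW T(1) ultimately_periodic_sdigits ultimately_periodic_Stream ultimately_periodic_smap by metis
    obtain d where d: "infinite {n. d n}" "infinite {n. \<not> d n}" and S: "beta_limit d T"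
      by (rule markov_cases[OF T(3,2)]) (use pT christoffel_form_periodic in blast)+
    obtain L where L: "alpha_limit d L" using alpha_limit_exists[OF d(1)] by blast
    \<comment> \<open>The exchange of letters interchanges \<open>U\<close> and \<open>V\<close>,
      and it interchanges \<alpha> with the reversed \<beta>; hence the complementary sequence of
      operations.\<close>
    let ?a = "\<lambda>n. alp (map (Not \<circ> d) [0..<n])" and ?b = "\<lambda>n. bet (map (Not \<circ> d) [0..<n])"
    have "pst N < cfv (2 ## sdigits (smap swap L))"
      using mirrored_all_if_alpha_limit[OF d S L lex_cut_sdigits_swap[OF pst_Rats[of N]]] admissible_mirrored[OF T(4)] by blast
    moreover have "word_tendsto (\<lambda>n. map swap (rev (bet (map d [0..<n])))) (smap swap T)"
      using S beta_limit_iff[OF d(2)] by (intro word_tendsto_map) blast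
    then have "word_tendsto ?a (smap swap T)" by (simp only: map_swap_rev_bet map_Not_comp)
    then have "word_tendsto (\<lambda>n. digits (?a n)) (2 ## cf_tail xs N)" unfolding T(1) by (rule word_tendsto_digits)
    then have "word_tendsto (\<lambda>n. 2 # digits (tl (?a n))) (cf_tail xs N)"
      unfolding digits_alp word_tendsto_Cons .
    moreover have "word_tendsto (\<lambda>n. map swap (alp (map d [0..<n]))) (smap swap L)"
      using L alpha_limit_iff[OF d(1)] by (intro word_tendsto_map) blast
    then have "word_tendsto (\<lambda>n. rev (?b n)) (smap swap L)"
      by (simp only: map_Not_comp map_swap_rev_alp[symmetric] rev_map rev_rev_ident)
    moreover have "cf_stream (0 ## 2 ## sdigits (smap swap L)) = cfv (2 ## sdigits (smap swap L))"
      by (rule cf_stream_0) simp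
    ultimately show ?thesis
      using aperiodic_formI_2[OF renormalization_sequenceI[of "Not \<circ> d", OF Not_infinite[OF d]] 2] by metis
  qed
qed

end

section \<open>From the forms to the bound\<close>

context cf_expansion
begin

lemma backward_1:
  assumes W: "cf_tail xs N = sdigits T" and T: "markov T" "shd T = Lb"
    and E: "\<And>\<theta> R. mirrored T \<theta> R \<Longrightarrow> pst N < cfv (sdigits R)"
  shows "finite (approx_solutions x) \<and> card (approx_solutions x) \<le> N"
  by (rule card_solutions_le, rule admissible_1_imp_le_3[OF W T(2) markov_imp_admissible[OF T(1) E]])

lemma backward_2:
  assumes W: "2 ## cf_tail xs N = sdigits (smap swap T)" and T: "markov T" "shd T = Lb"
    and E: "\<And>\<theta> R. mirrored T \<theta> R \<Longrightarrow> pst N < cfv (2 ## sdigits (smap swap R))"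
    and h: "pst N \<le> 1 / 2"
  shows "finite (approx_solutions x) \<and> card (approx_solutions x) \<le> N"
  by (rule card_solutions_le, rule admissible_2_imp_le_3[OF W T(2) markov_imp_admissible[OF T(1) E] h])

lemma cfv_2_less: "cfv (2 ## sdigits R) < 1 / 2"
  using cfv_bounds(1)[of "sdigits R"] by (simp add: cfv_Stream divide_simps)

text \<open>If the tail is \<open>2\<^sup>\<infinity>\<close> then \<open>\<lambda>\<^sub>N\<^sub>+\<^sub>1 > 3\<close> is possible, but only if \<open>x\<^sub>N = 1\<close>, and then \<open>\<lambda>\<^sub>N \<le> 3\<close>.\<close>

lemma backward_all_2:
  assumes W: "cf_tail xs N = sdigits (cycle [La])"
  shows "finite (approx_solutions x) \<and> card (approx_solutions x) \<le> N"
proof (cases "pst N \<le> 1 / 2")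
  case True
  show ?thesis
  proof (rule backward_2[of N "cycle [Lb]", OF _ markov_b _ _ True])
    show "2 ## cf_tail xs N = sdigits (smap swap (cycle [Lb]))"
      using W sdigits_cycle_La[of "cf_tail xs N"] sdigits_cycle_swap by simp
  qed (use not_mirrored_b in auto)
next
  case False
  then obtain M where M: "N = Suc M" using pst_0 by (cases N) auto
  have "dg N = 1" using False pst_ge2[of N] digit_pos[of N] M by (metis One_nat_def Suc_le_mono antisym_conv1 le0 linorder_not_le zless_add1_eq one_add_one)
  then have lN: "cf_lambda xs (Suc M) \<le> 3" using lambda_1[of M] M by simp
  have d: "dg (N + 1 + j) = 2" for j
  proof -
    have "dg (N + 1 + j) = sdigits (cycle [La]) !! j"
      using W unfolding cf_tail_def by (metis Suc_eq_plus1 sdrop_snth)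
    also have "\<dots> = 2" using snth_sdigits[of "cycle [La]" "j div 2"]
      by (cases "even j") (auto elim!: evenE oddE simp flip: sconst_cycle)
    finally show ?thesis .
  qed
  have "cf_lambda xs (Suc n) \<le> 3" if "Suc N \<le> n" for n
  proof -
    have "dg n = 2" "dg (Suc n) = 2" "dg (Suc (Suc n)) = 2"
      using d[of "n - N - 1"] d[of "n - N"] d[of "n - N + 1"] that by (simp_all del: snth.simps)
    moreover have "pst n \<le> 1 / 2" using calculation(1) that by (intro pst_ge2) auto
    ultimately show ?thesis using lambda_fut[of n] fut_2(1)[of "Suc n"] by (simp del: snth.simps)
  qed
  \<comment> \<open>The indices are shifted by one: \<open>M\<close> stands for \<lambda>_N and
    \<open>N\<close> for \<lambda>_{N+1}. The possible violation at \<open>N + 1\<close> is paid for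
    by the index \<open>N\<close>, and \<open>N\<close> indices remain.\<close>
  then have sub: "{n. 3 < cf_lambda xs (Suc n)} \<subseteq> {..N} - {M}"
    using lN by (auto simp: not_less_eq_eq[symmetric] simp flip: not_le)
  then have fin: "finite {n. 3 < cf_lambda xs (Suc n)}" by (rule finite_subset) simp
  have "card (approx_solutions x) \<le> card {n. 3 < cf_lambda xs (Suc n)}"
    unfolding approx_solutions_eq by (rule card_image_le[OF fin])
  also have "\<dots> \<le> card ({..N} - {M})" by (rule card_mono[OF _ sub]) simp
  also have "\<dots> = N" using M by simp
  finally show ?thesis using finite_solutions_iff fin by simp
qed

lemma backward_periodic:
  assumes P: "periodic_form (cf_tail xs N)"
    and L: "N \<ge> 1 \<and> cf_tail xs N \<noteq> sdigits (cycle [La]) \<and> cf_tail xs N \<noteq> sdigits (cycle [Lb]) \<longrightarrow>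
          (xs !! (N + 1) = 1 \<longrightarrow>
             (\<exists>\<theta> R. longest_factorization [Lb, La] (cf_tail xs N) \<theta> R \<and>
                cf_past xs N < cf_stream (0 ## sdigits R))) \<and>
          (xs !! (N + 1) = 2 \<longrightarrow>
             (\<exists>\<theta> R. longest_factorization [La, Lb] (2 ## cf_tail xs N) \<theta> R \<and>
                cf_past xs N < cf_stream (0 ## 2 ## sdigits R)))"
  shows "finite (approx_solutions x) \<and> card (approx_solutions x) \<le> N"
proof -
  obtain T where T: "christoffel_form T" "cf_tail xs N = sdigits T \<or> 2 ## cf_tail xs N = sdigits (smap swap T)"
    using P unfolding periodic_form_iff by blast
  have M: "markov T" and b: "shd T = Lb" using T(1) christoffel_form_markov christoffel_form_shd by auto
  obtain T1 where T1: "T = Lb ## T1" using b by (metis stream.collapse)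
  have hd: "dg (N + 1) = shd (cf_tail xs N)"
    using sdrop_snth[of "Suc N" xs 0] by (simp add: cf_tail_def)
  show ?thesis
  proof (cases "cf_tail xs N = sdigits T")
    case W: True
    have d: "dg (N + 1) = 1" using hd W T1 by simp
    show ?thesis
    proof (rule backward_1[OF W M b])
      fix \<theta> R assume m: "mirrored T \<theta> R"
      show "pst N < cfv (sdigits R)"
      proof (cases "N = 0")
        case True then show ?thesis using pst_0 cfv_bounds(1)[of "sdigits R"] by simp
      next
        case False
        have "T \<noteq> cycle [Lb]" using m not_mirrored_b by auto
        moreover have "T \<noteq> cycle [La]" using b by auto
        ultimately obtain \<theta>0 R0 where l: "longest_factorization [Lb, La] (sdigits T) \<theta>0 R0"
          "pst N < cf_stream (0 ## sdigits R0)"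
          using L False d unfolding W sdigits_inject by auto
        then have l': "mirrored T \<theta>0 R0" "\<And>\<theta>' R'. mirrored T \<theta>' R' \<Longrightarrow> length \<theta>' \<le> length \<theta>0"
          unfolding longest_factorization_def factorization_iff_1 by auto
        show ?thesis
          by (rule mirrored_all_if_longest[OF M lex_cut_sdigits[OF pst_Rats[of N]] l' _ m]) (use l in \<open>simp_all add: cf_stream_0\<close>)
      qed
    qed
  next
    case False
    then have W: "2 ## cf_tail xs N = sdigits (smap swap T)" using T(2) by blast
    then have W1: "cf_tail xs N = 2 ## sdigits (smap swap T1)" using T1 by simp
    have d: "dg (N + 1) = 2" using hd W1 by simp
    show ?thesis
    proof (cases "cf_tail xs N = sdigits (cycle [La])")
      case True then show ?thesis by (rule backward_all_2)
    next
      case nLa: False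
      have nb: "T \<noteq> cycle [Lb]" using nLa W sdigits_cycle_swap sdigits_cycle_La[of "cf_tail xs N"] by auto
      have nLb: "cf_tail xs N \<noteq> sdigits (cycle [Lb])"
        using W1 cycle_decomp[of "[Lb]"] by (metis block.simps(2) list.distinct(1) one_eq_numeral_iff sdigits_simps(1) semiring_norm(85) shift.simps stream.inject)
      have E: "pst N < cfv (2 ## sdigits (smap swap R))" if m: "mirrored T \<theta> R" for \<theta> R
      proof (cases "N = 0")
        case True then show ?thesis using pst_0 cfv_bounds(1)[of "2 ## sdigits (smap swap R)"] by simp
      next
        case False
        then obtain \<theta>0 R0 where l: "longest_factorization [La, Lb] (sdigits (smap swap T)) \<theta>0 R0"
          "pst N < cf_stream (0 ## 2 ## sdigits R0)"
          using L nLa nLb d unfolding W by auto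
        then have l': "mirrored T (map swap \<theta>0) (smap swap R0)"
          "\<And>\<theta>' R'. mirrored T (map swap \<theta>') (smap swap R') \<Longrightarrow> length \<theta>' \<le> length \<theta>0"
          unfolding longest_factorization_def factorization_iff_2 by auto
        have l2: "length \<theta>' \<le> length (map swap \<theta>0)" if "mirrored T \<theta>' R'" for \<theta>' R'
          using l'(2)[of "map swap \<theta>'" "smap swap R'"] that by (simp only: map_swap_swap smap_swap_swap length_map)
        show ?thesis
          by (rule mirrored_all_if_longest[OF M lex_cut_sdigits_swap[OF pst_Rats[of N]] l'(1) l2 _ m]) (use l in \<open>simp_all add: cf_stream_0\<close>)
      qed
      \<comment> \<open>A single factorization already bounds the past by 1/2, as
        \<open>[0;2,R] < 1/2\<close>. One exists because \<open>T\<close> is not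
        \<open>b^\<infinity>\<close>; the tail \<open>2^\<infinity>\<close> has none and was treated
        apart.\<close>
      obtain \<theta> R where "mirrored T \<theta> R" using markov_mirrored_exists[OF M b nb] by blast
      then have h: "pst N \<le> 1 / 2" using E[of \<theta> R] cfv_2_less[of "smap swap R"] by linarith
      show ?thesis by (rule backward_2[OF W M b _ h]) (rule E)
    qed
  qed
qed

lemma backward_aperiodic:
  assumes "aperiodic_form xs N"
  shows "finite (approx_solutions x) \<and> card (approx_solutions x) \<le> N"
proof -
  obtain \<alpha> \<beta> where r: "renormalization_sequence (\<lambda>n. (\<alpha> n, \<beta> n))"
    and c: "xs !! (N + 1) = 1 \<and>
        word_tendsto (\<lambda>n. digits (rev (\<beta> n))) (cf_tail xs N) \<and>
        (N \<ge> 1 \<longrightarrow> (\<exists>L. word_tendsto \<alpha> L \<and> cf_past xs N < cf_stream (0 ## sdigits L)))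
      \<or> xs !! (N + 1) = 2 \<and>
        word_tendsto (\<lambda>n. 2 # digits (tl (\<alpha> n))) (cf_tail xs N) \<and>
        (N \<ge> 1 \<longrightarrow> (\<exists>L. word_tendsto (\<lambda>n. rev (\<beta> n)) L \<and> cf_past xs N < cf_stream (0 ## 2 ## sdigits L)))"
    using assms unfolding aperiodic_form_def by blast
  obtain d where d: "infinite {n. d n}" "infinite {n. \<not> d n}"
    and ab: "\<And>n. \<alpha> n = alp (map d [0..<n])" "\<And>n. \<beta> n = bet (map d [0..<n])"
    using renormalization_sequenceD[OF r] by blast
  have abf: "\<alpha> = (\<lambda>n. alp (map d [0..<n]))" "\<beta> = (\<lambda>n. bet (map d [0..<n]))" using ab by auto
  from c show ?thesis
  proof (elim disjE conjE)
    assume w: "word_tendsto (\<lambda>n. digits (rev (\<beta> n))) (cf_tail xs N)"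
      and l: "N \<ge> 1 \<longrightarrow> (\<exists>L. word_tendsto \<alpha> L \<and> cf_past xs N < cf_stream (0 ## sdigits L))"
    obtain T where T: "beta_limit d T" using beta_limit_exists[OF d(2)] by blast
    have "word_tendsto (\<lambda>n. digits (rev (\<beta> n))) (sdigits T)"
      using T beta_limit_iff[OF d(2)] unfolding abf by (intro word_tendsto_digits) blast
    then have W: "cf_tail xs N = sdigits T" using w word_tendsto_unique by blast
    show ?thesis
    proof (rule backward_1[OF W markov_beta_limit[OF d(2) T] shd_beta_limit[OF T]])
      fix \<theta> R assume m: "mirrored T \<theta> R"
      show "pst N < cfv (sdigits R)"
      proof (cases "N = 0")
        case True then show ?thesis using pst_0 cfv_bounds(1)[of "sdigits R"] by simp
      next
        case False
        then obtain L where L: "word_tendsto \<alpha> L" "pst N < cf_stream (0 ## sdigits L)" using l by auto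
        have "alpha_limit d L" using L(1) alpha_limit_iff[OF d(1)] unfolding abf by blast
        then show ?thesis
          using mirrored_all_if_alpha_limit[OF d T _ lex_cut_sdigits[OF pst_Rats[of N]]] L(2) m by (auto simp: cf_stream_0)
      qed
    qed
  next
    assume w: "word_tendsto (\<lambda>n. 2 # digits (tl (\<alpha> n))) (cf_tail xs N)"
      and l: "N \<ge> 1 \<longrightarrow> (\<exists>L. word_tendsto (\<lambda>n. rev (\<beta> n)) L \<and> cf_past xs N < cf_stream (0 ## 2 ## sdigits L))"
    note d' = Not_infinite[OF d]
    have a': "alp (map (Not \<circ> d) [0..<n]) = map swap (rev (\<beta> n))"
      and b': "rev (bet (map (Not \<circ> d) [0..<n])) = map swap (\<alpha> n)" for n
      unfolding map_Not_comp ab by (simp_all only: map_swap_rev_bet map_swap_rev_alp[symmetric] rev_map rev_rev_ident)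
    obtain T where T: "beta_limit (Not \<circ> d) T" using beta_limit_exists[OF d'(2)] by blast
    have "word_tendsto (\<lambda>n. map swap (\<alpha> n)) T" using T beta_limit_iff[OF d'(2), of T] unfolding b' by blast
    then have "word_tendsto (\<lambda>n. map swap (map swap (\<alpha> n))) (smap swap T)" by (rule word_tendsto_map)
    then have "word_tendsto (\<lambda>n. digits (\<alpha> n)) (sdigits (smap swap T))"
      unfolding map_swap_swap by (rule word_tendsto_digits)
    moreover have "word_tendsto (\<lambda>n. 2 # (2 # digits (tl (\<alpha> n)))) (2 ## cf_tail xs N)"
      using w unfolding word_tendsto_Cons .
    then have "word_tendsto (\<lambda>n. digits (\<alpha> n)) (2 ## cf_tail xs N)" unfolding ab digits_alp .
    ultimately have W: "2 ## cf_tail xs N = sdigits (smap swap T)" using word_tendsto_unique by blast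
    have E: "(\<forall>\<theta> R. mirrored T \<theta> R \<longrightarrow> pst N < cfv (2 ## sdigits (smap swap R))) \<and> pst N \<le> 1 / 2"
    proof (cases "N = 0")
      case True
      have "0 < cfv (2 ## sdigits (smap swap R))" for R by (rule cfv_bounds) simp
      then show ?thesis using True pst_0 by simp
    next
      case False
      then obtain L where L: "word_tendsto (\<lambda>n. rev (\<beta> n)) L" "pst N < cf_stream (0 ## 2 ## sdigits L)" using l by auto
      then have p: "pst N < cfv (2 ## sdigits L)" by (simp add: cf_stream_0)
      have "word_tendsto (\<lambda>n. map swap (rev (\<beta> n))) (smap swap L)" using L(1) by (rule word_tendsto_map)
      then have "alpha_limit (Not \<circ> d) (smap swap L)" using alpha_limit_iff[OF d'(1), of "smap swap L"] unfolding a' by blast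
      then have "\<forall>\<theta> R. mirrored T \<theta> R \<longrightarrow> pst N < cfv (2 ## sdigits (smap swap R))"
        using mirrored_all_if_alpha_limit[OF d' T _ lex_cut_sdigits_swap[OF pst_Rats[of N]]] p by simp
      then show ?thesis using p cfv_2_less[of L] by auto
    qed
    then show ?thesis using backward_2[OF W markov_beta_limit[OF d'(2) T] shd_beta_limit[OF T]] by blast
  qed
qed

end

text \<open>Finitely many solutions mean finitely many indices with \<lambda> > 3, so the least
  bound exists; if it could be lowered past its own index, it would not be least.\<close>

lemma cf_tail_le_3_Least:
  assumes "x \<notin> \<rat>" "has_cf x xs" "finite (approx_solutions x)"
    and N: "N = (LEAST M. \<forall>n\<ge>M + 1. cf_lambda xs n \<le> 3)"
  shows "cf_tail_le_3 x xs N"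
proof -
  interpret cf_expansion x xs using assms by unfold_locales
  let ?P = "\<lambda>M. \<forall>n\<ge>M + 1. cf_lambda xs n \<le> 3"
  have "finite {n. 3 < cf_lambda xs (Suc n)}" using assms(3) finite_solutions_iff by simp
  then obtain M where M: "\<And>n. n \<in> {n. 3 < cf_lambda xs (Suc n)} \<Longrightarrow> n < M" by (metis finite_nat_set_iff_bounded)
  have "?P M"
  proof (intro allI impI)
    fix n assume "M + 1 \<le> n"
    then obtain m where m: "n = Suc m" "M \<le> m" by (cases n) auto
    then have "m \<notin> {n. 3 < cf_lambda xs (Suc n)}" using M[of m] by auto
    then show "cf_lambda xs n \<le> 3" using m by simp
  qed
  then have PN: "?P N" unfolding N by (rule LeastI)
  show ?thesis
  proof
    show "cf_lambda xs (Suc n) \<le> 3" if "N \<le> n" for n using PN that by simp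
    show "N = 0 \<or> 3 < cf_lambda xs N"
    proof (rule ccontr)
      assume "\<not> ?thesis"
      then obtain M' where M': "N = Suc M'" "cf_lambda xs (Suc M') \<le> 3" by (cases N) auto
      have "?P M'"
      proof (intro allI impI)
        fix n assume "M' + 1 \<le> n"
        then show "cf_lambda xs n \<le> 3" using PN M' by (cases "n = Suc M'") auto
      qed
      then have "N \<le> M'" unfolding N by (rule Least_le)
      then show False using M' by simp
    qed
  qed
qed

theorem theorem1p1:
  "(\<forall>x xs N.
      x \<notin> \<rat> \<and> has_cf x xs \<and> finite (approx_solutions x) \<and>
      N = (LEAST M. \<forall>n\<ge>M + 1. cf_lambda xs n \<le> 3) \<longrightarrow>
      (ultimately_periodic xs \<longrightarrow>
         periodic_form (cf_tail xs N) \<and>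
         (N \<ge> 1 \<and> cf_tail xs N \<noteq> sdigits (cycle [La]) \<and>
          cf_tail xs N \<noteq> sdigits (cycle [Lb]) \<longrightarrow>
            (xs !! (N + 1) = 1 \<longrightarrow>
               (\<exists>!(\<theta>, R). longest_factorization [Lb, La] (cf_tail xs N) \<theta> R) \<and>
               (\<forall>\<theta> R. factorization [Lb, La] (cf_tail xs N) \<theta> R \<longrightarrow>
                  cf_past xs N < cf_stream (0 ## sdigits R))) \<and>
            (xs !! (N + 1) = 2 \<longrightarrow>
               (\<exists>!(\<theta>, R). longest_factorization [La, Lb] (2 ## cf_tail xs N) \<theta> R) \<and>
               (\<forall>\<theta> R. factorization [La, Lb] (2 ## cf_tail xs N) \<theta> R \<longrightarrow>
                  cf_past xs N < cf_stream (0 ## 2 ## sdigits R))))) \<and>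
      (\<not> ultimately_periodic xs \<longrightarrow> aperiodic_form xs N)) \<and>
   (\<forall>x xs N.
      x \<notin> \<rat> \<and> has_cf x xs \<and>
      (periodic_form (cf_tail xs N) \<and>
       (N \<ge> 1 \<and> cf_tail xs N \<noteq> sdigits (cycle [La]) \<and>
        cf_tail xs N \<noteq> sdigits (cycle [Lb]) \<longrightarrow>
          (xs !! (N + 1) = 1 \<longrightarrow>
             (\<exists>\<theta> R. longest_factorization [Lb, La] (cf_tail xs N) \<theta> R \<and>
                cf_past xs N < cf_stream (0 ## sdigits R))) \<and>
          (xs !! (N + 1) = 2 \<longrightarrow>
             (\<exists>\<theta> R. longest_factorization [La, Lb] (2 ## cf_tail xs N) \<theta> R \<and>
                cf_past xs N < cf_stream (0 ## 2 ## sdigits R))))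
       \<or> aperiodic_form xs N) \<longrightarrow>
      finite (approx_solutions x) \<and> card (approx_solutions x) \<le> N)"
proof (intro conjI[of "\<forall>x xs N. _ x xs N"] allI impI, goal_cases)
  case (1 x xs N)
  then interpret cf_tail_le_3 x xs N using cf_tail_le_3_Least by blast
  show ?case using forward_periodic forward_aperiodic by blast
next
  case (2 x xs N)
  then interpret cf_expansion x xs by unfold_locales auto
  show ?case using 2 backward_periodic[of N] backward_aperiodic[of N] by blast
qed

end
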